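(* Let $(V,\sigma)$ be a braided vector space over $\mathbb{C}$ whose braiding $\sigma$ is of Hecke type with parameter $\nu\in\mathbb{C}^\ast$, $\nu$ not a root of unity, and suppose that for some $M$ one has $\dim S_\sigma^M(V)=1$ and $\dim S_\sigma^p(V)=0$ for all $p>M$. Then the space $\bigoplus_{p=0}^{M}\mathrm{End}\,S_\sigma^p(V)$ equipped with the third product $\times$ is an associative algebra with two-sided unit element $\mathrm{I}_0=(\mathrm{I}_0,0,\ldots,0)$.
   Context: A braiding on a complex vector space $V$ is an invertible $\sigma\in\mathrm{End}(V\otimes V)$ with $(\sigma\otimes \mathrm{id})(\mathrm{id}\otimes\sigma)(\sigma\otimes \mathrm{id})=(\mathrm{id}\otimes\sigma)(\sigma\otimes \mathrm{id})(\mathrm{id}\otimes\sigma)$; $(V,\sigma)$ is then a braided vector space. $\sigma$ is of Hecke type with parameter $\nu\in\mathbb{C}^\ast$ if $(\sigma+\mathrm{id})(\sigma-\nu\,\mathrm{id})=0$. On $V^{\otimes p}$ let $\sigma_i=\mathrm{id}^{\otimes(i-1)}\otimes\sigma\otimes\mathrm{id}^{\otimes(p-i-1)}$; for $w\in\mathfrak{S}_p$ with reduced expression $w=s_{i_1}\cdots s_{i_l}$ ($s_i=(i,i+1)$) let $T_w=\sigma_{i_1}\cdots\sigma_{i_l}$. Put $A^{(p)}=\sum_{w\in\mathfrak{S}_p}T_w$ and $S_\sigma^p(V)=\mathrm{Im}\,A^{(p)}\subset V^{\otimes p}$ (so $S^0_\sigma(V)=\mathbb{C}$, $S^1_\sigma(V)=V$).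 Let $\mathfrak{S}_{i,j}\subset\mathfrak{S}_{i+j}$ be the set of $w$ with $w(1)<\cdots<w(i)$ and $w(i+1)<\cdots<w(i+j)$. The quantum shuffle product is $sh=\sum_{w\in\mathfrak{S}_{i,j}}T_w: V^{\otimes i}\otimes V^{\otimes j}\to V^{\otimes(i+j)}$; it maps $S_\sigma^i(V)\otimes S_\sigma^j(V)$ to $S_\sigma^{i+j}(V)$. The deconcatenation $\delta_{i,j}:V^{\otimes(i+j)}\to V^{\otimes i}\otimes V^{\otimes j}$, $v_1\otimes\cdots\otimes v_{i+j}\mapsto(v_1\otimes\cdots\otimes v_i)\otimes(v_{i+1}\otimes\cdots\otimes v_{i+j})$, maps $S_\sigma^{i+j}(V)$ to $S_\sigma^i(V)\otimes S_\sigma^j(V)$. Elements of $\bigoplus_{p=0}^M\mathrm{End}\,S_\sigma^p(V)$ are written $\mathbf{A}=(A_0,\ldots,A_M)$. Composition product: $(\mathbf{A}\circ\mathbf{B})_p=A_p\circ B_p$. Convolution product: $(\mathbf{A}\ast\mathbf{B})_p=\sum_{l=0}^pA_l\ast B_{p-l}$, where $A_i\ast B_j=sh\circ(A_i\otimes B_j)\circ\delta_{i,j}\in\mathrm{End}\,S_\sigma^{i+j}(V)$. Let $\mathrm{I}_p$ be the identity of $S_\sigma^p(V)$. The convolution product is associative with unit $(\mathrm{I}_0,0,\ldots,0)$. Put $(n)_\nu=(1-\nu^n)/(1-\nu)$, $(n)_\nu!=(1)_\nu\cdots(n)_\nu$, $(0)_\nu!=1$. Let $e_\nu^{\ast\mathrm{I}_1}=(\mathrm{I}_0,\mathrm{I}_1,\ldots,\mathrm{I}_M)$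 (its $p$-th component equals $\frac1{(p)_\nu!}\mathrm{I}_1^{\ast p}$); it has a two-sided inverse for $\ast$, $(e_\nu^{\ast\mathrm{I}_1})^{-1}$, with $p$-th component $\frac{(-1)^p\nu^{p(p-1)/2}}{(p)_\nu!}\mathrm{I}_1^{\ast p}$. Define $\alpha(\mathbf{A})=\mathbf{A}\ast e_\nu^{\ast\mathrm{I}_1}$, a linear bijection with inverse $\alpha^{-1}(\mathbf{A})=\mathbf{A}\ast(e_\nu^{\ast\mathrm{I}_1})^{-1}$. The third product is $\mathbf{A}\times\mathbf{B}=\alpha^{-1}\big((\alpha\mathbf{A})\circ(\alpha\mathbf{B})\big)$. *)

theory Defs
  imports
    Complex_Main
    "HOL-Library.Function_Algebras"
    "HOL-Combinatorics.Permutations"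
    "HOL-Algebra.Module"
begin

section \<open>Tensor powers\<close>

text \<open>
  \<open>V\<close> is a complex vector space of arbitrary dimension, given by a scalar multiplication
  \<open>scale\<close> on the type \<open>'v\<close>.  Its tensor algebra is realised inside the dual of the space of
  multilinear forms: a form is a function on lists that is linear in every entry, the pure
  tensor \<open>v\<^sub>1 \<otimes> \<dots> \<otimes> v\<^sub>p\<close> is evaluation of forms at the list \<open>[v\<^sub>1, \<dots>, v\<^sub>p]\<close>, and
  \<open>V\<^bsup>\<otimes>p\<^esup>\<close> is the span of the pure tensors of length \<open>p\<close>.  Since forms separate the elements
  of the algebraic tensor power of a vector space, this span is the tensor power; its universal
  property is \<open>tensor_power_universal\<close> below.
\<close>

type_synonym 'v tensor = "('v list \<Rightarrow> complex) \<Rightarrow> complex"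

definition tscale :: "complex \<Rightarrow> ('a \<Rightarrow> complex) \<Rightarrow> ('a \<Rightarrow> complex)" where
  "tscale c t = (\<lambda>\<phi>. c * t \<phi>)"

interpretation tensor: vector_space "tscale :: complex \<Rightarrow> ('a \<Rightarrow> complex) \<Rightarrow> ('a \<Rightarrow> complex)"
  by unfold_locales (auto simp: tscale_def fun_eq_iff algebra_simps)

definition multilinear_form ::
    "(complex \<Rightarrow> 'v::ab_group_add \<Rightarrow> 'v) \<Rightarrow> ('v list \<Rightarrow> complex) \<Rightarrow> bool" where
  "multilinear_form scale \<phi> \<longleftrightarrow>
     (\<forall>us ws. Vector_Spaces.linear scale (*) (\<lambda>v. \<phi> (us @ [v] @ ws)))"

definition pure_tensor ::
    "(complex \<Rightarrow> 'v::ab_group_add \<Rightarrow> 'v) \<Rightarrow> 'v list \<Rightarrow> 'v tensor" where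
  "pure_tensor scale vs = (\<lambda>\<phi>. if multilinear_form scale \<phi> then \<phi> vs else 0)"

definition tensor_power ::
    "(complex \<Rightarrow> 'v::ab_group_add \<Rightarrow> 'v) \<Rightarrow> nat \<Rightarrow> 'v tensor set" where
  "tensor_power scale p = tensor.span (pure_tensor scale ` {vs. length vs = p})"

text \<open>
  The product of the tensor algebra; on pure tensors it is concatenation
  (\<open>tensor_mult_pure\<close>).
\<close>

definition tensor_mult ::
    "(complex \<Rightarrow> 'v::ab_group_add \<Rightarrow> 'v) \<Rightarrow> 'v tensor \<Rightarrow> 'v tensor \<Rightarrow> 'v tensor" where
  "tensor_mult scale x y =
     (\<lambda>\<phi>. if multilinear_form scale \<phi> then x (\<lambda>us. y (\<lambda>ws. \<phi> (us @ ws))) else 0)"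

text \<open>
  For subspaces \<open>W\<^sub>1 \<subseteq> V\<^bsup>\<otimes>i\<^esup>\<close> and \<open>W\<^sub>2 \<subseteq> V\<^bsup>\<otimes>j\<^esup>\<close> the space \<open>W\<^sub>1 \<otimes> W\<^sub>2\<close> is taken as a subspace of
  \<open>V\<^bsup>\<otimes>(i+j)\<^esup>\<close>, using the canonical identification of \<open>V\<^bsup>\<otimes>i\<^esup> \<otimes> V\<^bsup>\<otimes>j\<^esup>\<close> with \<open>V\<^bsup>\<otimes>(i+j)\<^esup>\<close>.  That
  identification is inverse to the deconcatenation \<open>\<delta>\<^sub>i\<^sub>,\<^sub>j\<close>, which therefore becomes the
  identity map of \<open>V\<^bsup>\<otimes>(i+j)\<^esup>\<close>.
\<close>

definition tensor_product ::
    "(complex \<Rightarrow> 'v::ab_group_add \<Rightarrow> 'v) \<Rightarrow> 'v tensor set \<Rightarrow> 'v tensor set \<Rightarrow> 'v tensor set" where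
  "tensor_product scale W1 W2 = tensor.span {tensor_mult scale x y |x y. x \<in> W1 \<and> y \<in> W2}"

text \<open>
  An endomorphism of a subspace is represented by the function that extends it by \<open>0\<close>, so that
  equality of endomorphisms is equality of functions.
\<close>

definition endos :: "'v tensor set \<Rightarrow> ('v tensor \<Rightarrow> 'v tensor) set" where
  "endos W = {f. (\<forall>x\<in>W. f x \<in> W) \<and> (\<forall>x\<in>W. \<forall>y\<in>W. f (x + y) = f x + f y) \<and>
     (\<forall>c. \<forall>x\<in>W. f (tscale c x) = tscale c (f x)) \<and> (\<forall>x. x \<notin> W \<longrightarrow> f x = 0)}"

definition id_on :: "'v tensor set \<Rightarrow> 'v tensor \<Rightarrow> 'v tensor" where
  "id_on W = (\<lambda>x. if x \<in> W then x else 0)"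

text \<open>
  \<open>tensor_map scale W\<^sub>1 f W\<^sub>2 g\<close> is \<open>f \<otimes> g\<close> on \<open>W\<^sub>1 \<otimes> W\<^sub>2\<close>; see \<open>tensor_map_unique_existence\<close>.
\<close>

definition tensor_map ::
    "(complex \<Rightarrow> 'v::ab_group_add \<Rightarrow> 'v) \<Rightarrow> 'v tensor set \<Rightarrow> ('v tensor \<Rightarrow> 'v tensor) \<Rightarrow>
     'v tensor set \<Rightarrow> ('v tensor \<Rightarrow> 'v tensor) \<Rightarrow> 'v tensor \<Rightarrow> 'v tensor" where
  "tensor_map scale W1 f W2 g =
     (THE h. h \<in> endos (tensor_product scale W1 W2) \<and>
        (\<forall>x\<in>W1. \<forall>y\<in>W2. h (tensor_mult scale x y) = tensor_mult scale (f x) (g y)))"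

text \<open>
  The library's \<open>dim\<close> is \<open>0\<close> on infinite-dimensional spaces, hence a relational version.
\<close>

definition has_dim :: "'v tensor set \<Rightarrow> nat \<Rightarrow> bool" where
  "has_dim W n \<longleftrightarrow>
     (\<exists>B. finite B \<and> card B = n \<and> tensor.independent B \<and> tensor.span B = W)"

subsection \<open>Adequacy of the encoding\<close>

lemma multilinear_form_append_left:
  assumes "multilinear_form scale \<phi>"
  shows "multilinear_form scale (\<lambda>ws. \<phi> (us @ ws))"
  unfolding multilinear_form_def
proof (intro allI)
  fix us' ws'
  show "Vector_Spaces.linear scale (*) (\<lambda>v. \<phi> (us @ us' @ [v] @ ws'))"
    using assms[unfolded multilinear_form_def, rule_format, of "us @ us'" ws'] by simp
qed

lemma multilinear_form_append_right:
  assumes "multilinear_form scale \<phi>"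
  shows "multilinear_form scale (\<lambda>us. \<phi> (us @ ws))"
  unfolding multilinear_form_def
proof (intro allI)
  fix us' ws'
  show "Vector_Spaces.linear scale (*) (\<lambda>v. \<phi> ((us' @ [v] @ ws') @ ws))"
    using assms[unfolded multilinear_form_def, rule_format, of us' "ws' @ ws"] by simp
qed

lemma tensor_mult_pure:
  "tensor_mult scale (pure_tensor scale us) (pure_tensor scale ws) = pure_tensor scale (us @ ws)"
proof
  fix \<phi> :: "'a list \<Rightarrow> complex"
  show "tensor_mult scale (pure_tensor scale us) (pure_tensor scale ws) \<phi> =
      pure_tensor scale (us @ ws) \<phi>"
  proof (cases "multilinear_form scale \<phi>")
    case True
    note * = multilinear_form_append_left[OF True] multilinear_form_append_right[OF True]
    show ?thesis by (simp add: tensor_mult_def pure_tensor_def True *)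
  qed (simp add: tensor_mult_def pure_tensor_def)
qed

lemma linear_functional_separation:
  fixes scale :: "complex \<Rightarrow> 'w::ab_group_add \<Rightarrow> 'w"
  assumes "vector_space scale" and "\<And>l. Vector_Spaces.linear scale (*) l \<Longrightarrow> l x = l y"
  shows "x = y"
proof (rule ccontr)
  assume "x \<noteq> y"
  interpret W: vector_space scale by fact
  interpret C: vector_space "(*) :: complex \<Rightarrow> complex \<Rightarrow> complex"
    by unfold_locales (auto simp: algebra_simps)
  interpret P: vector_space_pair scale "(*) :: complex \<Rightarrow> complex \<Rightarrow> complex" ..
  have "W.independent {x - y}" using \<open>x \<noteq> y\<close> by simp
  from P.linear_independent_extend[OF this, of "\<lambda>_. 1"]
  obtain l where l: "Vector_Spaces.linear scale (*) l" "l (x - y) = 1" by auto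
  interpret l: Vector_Spaces.linear scale "(*)" l by fact
  show False using assms(2)[OF l(1)] l(2) by (simp add: l.diff)
qed

lemma tensor_power_universal:
  fixes scale :: "complex \<Rightarrow> 'v::ab_group_add \<Rightarrow> 'v"
    and scale' :: "complex \<Rightarrow> 'w::ab_group_add \<Rightarrow> 'w"
  assumes V: "vector_space scale" and W: "vector_space scale'"
    and F: "\<And>us ws. length (us @ ws) + 1 = p \<Longrightarrow>
      Vector_Spaces.linear scale scale' (\<lambda>v. F (us @ [v] @ ws))"
  shows "\<exists>h. Vector_Spaces.linear tscale scale' h \<and>
      (\<forall>vs. length vs = p \<longrightarrow> h (pure_tensor scale vs) = F vs)"
    and "\<lbrakk>Vector_Spaces.linear tscale scale' h; Vector_Spaces.linear tscale scale' h';
      \<forall>vs. length vs = p \<longrightarrow> h (pure_tensor scale vs) = h' (pure_tensor scale vs);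
      t \<in> tensor_power scale p\<rbrakk> \<Longrightarrow> h t = h' t"
proof -
  interpret V: vector_space scale by fact
  interpret W: vector_space scale' by fact
  interpret C: vector_space "(*) :: complex \<Rightarrow> complex \<Rightarrow> complex"
    by unfold_locales (auto simp: algebra_simps)
  interpret P: vector_space_pair "tscale :: complex \<Rightarrow> 'v tensor \<Rightarrow> 'v tensor" scale' ..
  interpret Q: vector_space_pair "tscale :: complex \<Rightarrow> 'v tensor \<Rightarrow> 'v tensor"
    "(*) :: complex \<Rightarrow> complex \<Rightarrow> complex" ..
  let ?G = "pure_tensor scale ` {vs. length vs = p}"
  obtain B where B: "B \<subseteq> ?G" "tensor.independent B" "?G \<subseteq> tensor.span B"
    using tensor.maximal_independent_subset[of ?G] by blast
  define g where "g b = (SOME vs. length vs = p \<and> pure_tensor scale vs = b)" for b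
  have g: "length (g b) = p \<and> pure_tensor scale (g b) = b" if "b \<in> B" for b
    unfolding g_def by (rule someI_ex) (use that B(1) in auto)
  obtain h where h: "Vector_Spaces.linear tscale scale' h" "\<forall>b\<in>B. h b = F (g b)"
    using P.linear_independent_extend[OF B(2), of "\<lambda>b. F (g b)"] by blast
  have "h (pure_tensor scale vs) = F vs" if vs: "length vs = p" for vs
  proof (rule linear_functional_separation[OF W])
    fix l assume l: "Vector_Spaces.linear scale' (*) l"
    define \<phi> where "\<phi> vs = (if length vs = p then l (F vs) else 0)" for vs
    have \<phi>: "multilinear_form scale \<phi>"
      unfolding multilinear_form_def
    proof (intro allI)
      fix us ws
      show "Vector_Spaces.linear scale (*) (\<lambda>v. \<phi> (us @ [v] @ ws))"
      proof (cases "length (us @ ws) + 1 = p")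
        case True
        have "Vector_Spaces.linear scale (*) (l \<circ> (\<lambda>v. F (us @ [v] @ ws)))"
          by (rule Vector_Spaces.linear_compose[OF F[OF True] l])
        moreover have "(\<lambda>v. \<phi> (us @ [v] @ ws)) = l \<circ> (\<lambda>v. F (us @ [v] @ ws))"
          using True by (auto simp: \<phi>_def)
        ultimately show ?thesis by simp
      next
        case False
        then have "(\<lambda>v. \<phi> (us @ [v] @ ws)) = (\<lambda>v. 0)" by (auto simp: \<phi>_def)
        then show ?thesis
          by (simp only:) (unfold_locales, auto simp: algebra_simps)
      qed
    qed
    have ev: "Vector_Spaces.linear tscale (*) (\<lambda>t :: 'v tensor. t \<phi>)"
      by unfold_locales (auto simp: tscale_def algebra_simps)
    have lh: "Vector_Spaces.linear tscale (*) (l \<circ> h)"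
      by (rule Vector_Spaces.linear_compose[OF h(1) l])
    have "(l \<circ> h) (pure_tensor scale vs) = (\<lambda>t. t \<phi>) (pure_tensor scale vs)"
    proof (rule Q.linear_eq_on_span[OF lh ev])
      show "pure_tensor scale vs \<in> tensor.span B" using B(3) vs by auto
    next
      fix b assume b: "b \<in> B"
      have "b \<phi> = pure_tensor scale (g b) \<phi>" using g[OF b] by simp
      also have "\<dots> = \<phi> (g b)" using \<phi> by (simp add: pure_tensor_def)
      also have "\<dots> = l (F (g b))" using g[OF b] by (simp add: \<phi>_def)
      finally show "(l \<circ> h) b = b \<phi>" using h(2) b by simp
    qed
    then show "l (h (pure_tensor scale vs)) = l (F vs)"
      using \<phi> vs by (simp add: pure_tensor_def \<phi>_def)
  qed
  then show "\<exists>h. Vector_Spaces.linear tscale scale' h \<and>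
      (\<forall>vs. length vs = p \<longrightarrow> h (pure_tensor scale vs) = F vs)"
    using h(1) by blast
  show "h t = h' t" if "Vector_Spaces.linear tscale scale' h" "Vector_Spaces.linear tscale scale' h'"
      "\<forall>vs. length vs = p \<longrightarrow> h (pure_tensor scale vs) = h' (pure_tensor scale vs)"
      "t \<in> tensor_power scale p" for h h'
    by (rule P.linear_eq_on_span[OF that(1,2), of ?G])
      (use that(3,4) in \<open>auto simp: tensor_power_def\<close>)
qed

lemma pure_tensor_linear:
  assumes "vector_space scale"
  shows "Vector_Spaces.linear scale tscale (\<lambda>v. pure_tensor scale (us @ [v] @ ws))"
proof -
  interpret V: vector_space scale by fact
  have add: "\<phi> (us @ [v + w] @ ws) = \<phi> (us @ [v] @ ws) + \<phi> (us @ [w] @ ws)"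
    and mul: "\<phi> (us @ [scale c v] @ ws) = c * \<phi> (us @ [v] @ ws)"
    if "multilinear_form scale \<phi>" for \<phi> v w c
  proof -
    interpret l: Vector_Spaces.linear scale "(*)" "\<lambda>v. \<phi> (us @ [v] @ ws)"
      using that by (simp add: multilinear_form_def)
    show "\<phi> (us @ [v + w] @ ws) = \<phi> (us @ [v] @ ws) + \<phi> (us @ [w] @ ws)" by (rule l.add)
    show "\<phi> (us @ [scale c v] @ ws) = c * \<phi> (us @ [v] @ ws)" by (rule l.scale)
  qed
  show ?thesis
    by unfold_locales
      (use add mul in \<open>auto simp: fun_eq_iff pure_tensor_def tscale_def\<close>)
qed

lemma multilinear_form_add:
  assumes "multilinear_form scale \<phi>" "multilinear_form scale \<psi>"
  shows "multilinear_form scale (\<lambda>vs. \<phi> vs + \<psi> vs)"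
  unfolding multilinear_form_def
proof (intro allI)
  fix us ws
  interpret a: Vector_Spaces.linear scale "(*)" "\<lambda>v. \<phi> (us @ [v] @ ws)"
    using assms(1) by (simp add: multilinear_form_def)
  interpret b: Vector_Spaces.linear scale "(*)" "\<lambda>v. \<psi> (us @ [v] @ ws)"
    using assms(2) by (simp add: multilinear_form_def)
  show "Vector_Spaces.linear scale (*) (\<lambda>v. \<phi> (us @ [v] @ ws) + \<psi> (us @ [v] @ ws))"
    by unfold_locales (simp_all only: a.add b.add a.scale b.scale distrib_left add_ac)
qed

lemma multilinear_form_scale:
  assumes "multilinear_form scale \<phi>"
  shows "multilinear_form scale (\<lambda>vs. c * \<phi> vs)"
  unfolding multilinear_form_def
proof (intro allI)
  fix us ws
  interpret a: Vector_Spaces.linear scale "(*)" "\<lambda>v. \<phi> (us @ [v] @ ws)"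
    using assms(1) by (simp add: multilinear_form_def)
  show "Vector_Spaces.linear scale (*) (\<lambda>v. c * \<phi> (us @ [v] @ ws))"
    by unfold_locales (simp_all only: a.add a.scale distrib_left mult.left_commute)
qed

lemma tensor_power_induct [consumes 1, case_names zero add scale pure]:
  assumes "t \<in> tensor_power scale p"
    and "P 0"
    and "\<And>x y. x \<in> tensor_power scale p \<Longrightarrow> y \<in> tensor_power scale p \<Longrightarrow> P x \<Longrightarrow> P y \<Longrightarrow> P (x + y)"
    and "\<And>c x. x \<in> tensor_power scale p \<Longrightarrow> P x \<Longrightarrow> P (tscale c x)"
    and "\<And>vs. length vs = p \<Longrightarrow> P (pure_tensor scale vs)"
  shows "P t"
proof -
  have "t \<in> tensor_power scale p \<and> P t"
    using assms(1) unfolding tensor_power_def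
  proof (rule tensor.span_induct)
    show "tensor.subspace {t. t \<in> tensor.span (pure_tensor scale ` {vs. length vs = p}) \<and> P t}"
      using assms(2-4) unfolding tensor_power_def
      by (auto intro!: tensor.subspaceI tensor.span_zero tensor.span_add tensor.span_scale)
  qed (use assms(5) in \<open>auto intro: tensor.span_base\<close>)
  then show ?thesis ..
qed

lemma tensor_power_pure: "length vs = p \<Longrightarrow> pure_tensor scale vs \<in> tensor_power scale p"
  unfolding tensor_power_def by (auto intro: tensor.span_base)

lemma subspace_tensor_power: "tensor.subspace (tensor_power scale p)"
  unfolding tensor_power_def by (rule tensor.subspace_span)

lemma tensor_eval_add:
  assumes "x \<in> tensor_power scale p" "multilinear_form scale \<phi>" "multilinear_form scale \<psi>"
  shows "x (\<lambda>vs. \<phi> vs + \<psi> vs) = x \<phi> + x \<psi>"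
  using assms(1)
  by (induction rule: tensor_power_induct)
    (use assms(2,3) multilinear_form_add[OF assms(2,3)] in
      \<open>auto simp: tscale_def pure_tensor_def algebra_simps\<close>)

lemma tensor_eval_scale:
  assumes "x \<in> tensor_power scale p" "multilinear_form scale \<phi>"
  shows "x (\<lambda>vs. c * \<phi> vs) = c * x \<phi>"
  using assms(1)
  by (induction rule: tensor_power_induct)
    (use assms(2) multilinear_form_scale[OF assms(2)] in
      \<open>auto simp: tscale_def pure_tensor_def algebra_simps\<close>)

lemma multilinear_form_eval:
  assumes "vector_space scale" "y \<in> tensor_power scale p" "multilinear_form scale \<phi>"
  shows "multilinear_form scale (\<lambda>us. y (\<lambda>ws. \<phi> (us @ ws)))"
proof -
  interpret vector_space scale by fact
  interpret C: vector_space "(*) :: complex \<Rightarrow> complex \<Rightarrow> complex"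
    by unfold_locales (auto simp: algebra_simps)
  have *: "multilinear_form scale (\<lambda>us. 0)"
    unfolding multilinear_form_def by (intro allI, unfold_locales) auto
  show ?thesis
    using assms(2)
  proof (induction rule: tensor_power_induct)
    case (pure vs)
    then show ?case
      using multilinear_form_append_left[OF assms(3)] multilinear_form_append_right[OF assms(3)]
      by (simp add: pure_tensor_def)
  next
    case zero
    show ?case using * by simp
  next
    case (add x y)
    show ?case using multilinear_form_add[OF add(3,4)] by simp
  next
    case (scale c x)
    show ?case using multilinear_form_scale[OF scale(2), of c] by (simp add: tscale_def)
  qed
qed

lemma tensor_mult_add_left:
  "tensor_mult scale (x + x') y = tensor_mult scale x y + tensor_mult scale x' y"
  by (auto simp: tensor_mult_def fun_eq_iff)

lemma tensor_mult_scale_left: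
  "tensor_mult scale (tscale c x) y = tscale c (tensor_mult scale x y)"
  by (auto simp: tensor_mult_def fun_eq_iff tscale_def)

lemma tensor_mult_add_right:
  assumes "vector_space scale" "x \<in> tensor_power scale p"
    "y \<in> tensor_power scale q" "y' \<in> tensor_power scale q"
  shows "tensor_mult scale x (y + y') = tensor_mult scale x y + tensor_mult scale x y'"
  using tensor_eval_add[OF assms(2)] multilinear_form_eval[OF assms(1)] assms(3,4)
  by (auto simp: tensor_mult_def fun_eq_iff)

lemma tensor_mult_scale_right:
  assumes "vector_space scale" "x \<in> tensor_power scale p" "y \<in> tensor_power scale q"
  shows "tensor_mult scale x (tscale c y) = tscale c (tensor_mult scale x y)"
  using tensor_eval_scale[OF assms(2)] multilinear_form_eval[OF assms(1)] assms(3)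
  by (auto simp: tensor_mult_def fun_eq_iff tscale_def)

lemma endos_extend:
  assumes W: "tensor.subspace W" "W \<subseteq> tensor_power scale p" and f: "f \<in> endos W"
  obtains f' where "Vector_Spaces.linear tscale tscale f'" "\<And>x. x \<in> W \<Longrightarrow> f' x = f x"
    "\<And>x. f' x \<in> W"
proof -
  interpret P: vector_space_pair "tscale :: complex \<Rightarrow> 'a tensor \<Rightarrow> 'a tensor"
    "tscale :: complex \<Rightarrow> 'a tensor \<Rightarrow> 'a tensor" ..
  obtain B where B: "B \<subseteq> W" "tensor.independent B" "W \<subseteq> tensor.span B"
    using tensor.maximal_independent_subset[of W] by blast
  have span: "tensor.span B = W" using B tensor.span_minimal[OF B(1) W(1)] by auto
  obtain f' where f': "Vector_Spaces.linear tscale tscale f'" "\<forall>x\<in>B. f' x = f x"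
    "range f' = tensor.span (f ` B)"
    using P.linear_independent_extend_subspace[OF B(2), of f] by blast
  interpret f': Vector_Spaces.linear tscale tscale f' by fact
  have f0: "f 0 = 0"
  proof -
    have "0 \<in> W" using tensor.subspace_0[OF W(1)] .
    then have "f (0 + 0) = f 0 + f 0" using f unfolding endos_def by blast
    then show ?thesis by simp
  qed
  have "f' x = f x" if "x \<in> W" for x
  proof -
    have "x \<in> W \<and> f' x = f x"
      using that[folded span]
    proof (rule tensor.span_induct)
      show "tensor.subspace {x. x \<in> W \<and> f' x = f x}"
        using f W(1) f0
        by (auto intro!: tensor.subspaceI simp: tensor.subspace_0 tensor.subspace_add
            tensor.subspace_scale endos_def f'.add f'.scale f'.zero)
    qed (use f'(2) B(1) in auto)
    then show ?thesis ..
  qed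
  moreover have "f' x \<in> W" for x
  proof -
    have "f' x \<in> tensor.span (f ` B)" using f'(3) by auto
    moreover have "tensor.span (f ` B) \<subseteq> W"
      by (rule tensor.span_minimal[OF _ W(1)]) (use f B(1) in \<open>auto simp: endos_def\<close>)
    ultimately show ?thesis by auto
  qed
  ultimately show thesis using that f'(1) by blast
qed

lemma tensor_map_unique_existence:
  assumes V: "vector_space scale"
    and W1: "tensor.subspace W1" "W1 \<subseteq> tensor_power scale i"
    and W2: "tensor.subspace W2" "W2 \<subseteq> tensor_power scale j"
    and f: "f \<in> endos W1" and g: "g \<in> endos W2"
  shows "\<exists>!h. h \<in> endos (tensor_product scale W1 W2) \<and>
    (\<forall>x\<in>W1. \<forall>y\<in>W2. h (tensor_mult scale x y) = tensor_mult scale (f x) (g y))"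
proof -
  interpret V: vector_space scale by fact
  obtain f' where f': "Vector_Spaces.linear tscale tscale f'" "\<And>x. x \<in> W1 \<Longrightarrow> f' x = f x"
    "\<And>x. f' x \<in> W1"
    using endos_extend[OF W1 f] by blast
  obtain g' where g': "Vector_Spaces.linear tscale tscale g'" "\<And>x. x \<in> W2 \<Longrightarrow> g' x = g x"
    "\<And>x. g' x \<in> W2"
    using endos_extend[OF W2 g] by blast
  interpret f': Vector_Spaces.linear tscale tscale f' by (rule f')
  interpret g': Vector_Spaces.linear tscale tscale g' by (rule g')
  have f'T: "f' x \<in> tensor_power scale i" for x using f'(3) W1(2) by auto
  have g'T: "g' x \<in> tensor_power scale j" for x using g'(3) W2(2) by auto
  define F where "F vs = tensor_mult scale (f' (pure_tensor scale (take i vs)))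
    (g' (pure_tensor scale (drop i vs)))" for vs
  have F: "Vector_Spaces.linear scale tscale (\<lambda>v. F (us @ [v] @ ws))"
    if "length (us @ ws) + 1 = i + j" for us ws
  proof (cases "length us < i")
    case True
    interpret l: Vector_Spaces.linear scale tscale
      "\<lambda>v. pure_tensor scale (us @ [v] @ take (i - Suc (length us)) ws)"
      by (rule pure_tensor_linear[OF V])
    have eq: "F (us @ [v] @ ws) = tensor_mult scale
        (f' (pure_tensor scale (us @ [v] @ take (i - Suc (length us)) ws)))
        (g' (pure_tensor scale (drop (i - Suc (length us)) ws)))" for v
      using True by (simp add: F_def take_Cons' drop_Cons')
    show ?thesis
      unfolding eq
      by unfold_locales
        (simp_all only: l.add l.scale f'.add f'.scale tensor_mult_add_left tensor_mult_scale_left)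
  next
    case False
    interpret l: Vector_Spaces.linear scale tscale
      "\<lambda>v. pure_tensor scale (drop i us @ [v] @ ws)"
      by (rule pure_tensor_linear[OF V])
    have eq: "F (us @ [v] @ ws) = tensor_mult scale
        (f' (pure_tensor scale (take i us)))
        (g' (pure_tensor scale (drop i us @ [v] @ ws)))" for v
      using False by (simp add: F_def)
    show ?thesis
      unfolding eq
      by unfold_locales
        (simp_all only: l.add l.scale g'.add g'.scale tensor_mult_add_right[OF V f'T g'T g'T]
          tensor_mult_scale_right[OF V f'T g'T])
  qed
  obtain h where h: "Vector_Spaces.linear tscale tscale h"
    "\<And>vs. length vs = i + j \<Longrightarrow> h (pure_tensor scale vs) = F vs"
    using tensor_power_universal(1)[OF V tensor.vector_space_axioms F] by blast
  interpret h: Vector_Spaces.linear tscale tscale h by (rule h)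
  have z: "tensor_mult scale 0 y = 0" for y
    by (simp add: tensor_mult_def fun_eq_iff)
  have z': "tensor_mult scale x 0 = 0" if "x \<in> tensor_power scale i" for x
    using tensor_mult_add_right[OF V that, of 0 j 0] tensor.subspace_0[OF subspace_tensor_power, of scale j]
    by (metis add.right_neutral add_left_cancel)
  have h1: "h (tensor_mult scale (pure_tensor scale us) y) =
      tensor_mult scale (f' (pure_tensor scale us)) (g' y)"
    if "length us = i" "y \<in> tensor_power scale j" for us y
    using that(2)
  supply us = tensor_power_pure[OF that(1), of scale]
  proof (induction rule: tensor_power_induct)
    case zero
    show ?case by (simp only: z'[OF us] z'[OF f'T] h.zero g'.zero)
  next
    case (add x y)
    then show ?case
      by (simp only: tensor_mult_add_right[OF V us add(1,2)] h.add g'.add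
          tensor_mult_add_right[OF V f'T g'T g'T])
  next
    case (scale c x)
    then show ?case
      by (simp only: tensor_mult_scale_right[OF V us scale(1)] h.scale g'.scale
          tensor_mult_scale_right[OF V f'T g'T])
  next
    case (pure ws)
    then show ?case using that(1) h(2)[of "us @ ws"] by (simp add: tensor_mult_pure F_def)
  qed
  have h2: "h (tensor_mult scale x y) = tensor_mult scale (f' x) (g' y)"
    if "x \<in> tensor_power scale i" "y \<in> tensor_power scale j" for x y
    using that(1)
    by (induction rule: tensor_power_induct)
      (simp_all only: z h.add h.scale h.zero f'.add f'.scale f'.zero
        tensor_mult_add_left tensor_mult_scale_left h1 that(2))
  have h3: "h (tensor_mult scale x y) = tensor_mult scale (f x) (g y)"
    if "x \<in> W1" "y \<in> W2" for x y
    using h2[of x y] that f'(2) g'(2) W1(2) W2(2) by auto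
  let ?G = "{tensor_mult scale x y |x y. x \<in> W1 \<and> y \<in> W2}"
  let ?W = "tensor_product scale W1 W2"
  have subW: "tensor.subspace ?W" unfolding tensor_product_def by (rule tensor.subspace_span)
  have G: "tensor_mult scale x y \<in> ?W" if "x \<in> W1" "y \<in> W2" for x y
    unfolding tensor_product_def using that by (auto intro!: tensor.span_base)
  have hW: "h x \<in> ?W" if "x \<in> ?W" for x
    using that[unfolded tensor_product_def]
  proof (rule tensor.span_induct)
    show "tensor.subspace {x. h x \<in> ?W}"
      using subW by (auto intro!: tensor.subspaceI simp: h.add h.scale h.zero tensor.subspace_0
          tensor.subspace_add tensor.subspace_scale)
    fix x assume "x \<in> ?G"
    then show "h x \<in> ?W" using h3 G f g by (auto simp: endos_def)
  qed
  show ?thesis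
  proof (rule ex1I)
    show "(\<lambda>x. if x \<in> ?W then h x else 0) \<in> endos ?W \<and> (\<forall>x\<in>W1. \<forall>y\<in>W2.
        (if tensor_mult scale x y \<in> ?W then h (tensor_mult scale x y) else 0) =
        tensor_mult scale (f x) (g y))"
      using hW G h3 subW
      by (auto simp: endos_def h.add h.scale tensor.subspace_add tensor.subspace_scale)
  next
    fix k assume k: "k \<in> endos ?W \<and>
      (\<forall>x\<in>W1. \<forall>y\<in>W2. k (tensor_mult scale x y) = tensor_mult scale (f x) (g y))"
    have k0: "k 0 = 0"
    proof -
      have "0 \<in> ?W" using tensor.subspace_0[OF subW] .
      then have "k (0 + 0) = k 0 + k 0" using k unfolding endos_def by blast
      then show ?thesis by simp
    qed
    have "k x = h x" if "x \<in> ?W" for x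
    proof -
      have "x \<in> ?W \<and> k x = h x"
        using that[unfolded tensor_product_def]
      proof (rule tensor.span_induct)
        show "tensor.subspace {x. x \<in> ?W \<and> k x = h x}"
          using k subW k0
          by (auto intro!: tensor.subspaceI simp: tensor.subspace_0 tensor.subspace_add
              tensor.subspace_scale endos_def h.add h.scale h.zero)
      qed (use k h3 G in auto)
      then show ?thesis ..
    qed
    then show "k = (\<lambda>x. if x \<in> ?W then h x else 0)"
      using k by (auto simp: endos_def fun_eq_iff)
  qed
qed


section \<open>Braided vector spaces and quantum symmetric powers\<close>

definition braiding ::
    "(complex \<Rightarrow> 'v::ab_group_add \<Rightarrow> 'v) \<Rightarrow> ('v tensor \<Rightarrow> 'v tensor) \<Rightarrow> bool" where
  "braiding scale \<sigma> \<longleftrightarrow>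
     \<sigma> \<in> endos (tensor_power scale 2) \<and>
     bij_betw \<sigma> (tensor_power scale 2) (tensor_power scale 2) \<and>
     (let V = tensor_power scale 1;
          V2 = tensor_power scale 2;
          \<sigma>_id = tensor_map scale V2 \<sigma> V (id_on V);
          id_\<sigma> = tensor_map scale V (id_on V) V2 \<sigma>
      in \<sigma>_id \<circ> id_\<sigma> \<circ> \<sigma>_id = id_\<sigma> \<circ> \<sigma>_id \<circ> id_\<sigma>)"

definition hecke_type ::
    "(complex \<Rightarrow> 'v::ab_group_add \<Rightarrow> 'v) \<Rightarrow> ('v tensor \<Rightarrow> 'v tensor) \<Rightarrow> complex \<Rightarrow> bool" where
  "hecke_type scale \<sigma> \<nu> \<longleftrightarrow> \<nu> \<noteq> 0 \<and>
     (\<forall>x\<in>tensor_power scale 2. let y = \<sigma> x - tscale \<nu> x in \<sigma> y + y = 0)"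

definition sigma_at ::
    "(complex \<Rightarrow> 'v::ab_group_add \<Rightarrow> 'v) \<Rightarrow> ('v tensor \<Rightarrow> 'v tensor) \<Rightarrow> nat \<Rightarrow> nat \<Rightarrow>
     'v tensor \<Rightarrow> 'v tensor" where
  "sigma_at scale \<sigma> p i =
     (let V = tensor_power scale in
      tensor_map scale (V (i - 1)) (id_on (V (i - 1)))
        (V (p - i + 1)) (tensor_map scale (V 2) \<sigma> (V (p - i - 1)) (id_on (V (p - i - 1)))))"

text \<open>Permutations act on \<open>{1..p}\<close> and are multiplied as functions.\<close>

definition word_perm :: "nat list \<Rightarrow> nat \<Rightarrow> nat" where
  "word_perm is = foldr (\<lambda>i w. Transposition.transpose i (i + 1) \<circ> w) is id"

definition reduced_word :: "nat \<Rightarrow> (nat \<Rightarrow> nat) \<Rightarrow> nat list \<Rightarrow> bool" where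
  "reduced_word p w is \<longleftrightarrow>
     set is \<subseteq> {1..<p} \<and> word_perm is = w \<and>
     (\<forall>js. set js \<subseteq> {1..<p} \<and> word_perm js = w \<longrightarrow> length is \<le> length js)"

text \<open>By Matsumoto's theorem \<open>T_perm\<close> does not depend on the chosen reduced expression.\<close>

definition T_perm ::
    "(complex \<Rightarrow> 'v::ab_group_add \<Rightarrow> 'v) \<Rightarrow> ('v tensor \<Rightarrow> 'v tensor) \<Rightarrow> nat \<Rightarrow> (nat \<Rightarrow> nat) \<Rightarrow>
     'v tensor \<Rightarrow> 'v tensor" where
  "T_perm scale \<sigma> p w =
     foldr (\<lambda>i f. sigma_at scale \<sigma> p i \<circ> f) (SOME is. reduced_word p w is)
       (id_on (tensor_power scale p))"

definition quantum_symmetrizer ::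
    "(complex \<Rightarrow> 'v::ab_group_add \<Rightarrow> 'v) \<Rightarrow> ('v tensor \<Rightarrow> 'v tensor) \<Rightarrow> nat \<Rightarrow>
     'v tensor \<Rightarrow> 'v tensor" where
  "quantum_symmetrizer scale \<sigma> p = (\<lambda>x. \<Sum>w | w permutes {1..p}. T_perm scale \<sigma> p w x)"

definition Ssym ::
    "(complex \<Rightarrow> 'v::ab_group_add \<Rightarrow> 'v) \<Rightarrow> ('v tensor \<Rightarrow> 'v tensor) \<Rightarrow> nat \<Rightarrow> 'v tensor set" where
  "Ssym scale \<sigma> p = quantum_symmetrizer scale \<sigma> p ` tensor_power scale p"

definition shuffle_perms :: "nat \<Rightarrow> nat \<Rightarrow> (nat \<Rightarrow> nat) set" where
  "shuffle_perms i j =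
     {w. w permutes {1..i + j} \<and> strict_mono_on {1..i} w \<and> strict_mono_on {i + 1..i + j} w}"

definition quantum_shuffle ::
    "(complex \<Rightarrow> 'v::ab_group_add \<Rightarrow> 'v) \<Rightarrow> ('v tensor \<Rightarrow> 'v tensor) \<Rightarrow> nat \<Rightarrow> nat \<Rightarrow>
     'v tensor \<Rightarrow> 'v tensor" where
  "quantum_shuffle scale \<sigma> i j = (\<lambda>x. \<Sum>w\<in>shuffle_perms i j. T_perm scale \<sigma> (i + j) w x)"


section \<open>The three products\<close>

text \<open>
  An element of \<open>\<Oplus>\<^sub>p\<^sub>\<le>\<^sub>M End S\<^sup>p\<close> is a sequence \<open>A\<close> of endomorphisms with \<open>A p = 0\<close> for \<open>p > M\<close>.
\<close>

type_synonym 'v endo_seq = "nat \<Rightarrow> 'v tensor \<Rightarrow> 'v tensor"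

definition endo_seqs ::
    "(complex \<Rightarrow> 'v::ab_group_add \<Rightarrow> 'v) \<Rightarrow> ('v tensor \<Rightarrow> 'v tensor) \<Rightarrow> nat \<Rightarrow> 'v endo_seq set" where
  "endo_seqs scale \<sigma> M =
     {A. (\<forall>p\<le>M. A p \<in> endos (Ssym scale \<sigma> p)) \<and> (\<forall>p>M. A p = (\<lambda>x. 0))}"

definition comp_prod :: "'v endo_seq \<Rightarrow> 'v endo_seq \<Rightarrow> 'v endo_seq" where
  "comp_prod A B = (\<lambda>p. A p \<circ> B p)"

text \<open>
  \<open>f * g = sh \<circ> (f \<otimes> g) \<circ> \<delta>\<^sub>i\<^sub>,\<^sub>j\<close> for \<open>f \<in> End S\<^sup>i\<close> and \<open>g \<in> End S\<^sup>j\<close>; the map \<open>\<delta>\<^sub>i\<^sub>,\<^sub>j\<close> does not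
  show up because it is the inclusion of \<open>S\<^bsup>i+j\<^esup>\<close> into \<open>S\<^sup>i \<otimes> S\<^sup>j \<subseteq> V\<^bsup>\<otimes>(i+j)\<^esup>\<close>.
\<close>

definition conv_hom ::
    "(complex \<Rightarrow> 'v::ab_group_add \<Rightarrow> 'v) \<Rightarrow> ('v tensor \<Rightarrow> 'v tensor) \<Rightarrow>
     nat \<Rightarrow> ('v tensor \<Rightarrow> 'v tensor) \<Rightarrow> nat \<Rightarrow> ('v tensor \<Rightarrow> 'v tensor) \<Rightarrow> 'v tensor \<Rightarrow> 'v tensor" where
  "conv_hom scale \<sigma> i f j g =
     (\<lambda>x. if x \<in> Ssym scale \<sigma> (i + j)
       then quantum_shuffle scale \<sigma> i j
              (tensor_map scale (Ssym scale \<sigma> i) f (Ssym scale \<sigma> j) g x)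
       else 0)"

definition conv_prod ::
    "(complex \<Rightarrow> 'v::ab_group_add \<Rightarrow> 'v) \<Rightarrow> ('v tensor \<Rightarrow> 'v tensor) \<Rightarrow> nat \<Rightarrow>
     'v endo_seq \<Rightarrow> 'v endo_seq \<Rightarrow> 'v endo_seq" where
  "conv_prod scale \<sigma> M A B =
     (\<lambda>p x. if p \<le> M then \<Sum>l\<le>p. conv_hom scale \<sigma> l (A l) (p - l) (B (p - l)) x else 0)"

definition conv_unit ::
    "(complex \<Rightarrow> 'v::ab_group_add \<Rightarrow> 'v) \<Rightarrow> ('v tensor \<Rightarrow> 'v tensor) \<Rightarrow> 'v endo_seq" where
  "conv_unit scale \<sigma> = (\<lambda>p. if p = 0 then id_on (Ssym scale \<sigma> 0) else (\<lambda>x. 0))"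

definition conv_exp ::
    "(complex \<Rightarrow> 'v::ab_group_add \<Rightarrow> 'v) \<Rightarrow> ('v tensor \<Rightarrow> 'v tensor) \<Rightarrow> nat \<Rightarrow> 'v endo_seq" where
  "conv_exp scale \<sigma> M = (\<lambda>p. if p \<le> M then id_on (Ssym scale \<sigma> p) else (\<lambda>x. 0))"

definition conv_exp_inv ::
    "(complex \<Rightarrow> 'v::ab_group_add \<Rightarrow> 'v) \<Rightarrow> ('v tensor \<Rightarrow> 'v tensor) \<Rightarrow> nat \<Rightarrow> 'v endo_seq" where
  "conv_exp_inv scale \<sigma> M =
     (THE X. X \<in> endo_seqs scale \<sigma> M \<and>
        conv_prod scale \<sigma> M (conv_exp scale \<sigma> M) X = conv_unit scale \<sigma> \<and>
        conv_prod scale \<sigma> M X (conv_exp scale \<sigma> M) = conv_unit scale \<sigma>)"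

definition alpha ::
    "(complex \<Rightarrow> 'v::ab_group_add \<Rightarrow> 'v) \<Rightarrow> ('v tensor \<Rightarrow> 'v tensor) \<Rightarrow> nat \<Rightarrow>
     'v endo_seq \<Rightarrow> 'v endo_seq" where
  "alpha scale \<sigma> M A = conv_prod scale \<sigma> M A (conv_exp scale \<sigma> M)"

definition alpha_inv ::
    "(complex \<Rightarrow> 'v::ab_group_add \<Rightarrow> 'v) \<Rightarrow> ('v tensor \<Rightarrow> 'v tensor) \<Rightarrow> nat \<Rightarrow>
     'v endo_seq \<Rightarrow> 'v endo_seq" where
  "alpha_inv scale \<sigma> M A = conv_prod scale \<sigma> M A (conv_exp_inv scale \<sigma> M)"

definition third_prod ::
    "(complex \<Rightarrow> 'v::ab_group_add \<Rightarrow> 'v) \<Rightarrow> ('v tensor \<Rightarrow> 'v tensor) \<Rightarrow> nat \<Rightarrow>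
     'v endo_seq \<Rightarrow> 'v endo_seq \<Rightarrow> 'v endo_seq" where
  "third_prod scale \<sigma> M A B =
     alpha_inv scale \<sigma> M (comp_prod (alpha scale \<sigma> M A) (alpha scale \<sigma> M B))"


section \<open>Associative unital algebras\<close>

text \<open>The library's locale \<open>algebra\<close> is restricted to commutative algebras.\<close>

locale assoc_algebra = module R A + ring A for R (structure) and A (structure) +
  assumes smult_mult_left:
      "\<lbrakk>a \<in> carrier R; x \<in> carrier A; y \<in> carrier A\<rbrakk> \<Longrightarrow>
       (a \<odot>\<^bsub>A\<^esub> x) \<otimes>\<^bsub>A\<^esub> y = a \<odot>\<^bsub>A\<^esub> (x \<otimes>\<^bsub>A\<^esub> y)"
    and smult_mult_right:
      "\<lbrakk>a \<in> carrier R; x \<in> carrier A; y \<in> carrier A\<rbrakk> \<Longrightarrow>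
       x \<otimes>\<^bsub>A\<^esub> (a \<odot>\<^bsub>A\<^esub> y) = a \<odot>\<^bsub>A\<^esub> (x \<otimes>\<^bsub>A\<^esub> y)"

definition complex_ring :: "complex ring" where
  "complex_ring = \<lparr>carrier = UNIV, mult = (*), one = 1, zero = 0, add = (+)\<rparr>"

definition third_algebra ::
    "(complex \<Rightarrow> 'v::ab_group_add \<Rightarrow> 'v) \<Rightarrow> ('v tensor \<Rightarrow> 'v tensor) \<Rightarrow> nat \<Rightarrow>
     (complex, 'v endo_seq) module" where
  "third_algebra scale \<sigma> M =
     \<lparr>carrier = endo_seqs scale \<sigma> M,
      mult = third_prod scale \<sigma> M,
      one = conv_unit scale \<sigma>,
      zero = (\<lambda>p x. 0),
      add = (\<lambda>A B p x. A p x + B p x),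
      smult = (\<lambda>c A p x. tscale c (A p x))\<rparr>"

end

theory Submission
  imports Defs
begin

text \<open>
  Writing \<open>I\<close> for the unit of the convolution product and \<open>E\<close> for \<open>(I\<^sub>0, \<dots>, I\<^sub>M)\<close>, the map \<open>\<alpha>\<close> is
  right convolution by \<open>E\<close>. Once convolution is known to be associative, \<open>E\<close> is invertible because
  its component of degree 0 is the identity, so \<open>\<alpha>\<close> is bijective and the third product is the
  composition product transported along \<open>\<alpha>\<close>; its unit is \<open>\<alpha>\<^sup>-\<^sup>1(E) = I\<close>.

  By Matsumoto's theorem, the unique factorisation of a permutation into a shuffle and a
  permutation preserving two blocks, with additive lengths, gives
  \<open>A\<^bsup>(i+j)\<^esup> = sh \<circ> (A\<^bsup>(i)\<^esup> \<otimes> A\<^bsup>(j)\<^esup>)\<close>. Hence both iterated shuffles of elements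
  \<open>A\<^bsup>(i)\<^esup>a\<close>, \<open>A\<^bsup>(j)\<^esup>b\<close>, \<open>A\<^bsup>(k)\<^esup>c\<close> are \<open>A\<^bsup>(i+j+k)\<^esup>(a \<otimes> b \<otimes> c)\<close>, which yields associativity of convolution. Inverting
  all permutations in the factorisation gives \<open>S\<^bsup>i+j\<^esup> \<subseteq> S\<^sup>i \<otimes> S\<^sup>j\<close>.
\<close>

section \<open>Reduced words in symmetric groups\<close>

text \<open>Two features of the encoding shape the work. \<open>T_perm\<close> is a fold over a
  chosen minimal word, so it can be computed with only once minimality is checkable; counting
  inversions achieves this, because additive counts make a concatenation of reduced words reduced.
  Secondly, maps on a subspace are extended by 0, so \<open>conv_hom\<close> vanishes outside
  \<open>Ssym scale \<sigma> (i + j)\<close>. Since deconcatenation is an inclusion, its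
  coassociativity costs nothing, but a nested convolution cannot be evaluated directly on a product
  of three elements: the product of two of them need not lie in the space where the inner
  convolution lives. That inner map therefore has to be enlarged to the whole tensor product before
  the two bracketings can be compared. Invertibility of \<open>conv_exp\<close> comes from left
  inverses alone: recursion on the degree gives one for every sequence that starts with the
  identity, and the result starts with the identity again.\<close>

definition inversions :: "nat \<Rightarrow> (nat \<Rightarrow> nat) \<Rightarrow> (nat \<times> nat) set" where
  "inversions n w = {(a, b). 1 \<le> a \<and> a < b \<and> b \<le> n \<and> w b < w a}"

text \<open>The Coxeter length in disguise, as \<open>reduced_word_iff\<close> shows.\<close>

definition inversion_number :: "nat \<Rightarrow> (nat \<Rightarrow> nat) \<Rightarrow> nat" where
  "inversion_number n w = card (inversions n w)"

abbreviation adj :: "nat \<Rightarrow> nat \<Rightarrow> nat" where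
  "adj k \<equiv> Transposition.transpose k (Suc k)"

lemma finite_inversions [simp]: "finite (inversions n w)"
  by (rule finite_subset[of _ "{1..n} \<times> {1..n}"]) (auto simp: inversions_def)

lemma adj_permutes: "k \<in> {1..<n} \<Longrightarrow> adj k permutes {1..n}"
  by (rule permutes_swap_id) auto

lemma adj_adj_comp [simp]: "adj k \<circ> (adj k \<circ> w) = w"
  by (simp add: fun_eq_iff)

lemma word_perm_Nil [simp]: "word_perm [] = id"
  by (simp add: word_perm_def)

lemma word_perm_Cons [simp]: "word_perm (k # is) = adj k \<circ> word_perm is"
  by (simp add: word_perm_def)

lemma word_perm_append: "word_perm (is @ js) = word_perm is \<circ> word_perm js"
  by (induction "is") auto

lemma word_perm_permutes: "set is \<subseteq> {1..<n} \<Longrightarrow> word_perm is permutes {1..n}"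
proof (induction "is")
  case (Cons k "is")
  then have "adj k \<circ> word_perm is permutes {1..n}"
    by (intro permutes_compose adj_permutes) auto
  then show ?case by (simp only: word_perm_Cons)
qed (auto simp: permutes_id)

text \<open>Exchanging positions with values turns an inversion (a, b) of w into the inversion (w b,
  w a) of the inverse. This carries results on right multiplication over to left
  multiplication.\<close>

lemma inversion_number_inv:
  assumes "w permutes {1..n}"
  shows "inversion_number n (inv_into UNIV w) = inversion_number n w"
  unfolding inversion_number_def
proof (rule bij_betw_same_card)
  have sub: "(\<lambda>(a, b). (u b, u a)) ` inversions n u \<subseteq> inversions n v"
    if u: "u permutes {1..n}" and vu: "\<And>x. v (u x) = x" for u v
  proof (clarify)
    fix a b assume ab: "(a, b) \<in> inversions n u"
    then have "a \<in> {1..n}" "b \<in> {1..n}" by (auto simp: inversions_def)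
    then have "u a \<in> {1..n}" "u b \<in> {1..n}" using permutes_in_image[OF u] by blast+
    then show "(u b, u a) \<in> inversions n v" using ab vu by (simp add: inversions_def)
  qed
  show "bij_betw (\<lambda>(a, b). (inv_into UNIV w b, inv_into UNIV w a))
      (inversions n (inv_into UNIV w)) (inversions n w)"
    by (rule bij_betw_byWitness[where f' = "\<lambda>(a, b). (w b, w a)"])
      (use sub[OF assms] sub[OF permutes_inv[OF assms]] in
        \<open>simp_all add: permutes_inverses[OF assms] case_prod_beta\<close>)
qed

text \<open>No position lies between k and k+1, so exchanging them keeps every old inversion, with
  positions renamed, and creates only the pair (k, k+1).\<close>

lemma inversion_number_right:
  assumes w: "w permutes {1..n}" and k: "k \<in> {1..<n}" and lt: "w k < w (Suc k)"
  shows "inversion_number n (w \<circ> adj k) = Suc (inversion_number n w)"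
proof -
  let ?f = "\<lambda>(a, b). (adj k a, adj k b)"
  have eq: "inversions n (w \<circ> adj k) = insert (k, Suc k) (?f ` inversions n w)"
  proof (intro Set.set_eqI iffI)
    fix z assume z: "z \<in> inversions n (w \<circ> adj k)"
    obtain a b where ab: "z = (a, b)" by force
    show "z \<in> insert (k, Suc k) (?f ` inversions n w)"
    proof (cases "z = (k, Suc k)")
      case False
      have "z = ?f (adj k a, adj k b)" by (simp add: ab)
      moreover have "(adj k a, adj k b) \<in> inversions n w"
        using z False k lt unfolding inversions_def ab
        by (auto simp: Transposition.transpose_def split: if_splits)
      ultimately show ?thesis by blast
    qed simp
  next
    fix z assume "z \<in> insert (k, Suc k) (?f ` inversions n w)"
    then show "z \<in> inversions n (w \<circ> adj k)"
      using k lt unfolding inversions_def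
      by (auto simp: Transposition.transpose_def split: if_splits)
  qed
  have "inj ?f" by (auto simp: inj_def transpose_eq_iff)
  moreover have "(k, Suc k) \<notin> ?f ` inversions n w"
    using lt by (auto simp: inversions_def Transposition.transpose_def split: if_splits)
  ultimately show ?thesis
    by (simp add: inversion_number_def eq card_image[OF inj_on_subset[OF _ subset_UNIV]])
qed

lemma inv_adj_comp:
  assumes "w permutes {1..n}"
  shows "inv_into UNIV (adj k \<circ> w) = inv_into UNIV w \<circ> adj k"
  using o_inv_distrib[of "adj k" w] permutes_bij[OF assms] by simp

lemma inversion_number_left:
  assumes w: "w permutes {1..n}" and k: "k \<in> {1..<n}"
    and lt: "inv_into UNIV w k < inv_into UNIV w (Suc k)"
  shows "inversion_number n (adj k \<circ> w) = Suc (inversion_number n w)"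
proof -
  have "adj k \<circ> w permutes {1..n}" by (rule permutes_compose[OF w adj_permutes[OF k]])
  then have "inversion_number n (adj k \<circ> w) = inversion_number n (inv_into UNIV w \<circ> adj k)"
    using inversion_number_inv inv_adj_comp[OF w] by metis
  also have "\<dots> = Suc (inversion_number n w)"
    using inversion_number_right[OF permutes_inv[OF w] k lt] inversion_number_inv[OF w] by simp
  finally show ?thesis .
qed

section \<open>Increasing permutations, descents and length\<close>

lemma strict_mono_on_atLeastAtMostI:
  fixes w :: "nat \<Rightarrow> nat"
  assumes "\<And>k. k \<in> {m..<n} \<Longrightarrow> w k < w (Suc k)"
  shows "strict_mono_on {m..n} w"
proof (rule strict_mono_onI)
  fix r s assume "r \<in> {m..n}" "s \<in> {m..n}" "r < s"
  then have "Suc r \<le> s" "m \<le> r" "s \<le> n" by auto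
  then show "w r < w s"
  proof (induction s rule: dec_induct)
    case base then show ?case using assms[of r] by auto
  next
    case (step s) then show ?case using assms[of s] by auto
  qed
qed

text \<open>Being increasing forces a \<le> w a for all a up to n; the inverse is increasing as well
  and gives the opposite inequality.\<close>

lemma strict_mono_permutes_id:
  fixes n :: nat
  assumes w: "w permutes {1..n}" and m: "strict_mono_on {1..n} w"
  shows "w = id"
proof -
  have ge: "a \<le> v a" if v: "v permutes {1..n}" "strict_mono_on {1..n} v" and "a \<le> n" for v a
    using \<open>a \<le> n\<close>
  proof (induction a)
    case (Suc a)
    show ?case
    proof (cases "a = 0")
      case True
      then show ?thesis using permutes_in_image[OF v(1), of 1] Suc by auto
    next
      case False
      then have "v a < v (Suc a)" using strict_mono_onD[OF v(2), of a "Suc a"] Suc by auto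
      then show ?thesis using Suc by auto
    qed
  qed simp
  have i: "inv_into UNIV w permutes {1..n}" by (rule permutes_inv[OF w])
  have mi: "strict_mono_on {1..n} (inv_into UNIV w)"
  proof (rule strict_mono_onI, rule ccontr)
    fix r s assume rs: "r \<in> {1..n}" "s \<in> {1..n}" "r < s"
      and n: "\<not> inv_into UNIV w r < inv_into UNIV w s"
    have "inv_into UNIV w r \<in> {1..n}" "inv_into UNIV w s \<in> {1..n}"
      using permutes_in_image[OF i] rs by blast+
    then have "w (inv_into UNIV w s) \<le> w (inv_into UNIV w r)"
      using n strict_mono_onD[OF m, of "inv_into UNIV w s" "inv_into UNIV w r"]
      by (cases "inv_into UNIV w s = inv_into UNIV w r") auto
    then show False using rs(3) by (simp add: permutes_inverses[OF w])
  qed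
  show ?thesis
  proof
    fix a
    show "w a = id a"
    proof (cases "a \<in> {1..n}")
      case True
      then have "w a \<in> {1..n}" using permutes_in_image[OF w] by blast
      then have "w a \<le> inv_into UNIV w (w a)" using ge[OF i mi] by auto
      then show ?thesis using ge[OF w m, of a] True by (simp add: permutes_inverses[OF w])
    qed (simp add: permutes_not_in[OF w])
  qed
qed

lemma exists_descent:
  assumes w: "w permutes {1..n}" and "w \<noteq> id"
  obtains k where "k \<in> {1..<n}" "w (Suc k) < w k"
proof -
  have "\<exists>k\<in>{1..<n}. \<not> w k < w (Suc k)"
    using strict_mono_on_atLeastAtMostI strict_mono_permutes_id[OF w] assms(2) by metis
  moreover have "w k \<noteq> w (Suc k)" for k using permutes_inj[OF w] by (metis injD n_not_Suc_n)
  ultimately show thesis using that by (metis linorder_neqE_nat)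
qed

text \<open>The ascent case applied to \<open>adj k \<circ> w\<close>, whose inverse ascends at
  k.\<close>

lemma inversion_number_left_descent:
  assumes w: "w permutes {1..n}" and k: "k \<in> {1..<n}"
    and gt: "inv_into UNIV w (Suc k) < inv_into UNIV w k"
  shows "inversion_number n w = Suc (inversion_number n (adj k \<circ> w))"
proof -
  have "inversion_number n (adj k \<circ> (adj k \<circ> w)) = Suc (inversion_number n (adj k \<circ> w))"
    by (rule inversion_number_left[OF permutes_compose[OF w adj_permutes[OF k]] k])
      (use gt in \<open>simp add: inv_adj_comp[OF w]\<close>)
  then show ?thesis by simp
qed

lemma inversion_number_id [simp]: "inversion_number n id = 0"
proof -
  have "inversions n id = {}" by (auto simp: inversions_def)
  then show ?thesis by (simp add: inversion_number_def)
qed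

lemma inv_permutes_neq: "w permutes S \<Longrightarrow> inv_into UNIV w k \<noteq> inv_into UNIV w (Suc k)"
  using permutes_inj[OF permutes_inv, of w S] by (metis injD n_not_Suc_n)

text \<open>Each letter changes the count by exactly one, up or down.\<close>

lemma inversion_number_word_perm_le:
  "set is \<subseteq> {1..<n} \<Longrightarrow> inversion_number n (word_perm is) \<le> length is"
proof (induction "is")
  case (Cons k "is")
  have p: "word_perm is permutes {1..n}" and k: "k \<in> {1..<n}"
    and IH: "inversion_number n (word_perm is) \<le> length is"
    using Cons word_perm_permutes[of "is" n] by auto
  have "inversion_number n (adj k \<circ> word_perm is) \<le> Suc (length is)"
  proof (cases "inv_into UNIV (word_perm is) k < inv_into UNIV (word_perm is) (Suc k)")
    case True
    then show ?thesis using inversion_number_left[OF p k True] IH by simp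
  next
    case False
    then have "inv_into UNIV (word_perm is) (Suc k) < inv_into UNIV (word_perm is) k"
      using inv_permutes_neq[OF p, of k] by (metis linorder_neqE_nat)
    then show ?thesis using inversion_number_left_descent[OF p k] IH by simp
  qed
  then show ?case by (simp only: word_perm_Cons list.size add_Suc_right add_0_right)
qed (simp only: word_perm_Nil inversion_number_id)

text \<open>Every left descent that is split off lowers the count by one, so the word collected on
  the way to the identity has one letter per inversion.\<close>

lemma exists_word:
  assumes "w permutes {1..n}"
  shows "\<exists>is. set is \<subseteq> {1..<n} \<and> word_perm is = w \<and> length is = inversion_number n w"
  using assms
proof (induction "inversion_number n w" arbitrary: w)
  case 0
  have "w = id"
  proof (rule ccontr)
    assume "w \<noteq> id"
    then obtain k where "k \<in> {1..<n}" "w (Suc k) < w k" using exists_descent[OF 0(2)] by blast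
    then have "(k, Suc k) \<in> inversions n w" by (auto simp: inversions_def)
    then show False using 0(1) by (auto simp: inversion_number_def)
  qed
  then have "set [] \<subseteq> {1..<n} \<and> word_perm [] = w \<and> length [] = inversion_number n w"
    by simp
  then show ?case by blast
next
  case (Suc m)
  \<comment> \<open>Left descents of w are descents of its inverse, so it is the inverse that must
    differ from the identity.\<close>
  have "inv_into UNIV w \<noteq> id"
    using Suc(2) inversion_number_inv[OF Suc(3)] by (metis inversion_number_id nat.distinct(1))
  then obtain k where k: "k \<in> {1..<n}" "inv_into UNIV w (Suc k) < inv_into UNIV w k"
    using exists_descent[OF permutes_inv[OF Suc(3)]] by blast
  note d = inversion_number_left_descent[OF Suc(3) k]
  from Suc(1)[of "adj k \<circ> w"] Suc(2) d permutes_compose[OF Suc(3) adj_permutes[OF k(1)]]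
  obtain "is" where "set is \<subseteq> {1..<n}" "word_perm is = adj k \<circ> w"
    "length is = inversion_number n (adj k \<circ> w)" by auto
  then show ?case using k d by (intro exI[of _ "k # is"]) auto
qed

lemma reduced_word_iff:
  assumes "w permutes {1..n}"
  shows "reduced_word n w is \<longleftrightarrow>
    set is \<subseteq> {1..<n} \<and> word_perm is = w \<and> length is = inversion_number n w"
  using exists_word[OF assms] inversion_number_word_perm_le[of _ n]
  unfolding reduced_word_def by (metis le_antisym)

lemma exists_reduced_word: "w permutes {1..n} \<Longrightarrow> \<exists>is. reduced_word n w is"
  using exists_word reduced_word_iff by blast

text \<open>The possible first letters of reduced words of w are exactly its left descents, and any
  reduced word of the remainder may follow. This freedom is what drives
  \<open>matsumoto\<close>.\<close>

lemma reduced_word_Cons_iff: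
  assumes w: "w permutes {1..n}"
  shows "reduced_word n w (k # is) \<longleftrightarrow> k \<in> {1..<n} \<and> reduced_word n (adj k \<circ> w) is \<and>
    inv_into UNIV w (Suc k) < inv_into UNIV w k"
proof (cases "k \<in> {1..<n}")
  case True
  note p = permutes_compose[OF w adj_permutes[OF True]]
  have eq: "word_perm is = adj k \<circ> w \<longleftrightarrow> adj k \<circ> word_perm is = w"
    by (metis adj_adj_comp)
  show ?thesis
  proof (cases "inv_into UNIV w (Suc k) < inv_into UNIV w k")
    case gt: True
    then show ?thesis using True inversion_number_left_descent[OF w True gt] eq
      by (auto simp: reduced_word_iff[OF w] reduced_word_iff[OF p])
  next
    case False
    then have "inv_into UNIV w k < inv_into UNIV w (Suc k)"
      using inv_permutes_neq[OF w, of k] by linarith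
    from inversion_number_left[OF w True this]
    have "\<not> reduced_word n w (k # is)"
      using inversion_number_word_perm_le[of "is" n] eq
      by (auto simp: reduced_word_iff[OF w])
    then show ?thesis using False by auto
  qed
qed (auto simp: reduced_word_def)

text \<open>If the first letters i and j differ, both are left descents of w. Then w has two reduced
  words that begin with the two sides of the commutation or braid relation for i and j and share a
  tail c. The induction hypothesis ties each given word to one of these, and the relation for g
  joins them.\<close>

theorem matsumoto:
  fixes g :: "nat \<Rightarrow> 'a \<Rightarrow> 'a"
  assumes comm: "\<And>i j. \<lbrakk>i \<in> {1..<n}; j \<in> {1..<n}; Suc i < j\<rbrakk> \<Longrightarrow> g i \<circ> g j = g j \<circ> g i"
    and braid: "\<And>i. \<lbrakk>i \<in> {1..<n}; Suc i \<in> {1..<n}\<rbrakk> \<Longrightarrow>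
      g i \<circ> g (Suc i) \<circ> g i = g (Suc i) \<circ> g i \<circ> g (Suc i)"
    and w: "w permutes {1..n}" and r: "reduced_word n w is" "reduced_word n w js"
  shows "foldr (\<lambda>i f. g i \<circ> f) is e = foldr (\<lambda>i f. g i \<circ> f) js e"
  using w r
proof (induction "length is" arbitrary: w "is" js)
  case 0
  then have "is = []" "js = []" by (metis reduced_word_iff length_0_conv)+
  then show ?case by simp
next
  case (Suc m)
  note w = Suc(3)
  let ?F = "\<lambda>is. foldr (\<lambda>i f. g i \<circ> f) is e"
  have IH: "?F is' = ?F js'"
    if "v permutes {1..n}" "reduced_word n v is'" "reduced_word n v js'" "length is' = m"
    for v is' js' using Suc.hyps(1)[OF _ that(1-3)] that(4) by simp
  have len: "length js = Suc m"
    using Suc.prems Suc.hyps(2) by (auto simp: reduced_word_iff[OF w])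
  obtain i is' where i: "is = i # is'" "length is' = m" using Suc.hyps(2) by (cases "is") auto
  obtain j js' where j: "js = j # js'" "length js' = m" using len by (cases js) auto
  define v where "v = inv_into UNIV w"
  have ri: "i \<in> {1..<n}" "reduced_word n (adj i \<circ> w) is'" "v (Suc i) < v i"
    and rj: "j \<in> {1..<n}" "reduced_word n (adj j \<circ> w) js'" "v (Suc j) < v j"
    using Suc.prems reduced_word_Cons_iff[OF w] by (auto simp: i j v_def)
  note adjp = permutes_compose[OF _ adj_permutes]
  have key: "?F (i # is') = ?F (j # js')"
    if ij: "i < j" and ri: "i \<in> {1..<n}" "reduced_word n (adj i \<circ> w) is'" "v (Suc i) < v i"
    "length is' = m" and rj: "j \<in> {1..<n}" "reduced_word n (adj j \<circ> w) js'" "v (Suc j) < v j"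
    "length js' = m" for i j is' js'
  proof (cases "Suc i = j")
    case False
    have eq: "adj j \<circ> (adj i \<circ> w) = adj i \<circ> (adj j \<circ> w)"
      using ij False by (auto simp: fun_eq_iff Transposition.transpose_def)
    obtain c where c: "reduced_word n (adj j \<circ> (adj i \<circ> w)) c"
      using exists_reduced_word adjp w ri(1) rj(1) by metis
    have "reduced_word n (adj i \<circ> w) (j # c)"
      unfolding reduced_word_Cons_iff[OF adjp[OF w ri(1)]] inv_adj_comp[OF w]
      using c rj ij False by (auto simp: v_def Transposition.transpose_def)
    then have 1: "?F is' = ?F (j # c)" using IH[OF adjp[OF w ri(1)] ri(2)] ri(4) by blast
    have "reduced_word n (adj j \<circ> w) (i # c)"
      unfolding reduced_word_Cons_iff[OF adjp[OF w rj(1)]] inv_adj_comp[OF w]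
      using c[unfolded eq] ri ij False by (auto simp: v_def Transposition.transpose_def)
    then have 2: "?F js' = ?F (i # c)" using IH[OF adjp[OF w rj(1)] rj(2)] rj(4) by blast
    have "g i \<circ> g j = g j \<circ> g i" using comm[OF ri(1) rj(1)] ij False by simp
    then have "g i \<circ> (g j \<circ> ?F c) = g j \<circ> (g i \<circ> ?F c)"
      by (simp only: comp_assoc[symmetric])
    then show ?thesis using 1 2 by simp
  next
    case True
    have jn: "Suc i \<in> {1..<n}" using rj(1) True by simp
    note p1 = adjp[OF w ri(1)] and p2 = adjp[OF w jn]
    note p1' = adjp[OF p1 jn] and p2' = adjp[OF p2 ri(1)]
    have eq: "adj i \<circ> (adj (Suc i) \<circ> (adj i \<circ> w)) = adj (Suc i) \<circ> (adj i \<circ> (adj (Suc i) \<circ> w))"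
      by (auto simp: fun_eq_iff Transposition.transpose_def)
    obtain c where c: "reduced_word n (adj i \<circ> (adj (Suc i) \<circ> (adj i \<circ> w))) c"
      using exists_reduced_word[OF adjp[OF p1' ri(1)]] by blast
    \<comment> \<open>The inverse of w is decreasing on i, i+1, i+2, so each of the three letters of
      either braid word is a left descent when its turn comes, and c completes both words.\<close>
    have d: "v (Suc i) < v i" "v (Suc (Suc i)) < v (Suc i)" using ri rj True by auto
    have "reduced_word n (adj i \<circ> w) (Suc i # i # c)"
      unfolding reduced_word_Cons_iff[OF p1] reduced_word_Cons_iff[OF p1']
        inv_adj_comp[OF w] inv_adj_comp[OF p1]
      using c jn ri(1) d by (auto simp: v_def Transposition.transpose_def)
    then have 1: "?F is' = ?F (Suc i # i # c)" using IH[OF p1 ri(2)] ri(4) by blast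
    have "reduced_word n (adj (Suc i) \<circ> w) (i # Suc i # c)"
      unfolding reduced_word_Cons_iff[OF p2] reduced_word_Cons_iff[OF p2']
        inv_adj_comp[OF w] inv_adj_comp[OF p2]
      using c[unfolded eq] jn ri(1) d by (auto simp: v_def Transposition.transpose_def)
    then have 2: "?F js' = ?F (i # Suc i # c)" using IH[OF p2] rj True by blast
    have "g i \<circ> (g (Suc i) \<circ> (g i \<circ> ?F c)) = g (Suc i) \<circ> (g i \<circ> (g (Suc i) \<circ> ?F c))"
      by (simp only: comp_assoc[symmetric] braid[OF ri(1) jn])
    then show ?thesis using 1 2 True[symmetric] by simp
  qed
  consider "i < j" | "j < i" | "i = j" by linarith
  then show ?case
  proof cases
    case 3
    then show ?thesis using IH[OF adjp[OF w ri(1)] ri(2)] rj(2) i j by auto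
  qed (use key[of i j is' js'] key[of j i js' is'] ri rj i j in auto)
qed

section \<open>Shuffles and parabolic subgroups\<close>

text \<open>The Young subgroup S_i x S_j, encoded as a stabiliser so that closure under composition
  and inversion is immediate; the second block is then preserved automatically.\<close>

definition block_perms :: "nat \<Rightarrow> nat \<Rightarrow> (nat \<Rightarrow> nat) set" where
  "block_perms i j = {y. y permutes {1..i + j} \<and> y ` {1..i} = {1..i}}"

lemma block_perms_iff:
  assumes "y \<in> block_perms i j"
  shows "y a \<in> {1..i} \<longleftrightarrow> a \<in> {1..i}" "y a \<in> {1..i + j} \<longleftrightarrow> a \<in> {1..i + j}"
    "y a \<in> {i + 1..i + j} \<longleftrightarrow> a \<in> {i + 1..i + j}"
proof -
  have y: "y permutes {1..i + j}" "y ` {1..i} = {1..i}" using assms by (auto simp: block_perms_def)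
  show 1: "y a \<in> {1..i} \<longleftrightarrow> a \<in> {1..i}"
    using y(2) inj_image_mem_iff[OF permutes_inj[OF y(1)], of a "{1..i}"] by simp
  show 2: "y a \<in> {1..i + j} \<longleftrightarrow> a \<in> {1..i + j}" by (rule permutes_in_image[OF y(1)])
  have "{i + 1..i + j} = {1..i + j} - {1..i}" by auto
  then show "y a \<in> {i + 1..i + j} \<longleftrightarrow> a \<in> {i + 1..i + j}" using 1 2 by simp
qed

lemma block_perms_comp: "x \<in> block_perms i j \<Longrightarrow> y \<in> block_perms i j \<Longrightarrow> x \<circ> y \<in> block_perms i j"
  by (simp add: block_perms_def permutes_compose image_comp[symmetric] del: o_apply)

lemma block_perms_inv:
  assumes "y \<in> block_perms i j" shows "inv_into UNIV y \<in> block_perms i j"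
proof -
  have y: "y permutes {1..i + j}" "y ` {1..i} = {1..i}" using assms by (auto simp: block_perms_def)
  have "inv_into UNIV y ` {1..i} = {1..i}"
    using y(2) permutes_inj[OF y(1)] by (metis image_inv_f_f)
  then show ?thesis using permutes_inv[OF y(1)] by (auto simp: block_perms_def)
qed

lemma adj_block_perms:
  assumes "k \<in> {1..<i} \<union> {i + 1..<i + j}"
  shows "adj k \<in> block_perms i j"
proof -
  have "adj k ` {1..i} = {1..i}"
  proof (cases "k < i")
    case True
    then show ?thesis using assms permutes_image[OF adj_permutes[of k i]] by auto
  next
    case False
    then have "adj k a = a" if "a \<in> {1..i}" for a
      using assms that by (auto simp: Transposition.transpose_def)
    then show ?thesis by simp
  qed
  moreover have "k \<in> {1..<i + j}" using assms by auto
  ultimately show ?thesis using adj_permutes by (simp add: block_perms_def)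
qed

text \<open>Within a block x preserves the order, so an inversion of the composite is one of y.
  Between blocks y preserves the order, so it is an inversion of x pulled back along y. The two
  kinds are disjoint.\<close>

lemma inversion_number_shuffle_block:
  assumes x: "x \<in> shuffle_perms i j" and y: "y \<in> block_perms i j"
  shows "inversion_number (i + j) (x \<circ> y) = inversion_number (i + j) x + inversion_number (i + j) y"
proof -
  have xp: "x permutes {1..i + j}" and x1: "strict_mono_on {1..i} x"
    and x2: "strict_mono_on {i + 1..i + j} x" using x by (auto simp: shuffle_perms_def)
  have yp: "y permutes {1..i + j}" using y by (simp add: block_perms_def)
  let ?f = "\<lambda>(a, b). (y a, y b)" and ?n = "i + j"
  note yi = block_perms_iff[OF y]
  have m1: "x a < x b \<longleftrightarrow> a < b" if "a \<in> {1..i}" "b \<in> {1..i}" for a b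
    using strict_mono_on_less[OF x1] that by blast
  have m2: "x a < x b \<longleftrightarrow> a < b" if "a \<in> {i+1..i+j}" "b \<in> {i+1..i+j}" for a b
    using strict_mono_on_less[OF x2] that by blast
  have cross: "z \<in> inversions ?n (x \<circ> y) \<longleftrightarrow> z \<in> inversions ?n y \<or> ?f z \<in> inversions ?n x"
    "\<not> (z \<in> inversions ?n y \<and> ?f z \<in> inversions ?n x)"
    "z = (a, b) \<Longrightarrow> ?f z \<in> inversions ?n x \<Longrightarrow> a < b" if z: "z = (a, b)" for z a b
  proof -
    consider "a \<notin> {1..?n} \<or> b \<notin> {1..?n}" | "a \<in> {1..i}" "b \<in> {1..i}"
      | "a \<in> {i+1..i+j}" "b \<in> {i+1..i+j}" | "a \<in> {1..i}" "b \<in> {i+1..i+j}"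
      | "a \<in> {i+1..i+j}" "b \<in> {1..i}" by force
    then have "(z \<in> inversions ?n (x \<circ> y) \<longleftrightarrow> z \<in> inversions ?n y \<or> ?f z \<in> inversions ?n x) \<and>
      \<not> (z \<in> inversions ?n y \<and> ?f z \<in> inversions ?n x) \<and> (?f z \<in> inversions ?n x \<longrightarrow> a < b)"
    proof cases
      case 1
      then have "y a \<notin> {1..?n} \<or> y b \<notin> {1..?n}" using yi(2) by blast
      then show ?thesis using 1 by (auto simp: inversions_def z)
    next
      case 2
      then have *: "y a \<in> {1..i}" "y b \<in> {1..i}" using yi(1) by blast+
      show ?thesis using 2 * m1[OF *(2,1)] by (auto simp: inversions_def z)
    next
      case 3
      then have *: "y a \<in> {i+1..i+j}" "y b \<in> {i+1..i+j}" using yi(3) by blast+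
      show ?thesis using 3 * m2[OF *(2,1)] by (auto simp: inversions_def z)
    next
      case 4
      then have "y a \<in> {1..i}" "y b \<in> {i+1..i+j}" using yi by blast+
      then show ?thesis using 4 by (auto simp: inversions_def z)
    next
      case 5
      then have "y a \<in> {i+1..i+j}" "y b \<in> {1..i}" using yi by blast+
      then show ?thesis using 5 by (auto simp: inversions_def z)
    qed
    then show "z \<in> inversions ?n (x \<circ> y) \<longleftrightarrow> z \<in> inversions ?n y \<or> ?f z \<in> inversions ?n x"
      "\<not> (z \<in> inversions ?n y \<and> ?f z \<in> inversions ?n x)"
      "z = (a, b) \<Longrightarrow> ?f z \<in> inversions ?n x \<Longrightarrow> a < b" by blast+
  qed
  have bij: "bij ?f"
    using permutes_inverses[OF yp]
    by (intro o_bij[where g = "\<lambda>(a, b). (inv_into UNIV y a, inv_into UNIV y b)"])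
      (auto simp: fun_eq_iff)
  have "inversions ?n (x \<circ> y) = inversions ?n y \<union> ?f -` inversions ?n x"
    using cross(1) by force
  moreover have "inversions ?n y \<inter> ?f -` inversions ?n x = {}"
    using cross(2) by force
  moreover have "finite (?f -` inversions ?n x)"
    by (rule finite_vimageI) (use bij in \<open>auto simp: bij_is_inj\<close>)
  ultimately show ?thesis
    by (simp add: inversion_number_def card_Un_disjoint card_vimage_inj bij_is_inj[OF bij]
        bij_is_surj[OF bij])
qed

lemma block_perms_mono_id:
  assumes y: "y \<in> block_perms i j" and m: "strict_mono_on {1..i} y" "strict_mono_on {i + 1..i + j} y"
  shows "y = id"
proof -
  have yp: "y permutes {1..i + j}" using y by (simp add: block_perms_def)
  have "strict_mono_on {1..i + j} y"
  proof (rule strict_mono_onI)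
    fix r s assume rs: "r \<in> {1..i + j}" "s \<in> {1..i + j}" "r < s"
    consider "r \<in> {1..i}" "s \<in> {1..i}" | "r \<in> {i+1..i+j}" "s \<in> {i+1..i+j}"
      | "r \<in> {1..i}" "s \<in> {i+1..i+j}" using rs by force
    then show "y r < y s"
    proof cases
      case 3
      then have "y r \<in> {1..i}" "y s \<in> {i+1..i+j}" using block_perms_iff[OF y] by blast+
      then show ?thesis by auto
    qed (use m rs(3) strict_mono_onD in blast)+
  qed
  then show ?thesis by (rule strict_mono_permutes_id[OF yp])
qed

text \<open>Shuffles are the minimal representatives of the left cosets of the Young
  subgroup.\<close>

lemma shuffle_block_bij:
  "bij_betw (\<lambda>(x, y). x \<circ> y) (shuffle_perms i j \<times> block_perms i j) {w. w permutes {1..i + j}}"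
  unfolding bij_betw_def
proof (intro conjI inj_onI Set.set_eqI iffI)
  fix p q assume p: "p \<in> shuffle_perms i j \<times> block_perms i j"
    and q: "q \<in> shuffle_perms i j \<times> block_perms i j"
    and eq: "(case p of (x, y) \<Rightarrow> x \<circ> y) = (case q of (x, y) \<Rightarrow> x \<circ> y)"
  obtain x y x' y' where pq: "p = (x, y)" "q = (x', y')" by force
  have xy: "x \<in> shuffle_perms i j" "y \<in> block_perms i j" "x' \<in> shuffle_perms i j"
    "y' \<in> block_perms i j" "x \<circ> y = x' \<circ> y'" using p q eq pq by auto
  have yp: "y permutes {1..i + j}" using xy(2) by (simp add: block_perms_def)
  have x'p: "inj x'" using xy(3) permutes_inj by (auto simp: shuffle_perms_def)
  \<comment> \<open>z measures the difference of two representatives of one coset. It preserves the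
    blocks and is increasing on each of them because x and x' are.\<close>
  define z where "z = y' \<circ> inv_into UNIV y"
  have z: "z \<in> block_perms i j"
    unfolding z_def by (intro block_perms_comp block_perms_inv xy)
  have xz: "x = x' \<circ> z"
    unfolding z_def using xy(5) permutes_inverses[OF yp] by (metis comp_apply ext)
  have "strict_mono_on B z"
    if B: "B = {1..i} \<or> B = {i + 1..i + j}" for B
  proof (rule strict_mono_onI)
    fix r s assume rs: "r \<in> B" "s \<in> B" "r < s"
    have zB: "z r \<in> B" "z s \<in> B" using block_perms_iff[OF z] rs B by blast+
    have m: "strict_mono_on B x" "strict_mono_on B x'" using xy B by (auto simp: shuffle_perms_def)
    have "x' (z r) < x' (z s)" using strict_mono_onD[OF m(1) rs] xz by simp
    then show "z r < z s" using strict_mono_on_less[OF m(2) zB] by blast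
  qed
  then have "z = id" using block_perms_mono_id[OF z] by blast
  then have "x = x'" using xz by simp
  moreover have "y = y'" using xy(5) x'p \<open>x = x'\<close> by (metis fun.inj_map injD)
  ultimately show "p = q" by (simp add: pq)
next
  fix w assume "w \<in> (\<lambda>(x, y). x \<circ> y) ` (shuffle_perms i j \<times> block_perms i j)"
  then show "w \<in> {w. w permutes {1..i + j}}"
    by (auto simp: shuffle_perms_def block_perms_def intro: permutes_compose)
next
  fix w assume "w \<in> {w. w permutes {1..i + j}}"
  then have w: "w permutes {1..i + j}" by simp
  \<comment> \<open>Choose the element of the coset of w with the fewest inversions. A descent
    inside a block could be removed by a further adjacent transposition from the Young subgroup,
    against minimality.\<close>
  have "id \<in> block_perms i j" by (auto simp: block_perms_def permutes_id)
  from ex_has_least_nat[of "\<lambda>y. y \<in> block_perms i j", OF this,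
      of "\<lambda>y. inversion_number (i + j) (w \<circ> y)"]
  obtain y where y: "y \<in> block_perms i j"
    "\<And>z. z \<in> block_perms i j \<Longrightarrow>
      inversion_number (i + j) (w \<circ> y) \<le> inversion_number (i + j) (w \<circ> z)" by blast
  have yp: "y permutes {1..i + j}" using y by (simp add: block_perms_def)
  note wy = permutes_compose[OF yp w]
  have asc: "(w \<circ> y) k < (w \<circ> y) (Suc k)" if k: "k \<in> {1..<i} \<union> {i + 1..<i + j}" for k
  proof (rule ccontr)
    assume "\<not> (w \<circ> y) k < (w \<circ> y) (Suc k)"
    moreover have "(w \<circ> y) k \<noteq> (w \<circ> y) (Suc k)"
      using permutes_inj[OF wy] by (metis injD n_not_Suc_n)
    ultimately have lt: "(w \<circ> y \<circ> adj k) k < (w \<circ> y \<circ> adj k) (Suc k)" by simp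
    have k': "k \<in> {1..<i + j}" using k by auto
    have "inversion_number (i + j) (w \<circ> y \<circ> adj k \<circ> adj k) =
        Suc (inversion_number (i + j) (w \<circ> y \<circ> adj k))"
      by (rule inversion_number_right[OF permutes_compose[OF adj_permutes[OF k'] wy] k' lt])
    moreover have "w \<circ> y \<circ> adj k \<circ> adj k = w \<circ> y" by (simp add: fun_eq_iff)
    ultimately show False
      using y(2)[OF block_perms_comp[OF y(1) adj_block_perms[OF k]]] by (simp add: comp_assoc)
  qed
  have "w \<circ> y \<in> shuffle_perms i j"
    unfolding shuffle_perms_def
    using wy asc by (auto intro!: strict_mono_on_atLeastAtMostI)
  moreover have "w = (w \<circ> y) \<circ> inv_into UNIV y" by (simp add: fun_eq_iff permutes_inverses[OF yp])
  ultimately show "w \<in> (\<lambda>(x, y). x \<circ> y) ` (shuffle_perms i j \<times> block_perms i j)"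
    using block_perms_inv[OF y(1)] by (auto intro!: image_eqI[of _ _ "(w \<circ> y, inv_into UNIV y)"])
qed

section \<open>The Young subgroup as a product of two symmetric groups\<close>

definition shift_perm :: "nat \<Rightarrow> (nat \<Rightarrow> nat) \<Rightarrow> nat \<Rightarrow> nat" where
  "shift_perm i v = (\<lambda>a. if a \<le> i then a else i + v (a - i))"

text \<open>A permutation of {1..j} keeps positive arguments positive. Without that, an argument
  above i could be sent to i itself and fall into the other branch of
  \<open>shift_perm\<close>.\<close>

lemma shift_perm_comp:
  assumes "v' permutes {1..j}"
  shows "shift_perm i (v \<circ> v') = shift_perm i v \<circ> shift_perm i v'"
proof
  fix a
  have "v' b > 0" if "b > 0" for b
    using permutes_in_image[OF assms, of b] permutes_not_in[OF assms, of b] that by (cases "b \<le> j") auto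
  then have "v' (a - i) > 0" if "\<not> a \<le> i" using that by simp
  then show "shift_perm i (v \<circ> v') a = (shift_perm i v \<circ> shift_perm i v') a"
    by (cases "a \<le> i") (auto simp: shift_perm_def)
qed

lemma shift_perm_id [simp]: "shift_perm i id = id"
  by (auto simp: shift_perm_def fun_eq_iff)

lemma shift_perm_permutes:
  assumes v: "v permutes {1..j}"
  shows "shift_perm i v permutes {i + 1..i + j}"
proof (rule bij_imp_permutes)
  have bij: "bij (shift_perm i v)"
  proof (rule o_bij)
    show "shift_perm i (inv_into UNIV v) \<circ> shift_perm i v = id"
      "shift_perm i v \<circ> shift_perm i (inv_into UNIV v) = id"
      using shift_perm_comp[OF v] shift_perm_comp[OF permutes_inv[OF v]] permutes_inv_o[OF v]
      by (metis shift_perm_id)+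
  qed
  have iff: "shift_perm i v a \<in> {i + 1..i + j} \<longleftrightarrow> a \<in> {i + 1..i + j}" for a
    using permutes_in_image[OF v, of "a - i"] permutes_not_in[OF v, of "a - i"]
    by (auto simp: shift_perm_def)
  have "shift_perm i v ` {i + 1..i + j} = {i + 1..i + j}"
  proof (intro Set.set_eqI iffI)
    fix b assume b: "b \<in> {i + 1..i + j}"
    obtain a where "b = shift_perm i v a" using bij_is_surj[OF bij] by (metis surjD)
    then show "b \<in> shift_perm i v ` {i + 1..i + j}" using b iff by blast
  qed (use iff in blast)
  then show "bij_betw (shift_perm i v) {i + 1..i + j} {i + 1..i + j}"
    using bij_is_inj[OF bij] by (auto simp: bij_betw_def intro: inj_on_subset)
next
  fix a assume "a \<notin> {i + 1..i + j}"
  then have "a - i \<notin> {1..j}" if "\<not> a \<le> i" using that by auto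
  then show "shift_perm i v a = a" using permutes_not_in[OF v, of "a - i"]
    by (cases "a \<le> i") (auto simp: shift_perm_def)
qed

lemma shift_perm_word_perm:
  "set is \<subseteq> {1..<j} \<Longrightarrow> shift_perm i (word_perm is) = word_perm (map ((+) i) is)"
proof (induction "is")
  case (Cons k "is")
  have "shift_perm i (adj k) = adj (i + k)"
    using Cons.prems by (auto simp: shift_perm_def fun_eq_iff Transposition.transpose_def)
  then have "shift_perm i (adj k \<circ> word_perm is) = adj (i + k) \<circ> word_perm (map ((+) i) is)"
    using Cons shift_perm_comp[OF word_perm_permutes[of "is" j], of i "adj k"] by simp
  then show ?case by (simp only: word_perm_Cons list.map)
qed simp

text \<open>Coordinates on the Young subgroup, through which a sum over it becomes a double sum over
  the two factors.\<close>

lemma block_perms_bij: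
  "bij_betw (\<lambda>(u, v). u \<circ> shift_perm i v) ({u. u permutes {1..i}} \<times> {v. v permutes {1..j}})
     (block_perms i j)"
  unfolding bij_betw_def
proof (intro conjI inj_onI Set.set_eqI iffI)
  have low: "(u \<circ> shift_perm i v) a = u a" if "a \<le> i" for u v :: "nat \<Rightarrow> nat" and a
    using that by (simp add: shift_perm_def)
  have high: "(u \<circ> shift_perm i v) (i + a) = i + v a"
    if "u permutes {1..i}" "v permutes {1..j}" "a > 0" for u v a
  proof -
    have "v a > 0" using permutes_in_image[OF that(2), of a] permutes_not_in[OF that(2), of a] that(3)
      by (cases "a \<le> j") auto
    then show ?thesis using that(3) permutes_not_in[OF that(1), of "i + v a"]
      by (auto simp: shift_perm_def)
  qed
  fix p q assume "p \<in> {u. u permutes {1..i}} \<times> {v. v permutes {1..j}}"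
    "q \<in> {u. u permutes {1..i}} \<times> {v. v permutes {1..j}}"
    "(case p of (u, v) \<Rightarrow> u \<circ> shift_perm i v) = (case q of (u, v) \<Rightarrow> u \<circ> shift_perm i v)"
  then obtain u v u' v' where pq: "p = (u, v)" "q = (u', v')"
    and uv: "u permutes {1..i}" "v permutes {1..j}" "u' permutes {1..i}" "v' permutes {1..j}"
    and eq: "u \<circ> shift_perm i v = u' \<circ> shift_perm i v'" by auto
  have "u a = u' a" for a
    using low[of a u v] low[of a u' v'] eq uv permutes_not_in[OF uv(1), of a]
      permutes_not_in[OF uv(3), of a] by (cases "a \<le> i") auto
  moreover have "v a = v' a" for a
    using high[OF uv(1,2), of a] high[OF uv(3,4), of a] eq permutes_not_in[OF uv(2), of 0]
      permutes_not_in[OF uv(4), of 0] by (cases "a = 0") auto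
  ultimately show "p = q" by (auto simp: pq)
next
  fix w assume "w \<in> (\<lambda>(u, v). u \<circ> shift_perm i v) ` ({u. u permutes {1..i}} \<times> {v. v permutes {1..j}})"
  then obtain u v where w: "w = u \<circ> shift_perm i v" "u permutes {1..i}" "v permutes {1..j}" by auto
  have "u permutes {1..i + j}" by (rule permutes_subset[OF w(2)]) auto
  moreover have "shift_perm i v permutes {1..i + j}"
    by (rule permutes_subset[OF shift_perm_permutes[OF w(3)]]) auto
  moreover have "w ` {1..i} = u ` {1..i}" by (auto simp: w(1) shift_perm_def image_iff)
  ultimately show "w \<in> block_perms i j"
    using permutes_image[OF w(2)] by (auto simp: block_perms_def w(1) permutes_compose)
next
  fix w assume w: "w \<in> block_perms i j"
  note wi = block_perms_iff[OF w]
  have wp: "w permutes {1..i + j}" using w by (simp add: block_perms_def)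
  define u where "u a = (if a \<in> {1..i} then w a else a)" for a
  define v where "v a = (if a \<in> {1..j} then w (i + a) - i else a)" for a
  have u: "u permutes {1..i}"
  proof (rule bij_imp_permutes)
    have "bij_betw w {1..i} {1..i}"
      using w permutes_inj[OF wp] by (auto simp: block_perms_def bij_betw_def intro: inj_on_subset)
    then show "bij_betw u {1..i} {1..i}"
      by (rule bij_betw_cong[THEN iffD1, rotated]) (simp add: u_def)
  qed (auto simp: u_def)
  have hi: "w (i + a) \<in> {i + 1..i + j}" if "a \<in> {1..j}" for a using wi(3)[of "i + a"] that by auto
  have v: "v permutes {1..j}"
  proof (rule bij_imp_permutes)
    show "bij_betw v {1..j} {1..j}"
      unfolding bij_betw_def
    proof
      show inj: "inj_on v {1..j}"
      proof (rule inj_onI)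
        fix a b assume ab: "a \<in> {1..j}" "b \<in> {1..j}" "v a = v b"
        then have "w (i + a) = w (i + b)" using hi[OF ab(1)] hi[OF ab(2)] by (auto simp: v_def)
        then show "a = b" using permutes_inj[OF wp] by (metis injD add_left_cancel)
      qed
      have "v ` {1..j} \<subseteq> {1..j}" using hi by (force simp: v_def)
      then show "v ` {1..j} = {1..j}" using inj by (simp add: endo_inj_surj)
    qed
  qed (auto simp: v_def)
  have "w a = (u \<circ> shift_perm i v) a" for a
  proof -
    consider "a \<in> {1..i}" | "a \<in> {i+1..i+j}" | "a \<notin> {1..i+j}" by force
    then show ?thesis
    proof cases
      case 2
      then have "w a \<in> {i+1..i+j}" using wi(3) by blast
      then show ?thesis using 2 by (auto simp: u_def v_def shift_perm_def)
    next
      case 3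
      then have "w a = a" by (rule permutes_not_in[OF wp])
      then show ?thesis using 3 by (auto simp: u_def v_def shift_perm_def)
    qed (auto simp: u_def shift_perm_def)
  qed
  then show "w \<in> (\<lambda>(u, v). u \<circ> shift_perm i v) ` ({u. u permutes {1..i}} \<times> {v. v permutes {1..j}})"
    using u v by (auto intro!: image_eqI[of _ _ "(u, v)"] simp: fun_eq_iff)
qed

text \<open>No inversion joins the two blocks: values on the first are at most i, values on the
  second exceed i. Inside the blocks the inversions are those of u and the shifted ones of
  v.\<close>

lemma inversion_number_block:
  assumes u: "u permutes {1..i}" and v: "v permutes {1..j}"
  shows "inversion_number (i + j) (u \<circ> shift_perm i v) = inversion_number i u + inversion_number j v"
proof -
  let ?f = "\<lambda>(a, b). (i + a, i + b)" and ?w = "u \<circ> shift_perm i v"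
  have w: "?w \<in> block_perms i j" using block_perms_bij[of i j] u v by (auto simp: bij_betw_def)
  have low: "?w a = u a" if "a \<le> i" for a using that by (simp add: shift_perm_def)
  have high: "?w (i + a) = i + v a" if "a \<in> {1..j}" for a
  proof -
    have "v a \<in> {1..j}" using permutes_in_image[OF v] that by blast
    then show ?thesis using that permutes_not_in[OF u, of "i + v a"]
      by (auto simp: shift_perm_def)
  qed
  have "inversions (i + j) ?w = inversions i u \<union> ?f ` inversions j v" (is "?L = ?R")
  proof (intro Set.set_eqI iffI)
    fix z assume z: "z \<in> ?L"
    obtain a b where ab: "z = (a, b)" by force
    have r: "1 \<le> a" "a < b" "b \<le> i + j" "?w b < ?w a" using z by (auto simp: inversions_def ab)
    consider "b \<le> i" | "i < a" | "a \<le> i" "i < b" by linarith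
    then show "z \<in> ?R"
    proof cases
      case 1
      then show ?thesis using r low[of a] low[of b] by (auto simp: inversions_def ab)
    next
      case 2
      then have "?w (i + (b - i)) < ?w (i + (a - i))" using r by simp
      moreover have "a - i \<in> {1..j}" "b - i \<in> {1..j}" using 2 r by auto
      ultimately have "v (b - i) < v (a - i)" using high by (simp del: o_apply)
      then show ?thesis using 2 r
        by (auto simp: inversions_def ab intro!: image_eqI[of _ _ "(a - i, b - i)"])
    next
      case 3
      then have "?w a \<in> {1..i}" "?w b \<in> {i+1..i+j}" using block_perms_iff[OF w] r by auto
      then show ?thesis using r by auto
    qed
  next
    fix z assume "z \<in> ?R"
    then show "z \<in> ?L"
    proof
      assume "z \<in> inversions i u"
      then show ?thesis using low by (auto simp: inversions_def shift_perm_def)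
    next
      assume "z \<in> ?f ` inversions j v"
      then obtain a b where ab: "z = (i + a, i + b)" "(a, b) \<in> inversions j v" by auto
      then have r: "a \<in> {1..j}" "b \<in> {1..j}" by (auto simp: inversions_def)
      show ?thesis using ab(2) high[OF r(1)] high[OF r(2)]
        by (auto simp: inversions_def ab(1) simp del: o_apply)
    qed
  qed
  moreover have "inversions i u \<inter> ?f ` inversions j v = {}" by (auto simp: inversions_def)
  moreover have "card (?f ` inversions j v) = inversion_number j v"
    unfolding inversion_number_def by (rule card_image) (auto simp: inj_on_def)
  ultimately show ?thesis by (simp add: inversion_number_def card_Un_disjoint)
qed

lemma shuffle_perms_0_left: "shuffle_perms 0 j = {id}"
  using strict_mono_permutes_id[of _ j]
  by (auto simp: shuffle_perms_def permutes_id strict_mono_on_def)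

lemma shuffle_perms_0_right: "shuffle_perms i 0 = {id}"
  using strict_mono_permutes_id[of _ i]
  by (auto simp: shuffle_perms_def permutes_id strict_mono_on_def)

section \<open>Linear maps on tensor powers\<close>

text \<open>Linearity is asked on W only: members of \<open>endos W\<close> are cut off to 0 outside
  W and are in general not additive on the whole type.\<close>

definition lin_on :: "('a \<Rightarrow> complex) set \<Rightarrow> (('a \<Rightarrow> complex) \<Rightarrow> ('b \<Rightarrow> complex)) \<Rightarrow> bool" where
  "lin_on W f \<longleftrightarrow> (\<forall>x\<in>W. \<forall>y\<in>W. f (x + y) = f x + f y) \<and>
     (\<forall>c. \<forall>x\<in>W. f (tscale c x) = tscale c (f x))"

lemma endos_iff:
  "f \<in> endos W \<longleftrightarrow> lin_on W f \<and> (\<forall>x\<in>W. f x \<in> W) \<and> (\<forall>x. x \<notin> W \<longrightarrow> f x = 0)"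
  unfolding endos_def lin_on_def by blast

lemma lin_on_endos: "f \<in> endos W \<Longrightarrow> lin_on W f"
  by (simp add: endos_iff)

lemma endos_mem: "f \<in> endos W \<Longrightarrow> x \<in> W \<Longrightarrow> f x \<in> W"
  by (simp add: endos_iff)

lemma endos_outside: "f \<in> endos W \<Longrightarrow> x \<notin> W \<Longrightarrow> f x = 0"
  by (simp add: endos_iff)

lemma endos_eqI:
  assumes "f \<in> endos W" "g \<in> endos W" "\<And>x. x \<in> W \<Longrightarrow> f x = g x"
  shows "f = g"
proof
  fix x show "f x = g x"
    using assms endos_outside[OF assms(1), of x] endos_outside[OF assms(2), of x]
    by (cases "x \<in> W") auto
qed

lemma lin_on_0:
  assumes "lin_on W f" "0 \<in> W" shows "f 0 = 0"
proof -
  have "f (0 + 0) = f 0 + f 0" using assms unfolding lin_on_def by blast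
  then show ?thesis by simp
qed

lemma lin_on_subset: "lin_on W f \<Longrightarrow> W' \<subseteq> W \<Longrightarrow> lin_on W' f"
  unfolding lin_on_def by blast

lemma lin_on_comp:
  assumes "lin_on W f" "\<And>x. x \<in> W \<Longrightarrow> f x \<in> W'" "lin_on W' g"
  shows "lin_on W (\<lambda>x. g (f x))"
  using assms unfolding lin_on_def by simp

lemma lin_on_cong:
  assumes "tensor.subspace W" "\<And>x. x \<in> W \<Longrightarrow> f x = g x"
  shows "lin_on W f \<longleftrightarrow> lin_on W g"
  using assms(2) tensor.subspace_add[OF assms(1)] tensor.subspace_scale[OF assms(1)]
  unfolding lin_on_def by simp

lemma lin_on_id: "lin_on W (\<lambda>x. x)"
  unfolding lin_on_def by simp

lemma lin_on_add: "lin_on W f \<Longrightarrow> lin_on W g \<Longrightarrow> lin_on W (\<lambda>x. f x + g x)"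
  unfolding lin_on_def by (simp add: tensor.scale_right_distrib add_ac)

lemma lin_on_zero: "lin_on W (\<lambda>x. 0)"
  unfolding lin_on_def by simp

lemma lin_on_scale: "lin_on W f \<Longrightarrow> lin_on W (\<lambda>x. tscale c (f x))"
  unfolding lin_on_def by (simp add: tensor.scale_right_distrib mult.commute)

lemma lin_on_sum:
  assumes "\<And>a. a \<in> S \<Longrightarrow> lin_on W (f a)"
  shows "lin_on W (\<lambda>x. \<Sum>a\<in>S. f a x)"
  using assms by (induction S rule: infinite_finite_induct) (auto simp: lin_on_zero intro!: lin_on_add)

lemma lin_on_sum_apply:
  assumes f: "lin_on W f" and W: "tensor.subspace W" and g: "\<And>a. a \<in> S \<Longrightarrow> g a \<in> W"
  shows "f (\<Sum>a\<in>S. g a) = (\<Sum>a\<in>S. f (g a))"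
  using g
proof (induction S rule: infinite_finite_induct)
  case (insert a S)
  then have "f (g a + (\<Sum>a\<in>S. g a)) = f (g a) + f (\<Sum>a\<in>S. g a)"
    using f tensor.subspace_sum[OF W, of S g] unfolding lin_on_def by simp
  moreover have "f (sum g S) = (\<Sum>a\<in>S. f (g a))" using insert by blast
  ultimately show ?case by (simp only: sum.insert[OF insert(1,2)])
qed (use lin_on_0[OF f tensor.subspace_0[OF W]] in auto)

lemma lin_on_eq_span:
  assumes f: "lin_on (tensor.span G) f" and g: "lin_on (tensor.span G) g"
    and eq: "\<And>x. x \<in> G \<Longrightarrow> f x = g x" and x: "x \<in> tensor.span G"
  shows "f x = g x"
proof -
  have "x \<in> tensor.span G \<and> f x = g x"
    using x
  proof (rule tensor.span_induct)
    show "tensor.subspace {x. x \<in> tensor.span G \<and> f x = g x}"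
      using f g lin_on_0[OF f tensor.span_zero] lin_on_0[OF g tensor.span_zero]
      unfolding lin_on_def
      by (auto intro!: tensor.subspaceI tensor.span_zero tensor.span_add tensor.span_scale)
  qed (use eq tensor.span_base in auto)
  then show ?thesis ..
qed

lemma lin_on_image_subspace:
  assumes f: "lin_on W f" and W: "tensor.subspace W"
  shows "tensor.subspace (f ` W)"
proof (rule tensor.subspaceI)
  show "0 \<in> f ` W"
    using lin_on_0[OF f tensor.subspace_0[OF W]] tensor.subspace_0[OF W] by (metis image_eqI)
next
  fix x y assume "x \<in> f ` W" "y \<in> f ` W"
  then obtain a b where "a \<in> W" "b \<in> W" "x = f a" "y = f b" by blast
  then show "x + y \<in> f ` W"
    using f tensor.subspace_add[OF W, of a b] unfolding lin_on_def by (metis image_eqI)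
next
  fix c x assume "x \<in> f ` W"
  then obtain a where "a \<in> W" "x = f a" by blast
  then show "tscale c x \<in> f ` W"
    using f tensor.subspace_scale[OF W, of a c] unfolding lin_on_def by (metis image_eqI)
qed

lemma endos_comp:
  assumes "tensor.subspace W" "f \<in> endos W" "g \<in> endos W"
  shows "f \<circ> g \<in> endos W"
proof -
  \<comment> \<open>Outside W the composite takes the value f 0.\<close>
  have "f 0 = 0" using lin_on_0[OF lin_on_endos[OF assms(2)] tensor.subspace_0[OF assms(1)]] .
  then show ?thesis
    using assms lin_on_comp[of W g W f] unfolding endos_iff by (auto simp: comp_def)
qed

lemma id_on_endos: "tensor.subspace W \<Longrightarrow> id_on W \<in> endos W"
  using tensor.subspace_add[of W] tensor.subspace_scale[of W]
  by (simp add: endos_def id_on_def)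

lemma id_on_comp: "f \<in> endos W \<Longrightarrow> 0 \<in> W \<Longrightarrow> id_on W \<circ> f = f"
  unfolding endos_iff id_on_def by (auto simp: fun_eq_iff)

lemma zero_endos: "tensor.subspace W \<Longrightarrow> (\<lambda>x. 0) \<in> endos W"
  using tensor.subspace_0 unfolding endos_iff by (auto simp: lin_on_zero)

lemma add_endos:
  "tensor.subspace W \<Longrightarrow> f \<in> endos W \<Longrightarrow> g \<in> endos W \<Longrightarrow> (\<lambda>x. f x + g x) \<in> endos W"
  using tensor.subspace_add[of W] unfolding endos_iff by (auto intro: lin_on_add)

lemma scale_endos:
  "tensor.subspace W \<Longrightarrow> f \<in> endos W \<Longrightarrow> (\<lambda>x. tscale c (f x)) \<in> endos W"
  using tensor.subspace_scale[of W] unfolding endos_iff by (auto intro: lin_on_scale)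

lemma sum_endos:
  assumes "tensor.subspace W" "\<And>a. a \<in> S \<Longrightarrow> f a \<in> endos W"
  shows "(\<lambda>x. \<Sum>a\<in>S. f a x) \<in> endos W"
  using assms(2)
  by (induction S rule: infinite_finite_induct) (auto intro: zero_endos add_endos assms(1))

section \<open>Products of tensors and comparison of linear maps\<close>

locale tensor_algebra =
  fixes scale :: "complex \<Rightarrow> 'v::ab_group_add \<Rightarrow> 'v"
  assumes V: "vector_space scale"
begin

abbreviation tmult :: "'v tensor \<Rightarrow> 'v tensor \<Rightarrow> 'v tensor" (infixr "\<star>" 75) where
  "x \<star> y \<equiv> tensor_mult scale x y"

abbreviation TP :: "nat \<Rightarrow> 'v tensor set" where
  "TP \<equiv> tensor_power scale"

lemmas TP_0 = tensor.subspace_0[OF subspace_tensor_power]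

lemma lin_on_left: "lin_on W (\<lambda>x. x \<star> y)"
  by (simp add: lin_on_def tensor_mult_add_left tensor_mult_scale_left)

lemma lin_on_right: "x \<in> TP i \<Longrightarrow> lin_on (TP j) (\<lambda>y. x \<star> y)"
  using tensor_mult_add_right[OF V, of x i] tensor_mult_scale_right[OF V, of x i]
  unfolding lin_on_def by blast

lemma lin_on_TP_eqI:
  assumes "lin_on (TP n) f" "lin_on (TP n) g"
    and "\<And>vs. length vs = n \<Longrightarrow> f (pure_tensor scale vs) = g (pure_tensor scale vs)"
    and "x \<in> TP n"
  shows "f x = g x"
proof (rule lin_on_eq_span[where G = "pure_tensor scale ` {vs. length vs = n}" and f = f and g = g])
  show "lin_on (tensor.span (pure_tensor scale ` {vs. length vs = n})) f"
    "lin_on (tensor.span (pure_tensor scale ` {vs. length vs = n})) g"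
    "x \<in> tensor.span (pure_tensor scale ` {vs. length vs = n})"
    using assms by (simp_all add: tensor_power_def)
qed (use assms(3) in blast)

lemma tmult_mem: "x \<in> TP i \<Longrightarrow> y \<in> TP j \<Longrightarrow> x \<star> y \<in> TP (i + j)"
proof (induction rule: tensor_power_induct)
  case zero
  have "0 \<star> y = 0" by (rule lin_on_0[OF lin_on_left, of UNIV]) simp
  then show ?case by (simp only: TP_0)
next
  case (add x x')
  then show ?case by (simp only: tensor_mult_add_left tensor.subspace_add[OF subspace_tensor_power])
next
  case (scale c x)
  then show ?case by (simp only: tensor_mult_scale_left tensor.subspace_scale[OF subspace_tensor_power])
next
  case (pure vs)
  note l = lin_on_right[OF tensor_power_pure[OF pure(1)]]
  from pure(2) show ?case
  proof (induction rule: tensor_power_induct)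
    case zero
    show ?case by (simp only: TP_0 lin_on_0[OF l TP_0])
  next
    case (add x x')
    then have "pure_tensor scale vs \<star> (x + x') = pure_tensor scale vs \<star> x + pure_tensor scale vs \<star> x'"
      using l unfolding lin_on_def by blast
    then show ?case using add by (simp only: tensor.subspace_add[OF subspace_tensor_power])
  next
    case (scale c x)
    then have "pure_tensor scale vs \<star> tscale c x = tscale c (pure_tensor scale vs \<star> x)"
      using l unfolding lin_on_def by blast
    then show ?case using scale by (simp only: tensor.subspace_scale[OF subspace_tensor_power])
  next
    case (pure ws)
    then show ?case using \<open>length vs = i\<close> by (simp add: tensor_mult_pure tensor_power_pure)
  qed
qed

text \<open>The left bracketing evaluates z first and then tests whether the remaining form is
  multilinear, which is guaranteed for z in a tensor power.\<close>

lemma tmult_assoc: "z \<in> TP k \<Longrightarrow> (x \<star> y) \<star> z = x \<star> y \<star> z"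
  using multilinear_form_eval[OF V, of z k] multilinear_form_append_left[of scale]
  by (simp add: tensor_mult_def fun_eq_iff)

lemma tmult_unit_left: "y \<in> TP j \<Longrightarrow> pure_tensor scale [] \<star> y = y"
  by (rule lin_on_TP_eqI[OF lin_on_right lin_on_id])
    (auto simp: tensor_mult_pure intro: tensor_power_pure)

lemma tmult_unit_right: "y \<in> TP j \<Longrightarrow> y \<star> pure_tensor scale [] = y"
  by (rule lin_on_TP_eqI[OF lin_on_left lin_on_id]) (auto simp: tensor_mult_pure)

lemma unit_mem: "pure_tensor scale [] \<in> TP 0"
  by (rule tensor_power_pure) simp

text \<open>A pure tensor can be cut at any two places. With m = 2 or m = 3 this isolates the window
  on which one braiding, or the braid relation, acts.\<close>

lemma lin_on_TP_eq3:
  assumes "lin_on (TP n) f" "lin_on (TP n) g" "n = l + (m + r)"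
    and eq: "\<And>a b c. a \<in> TP l \<Longrightarrow> b \<in> TP m \<Longrightarrow> c \<in> TP r \<Longrightarrow> f (a \<star> b \<star> c) = g (a \<star> b \<star> c)"
    and "x \<in> TP n"
  shows "f x = g x"
proof (rule lin_on_TP_eqI[OF assms(1,2) _ assms(5)])
  fix vs :: "'v list" assume vs: "length vs = n"
  define a b c where "a = take l vs" and "b = take m (drop l vs)" and "c = drop m (drop l vs)"
  have "pure_tensor scale vs = pure_tensor scale a \<star> pure_tensor scale b \<star> pure_tensor scale c"
    by (simp add: tensor_mult_pure a_def b_def c_def del: drop_drop)
  moreover have "length a = l" "length b = m" "length c = r"
    using vs assms(3) by (auto simp: a_def b_def c_def)
  ultimately show "f (pure_tensor scale vs) = g (pure_tensor scale vs)"
    using eq tensor_power_pure by metis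
qed

lemma lin_on_TP_eq2:
  assumes "lin_on (TP n) f" "lin_on (TP n) g" "n = l + m"
    and eq: "\<And>a b. a \<in> TP l \<Longrightarrow> b \<in> TP m \<Longrightarrow> f (a \<star> b) = g (a \<star> b)"
    and "x \<in> TP n"
  shows "f x = g x"
proof (rule lin_on_TP_eq3[OF assms(1,2) _ _ assms(5), of l m 0])
  fix a b c assume "a \<in> TP l" "b \<in> TP m" "c \<in> TP 0"
  then show "f (a \<star> b \<star> c) = g (a \<star> b \<star> c)" using eq tmult_mem[of b m c 0] by simp
qed (use assms(3) in simp)

text \<open>The identification of a product of two tensor powers with one tensor power; a pure
  tensor is reached by cutting it after i entries.\<close>

lemma tensor_product_TP: "tensor_product scale (TP i) (TP j) = TP (i + j)"
proof
  show "tensor_product scale (TP i) (TP j) \<subseteq> TP (i + j)"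
    unfolding tensor_product_def
    by (rule tensor.span_minimal) (auto intro: tmult_mem subspace_tensor_power)
  have "pure_tensor scale vs \<in> tensor_product scale (TP i) (TP j)" if "length vs = i + j" for vs
  proof -
    have "pure_tensor scale vs = pure_tensor scale (take i vs) \<star> pure_tensor scale (drop i vs)"
      by (simp add: tensor_mult_pure)
    moreover have "pure_tensor scale (take i vs) \<in> TP i" "pure_tensor scale (drop i vs) \<in> TP j"
      using that by (auto intro: tensor_power_pure)
    ultimately show ?thesis unfolding tensor_product_def by (blast intro: tensor.span_base)
  qed
  then show "TP (i + j) \<subseteq> tensor_product scale (TP i) (TP j)"
    unfolding tensor_power_def[of _ "i + j"]
    by (intro tensor.span_minimal) (auto simp: tensor_product_def tensor.subspace_span)
qed

lemma subspace_tensor_product: "tensor.subspace (tensor_product scale W1 W2)"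
  unfolding tensor_product_def by (rule tensor.subspace_span)

lemma tensor_product_mem: "x \<in> W1 \<Longrightarrow> y \<in> W2 \<Longrightarrow> x \<star> y \<in> tensor_product scale W1 W2"
  unfolding tensor_product_def by (blast intro: tensor.span_base)

lemma tensor_product_mono:
  "W1 \<subseteq> W1' \<Longrightarrow> W2 \<subseteq> W2' \<Longrightarrow> tensor_product scale W1 W2 \<subseteq> tensor_product scale W1' W2'"
  unfolding tensor_product_def by (rule tensor.span_mono) blast

lemma tensor_product_subset_TP:
  "W1 \<subseteq> TP i \<Longrightarrow> W2 \<subseteq> TP j \<Longrightarrow> tensor_product scale W1 W2 \<subseteq> TP (i + j)"
  using tensor_product_mono[of W1 "TP i" W2 "TP j"] by (simp add: tensor_product_TP)

lemma lin_on_tensor_product_eqI: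
  assumes "lin_on (tensor_product scale W1 W2) f" "lin_on (tensor_product scale W1 W2) g"
    and "\<And>x y. x \<in> W1 \<Longrightarrow> y \<in> W2 \<Longrightarrow> f (x \<star> y) = g (x \<star> y)"
    and "z \<in> tensor_product scale W1 W2"
  shows "f z = g z"
  using assms unfolding tensor_product_def by (elim lin_on_eq_span) auto

text \<open>Span induction on products. Besides images, it yields inclusions between tensor products
  when f is the identity.\<close>

lemma lin_on_tensor_product_mem:
  assumes f: "lin_on (tensor_product scale W1 W2) f" and U: "tensor.subspace U"
    and "\<And>x y. x \<in> W1 \<Longrightarrow> y \<in> W2 \<Longrightarrow> f (x \<star> y) \<in> U"
    and "z \<in> tensor_product scale W1 W2"
  shows "f z \<in> U"
proof -
  let ?G = "{x \<star> y |x y. x \<in> W1 \<and> y \<in> W2}"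
  have "z \<in> tensor.span ?G \<and> f z \<in> U"
    using assms(4) unfolding tensor_product_def
  proof (rule tensor.span_induct)
    show "tensor.subspace {z. z \<in> tensor.span ?G \<and> f z \<in> U}"
      using f[unfolded tensor_product_def] lin_on_0[OF f[unfolded tensor_product_def] tensor.span_zero]
        tensor.subspace_0[OF U] tensor.subspace_add[OF U] tensor.subspace_scale[OF U]
      unfolding lin_on_def
      by (auto intro!: tensor.subspaceI tensor.span_zero tensor.span_add tensor.span_scale)
  qed (use assms(3) in \<open>blast intro: tensor.span_base\<close>)
  then show ?thesis ..
qed

text \<open>Resolves the definite description behind \<open>tensor_map\<close>; all later reasoning
  about it rests on these two facts.\<close>

lemma tensor_map_props:
  assumes "tensor.subspace W1" "W1 \<subseteq> TP i" "tensor.subspace W2" "W2 \<subseteq> TP j"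
    and "f \<in> endos W1" "g \<in> endos W2"
  shows tensor_map_endos: "tensor_map scale W1 f W2 g \<in> endos (tensor_product scale W1 W2)"
    and tensor_map_apply: "\<And>x y. x \<in> W1 \<Longrightarrow> y \<in> W2 \<Longrightarrow> tensor_map scale W1 f W2 g (x \<star> y) = f x \<star> g y"
  using theI'[OF tensor_map_unique_existence[OF V assms]] unfolding tensor_map_def by blast+

lemma tensor_map_eqI:
  assumes "tensor.subspace W1" "W1 \<subseteq> TP i" "tensor.subspace W2" "W2 \<subseteq> TP j"
    and "f \<in> endos W1" "g \<in> endos W2"
    and "lin_on (tensor_product scale W1 W2) h"
    and "\<And>x y. x \<in> W1 \<Longrightarrow> y \<in> W2 \<Longrightarrow> h (x \<star> y) = f x \<star> g y"
    and "z \<in> tensor_product scale W1 W2"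
  shows "tensor_map scale W1 f W2 g z = h z"
  by (rule lin_on_tensor_product_eqI[OF lin_on_endos[OF tensor_map_endos[OF assms(1-6)]] assms(7) _ assms(9)])
    (simp add: tensor_map_apply[OF assms(1-6)] assms(8))

end

section \<open>The Hecke operators\<close>

locale braided_space = tensor_algebra scale
  for scale :: "complex \<Rightarrow> 'v::ab_group_add \<Rightarrow> 'v" +
  fixes \<sigma> :: "'v tensor \<Rightarrow> 'v tensor"
  assumes braiding: "braiding scale \<sigma>"
begin

lemma sigma_endos: "\<sigma> \<in> endos (TP 2)"
  using braiding by (simp add: braiding_def)

abbreviation sg :: "nat \<Rightarrow> nat \<Rightarrow> 'v tensor \<Rightarrow> 'v tensor" where
  "sg \<equiv> sigma_at scale \<sigma>"

lemmas id_TP = id_on_endos[OF subspace_tensor_power]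
lemmas tensor_map_TP_endos =
  tensor_map_endos[OF subspace_tensor_power subset_refl subspace_tensor_power subset_refl,
    unfolded tensor_product_TP]
lemmas tensor_map_TP_apply =
  tensor_map_apply[OF subspace_tensor_power subset_refl subspace_tensor_power subset_refl]

lemma sg_endos:
  assumes "k \<in> {1..<n}" shows "sg n k \<in> endos (TP n)"
proof -
  \<comment> \<open>With truncated subtraction, these equations are what lets the degrees of the
    nested factors add up to n.\<close>
  have n: "n - k + 1 = 2 + (n - k - 1)" "(k - 1) + (2 + (n - k - 1)) = n" using assms by auto
  show ?thesis
    unfolding sigma_at_def Let_def n(1)
    using tensor_map_TP_endos[OF id_TP tensor_map_TP_endos[OF sigma_endos id_TP], of "k - 1" "n - k - 1"]
    by (simp only: n(2))
qed

text \<open>The index is \<open>Suc l\<close> because a generator is numbered by the first entry of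
  its window, which comes right after the l entries of a.\<close>

lemma sg_apply:
  assumes "a \<in> TP l" "b \<in> TP 2" "c \<in> TP r" "n = l + (2 + r)"
  shows "sg n (Suc l) (a \<star> b \<star> c) = a \<star> \<sigma> b \<star> c"
proof -
  have n: "n - Suc l + 1 = 2 + r" "Suc l - 1 = l" "n - Suc l - 1 = r" using assms by auto
  show ?thesis
    unfolding sigma_at_def Let_def n
    using tensor_map_TP_apply[OF id_TP tensor_map_TP_endos[OF sigma_endos id_TP] assms(1) tmult_mem[OF assms(2,3)]]
      tensor_map_TP_apply[OF sigma_endos id_TP assms(2,3)] assms(1,3)
    by (simp add: id_on_def)
qed

text \<open>Once x is written as a product around the window of \<sigma>, the factor y merely
  lengthens the part to the right. In \<open>sg_right\<close> the part to the left is lengthened and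
  the index moves by i.\<close>

lemma sg_left:
  assumes k: "k \<in> {1..<i}" and x: "x \<in> TP i" and y: "y \<in> TP j"
  shows "sg (i + j) k (x \<star> y) = sg i k x \<star> y"
proof -
  obtain l r where lr: "k = Suc l" "i = l + (2 + r)"
  proof
    show "k = Suc (k - 1)" "i = k - 1 + (2 + (i - k - 1))" using k by auto
  qed
  have k': "k \<in> {1..<i + j}" using k by auto
  show ?thesis
  proof (rule lin_on_TP_eq3[OF _ _ lr(2) _ x])
    show "lin_on (TP i) (\<lambda>x. sg (i + j) k (x \<star> y))"
      by (rule lin_on_comp[OF lin_on_left _ lin_on_endos[OF sg_endos[OF k']]]) (rule tmult_mem[OF _ y])
    show "lin_on (TP i) (\<lambda>x. sg i k x \<star> y)"
      by (rule lin_on_comp[OF lin_on_endos[OF sg_endos[OF k]] UNIV_I lin_on_left])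
  next
    fix a b c assume abc: "a \<in> TP l" "b \<in> TP 2" "c \<in> TP r"
    have cy: "c \<star> y \<in> TP (r + j)" by (rule tmult_mem[OF abc(3) y])
    have "sg (i + j) k ((a \<star> b \<star> c) \<star> y) = sg (i + j) (Suc l) (a \<star> b \<star> c \<star> y)"
      using lr(1) tmult_assoc[OF y] by simp
    also have "\<dots> = a \<star> \<sigma> b \<star> c \<star> y" by (rule sg_apply[OF abc(1,2) cy]) (use lr in simp)
    also have "\<dots> = sg i k (a \<star> b \<star> c) \<star> y"
      unfolding lr(1) sg_apply[OF abc lr(2)] using tmult_assoc[OF y] by simp
    finally show "sg (i + j) k ((a \<star> b \<star> c) \<star> y) = sg i k (a \<star> b \<star> c) \<star> y" .
  qed
qed

lemma sg_right:
  assumes k: "k \<in> {1..<j}" and x: "x \<in> TP i" and y: "y \<in> TP j"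
  shows "sg (i + j) (i + k) (x \<star> y) = x \<star> sg j k y"
proof -
  obtain l r where lr: "k = Suc l" "j = l + (2 + r)"
  proof
    show "k = Suc (k - 1)" "j = k - 1 + (2 + (j - k - 1))" using k by auto
  qed
  have k': "i + k \<in> {1..<i + j}" using k by auto
  show ?thesis
  proof (rule lin_on_TP_eq3[OF _ _ lr(2) _ y])
    show "lin_on (TP j) (\<lambda>y. sg (i + j) (i + k) (x \<star> y))"
      by (rule lin_on_comp[OF lin_on_right[OF x] _ lin_on_endos[OF sg_endos[OF k']]])
        (rule tmult_mem[OF x])
    show "lin_on (TP j) (\<lambda>y. x \<star> sg j k y)"
      by (rule lin_on_comp[OF lin_on_endos[OF sg_endos[OF k]] _ lin_on_right[OF x]])
        (rule endos_mem[OF sg_endos[OF k]])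
  next
    fix a b c assume abc: "a \<in> TP l" "b \<in> TP 2" "c \<in> TP r"
    have bc: "b \<star> c \<in> TP (2 + r)" "\<sigma> b \<star> c \<in> TP (2 + r)"
      by (intro tmult_mem abc endos_mem[OF sigma_endos])+
    have "sg (i + j) (i + k) (x \<star> a \<star> b \<star> c) = sg (i + j) (Suc (i + l)) ((x \<star> a) \<star> b \<star> c)"
      using lr(1) tmult_assoc[OF bc(1)] by simp
    also have "\<dots> = (x \<star> a) \<star> \<sigma> b \<star> c"
      by (rule sg_apply[OF tmult_mem[OF x abc(1)] abc(2,3)]) (use lr in simp)
    also have "\<dots> = x \<star> sg j k (a \<star> b \<star> c)"
      unfolding lr(1) sg_apply[OF abc lr(2)] using tmult_assoc[OF bc(2)] by simp
    finally show "sg (i + j) (i + k) (x \<star> a \<star> b \<star> c) = x \<star> sg j k (a \<star> b \<star> c)" .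
  qed
qed

lemma sg_commute:
  assumes i: "i \<in> {1..<n}" and j: "j \<in> {1..<n}" and ij: "Suc i < j"
  shows "sg n i \<circ> sg n j = sg n j \<circ> sg n i"
proof (rule endos_eqI[where W = "TP n"])
  \<comment> \<open>Cut just before entry j: the window of i ends at i+1 \<le> j-1 and stays on the
    left, while j becomes the first generator on the right.\<close>
  define m r where "m = j - 1" and "r = n - m"
  have n: "n = m + r" "i \<in> {1..<m}" "1 \<in> {1..<r}" "j = m + 1" using i j ij by (auto simp: m_def r_def)
  fix x assume x: "x \<in> TP n"
  have e: "sg n i \<circ> sg n j \<in> endos (TP n)" "sg n j \<circ> sg n i \<in> endos (TP n)"
    by (intro endos_comp subspace_tensor_power sg_endos i j)+
  show "(sg n i \<circ> sg n j) x = (sg n j \<circ> sg n i) x"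
  proof (rule lin_on_TP_eq2[OF lin_on_endos[OF e(1)] lin_on_endos[OF e(2)] n(1) _ x])
    fix a b assume ab: "a \<in> TP m" "b \<in> TP r"
    have "sg n j (a \<star> b) = a \<star> sg r 1 b" unfolding n(1,4) by (rule sg_right[OF n(3) ab])
    moreover have "sg n i (a \<star> b) = sg m i a \<star> b" unfolding n(1) by (rule sg_left[OF n(2) ab])
    moreover have "sg n j (sg m i a \<star> b) = sg m i a \<star> sg r 1 b"
      unfolding n(1,4) by (rule sg_right[OF n(3) endos_mem[OF sg_endos[OF n(2)] ab(1)] ab(2)])
    moreover have "sg n i (a \<star> sg r 1 b) = sg m i a \<star> sg r 1 b"
      unfolding n(1) by (rule sg_left[OF n(2) ab(1) endos_mem[OF sg_endos[OF n(3)] ab(2)]])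
    ultimately show "(sg n i \<circ> sg n j) (a \<star> b) = (sg n j \<circ> sg n i) (a \<star> b)" by simp
  qed
qed (intro endos_comp subspace_tensor_power sg_endos i j)+

text \<open>\<open>braiding\<close> states the braid relation with two tensor factors, whereas
  \<open>sigma_at\<close> always uses three, one of them here of degree 0. Multiplying by the empty
  tensor reconciles the two forms.\<close>

lemma sg_3:
  "sg 3 1 = tensor_map scale (TP 2) \<sigma> (TP 1) (id_on (TP 1))"
  "sg 3 2 = tensor_map scale (TP 1) (id_on (TP 1)) (TP 2) \<sigma>"
proof -
  have 12: "(1::nat) \<in> {1..<3}" "(2::nat) \<in> {1..<3}" by auto
  have s: "(2::nat) + 1 = 3" "(1::nat) + 2 = 3" by auto
  have e1: "tensor_map scale (TP 2) \<sigma> (TP 1) (id_on (TP 1)) \<in> endos (TP 3)"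
    using tensor_map_TP_endos[OF sigma_endos id_TP, of 1] unfolding s .
  have e2: "tensor_map scale (TP 1) (id_on (TP 1)) (TP 2) \<sigma> \<in> endos (TP 3)"
    using tensor_map_TP_endos[OF id_TP sigma_endos, of 1] unfolding s .
  show "sg 3 1 = tensor_map scale (TP 2) \<sigma> (TP 1) (id_on (TP 1))"
  proof (rule endos_eqI[OF sg_endos[OF 12(1)] e1])
    fix x assume x: "x \<in> TP 3"
    show "sg 3 1 x = tensor_map scale (TP 2) \<sigma> (TP 1) (id_on (TP 1)) x"
    proof (rule lin_on_TP_eq2[OF lin_on_endos[OF sg_endos[OF 12(1)]] lin_on_endos[OF e1] s(1)[symmetric] _ x])
      fix a b assume ab: "a \<in> TP 2" "b \<in> TP 1"
      show "sg 3 1 (a \<star> b) = tensor_map scale (TP 2) \<sigma> (TP 1) (id_on (TP 1)) (a \<star> b)"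
        using sg_apply[OF unit_mem ab, of 3] tmult_unit_left[OF tmult_mem[OF ab]]
          tmult_unit_left[OF tmult_mem[OF endos_mem[OF sigma_endos ab(1)] ab(2)]]
          tensor_map_TP_apply[OF sigma_endos id_TP ab] ab
        by (simp add: id_on_def)
    qed
  qed
  show "sg 3 2 = tensor_map scale (TP 1) (id_on (TP 1)) (TP 2) \<sigma>"
  proof (rule endos_eqI[OF sg_endos[OF 12(2)] e2])
    fix x assume x: "x \<in> TP 3"
    show "sg 3 2 x = tensor_map scale (TP 1) (id_on (TP 1)) (TP 2) \<sigma> x"
    proof (rule lin_on_TP_eq2[OF lin_on_endos[OF sg_endos[OF 12(2)]] lin_on_endos[OF e2] s(2)[symmetric] _ x])
      fix a b assume ab: "a \<in> TP 1" "b \<in> TP 2"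
      show "sg 3 2 (a \<star> b) = tensor_map scale (TP 1) (id_on (TP 1)) (TP 2) \<sigma> (a \<star> b)"
        using sg_apply[OF ab unit_mem, of 3] tmult_unit_right[OF ab(2)]
          tmult_unit_right[OF endos_mem[OF sigma_endos ab(2)]]
          tensor_map_TP_apply[OF id_TP sigma_endos ab] ab
        by (simp add: id_on_def numeral_2_eq_2)
    qed
  qed
qed

lemma sg_braid_3: "sg 3 1 \<circ> sg 3 2 \<circ> sg 3 1 = sg 3 2 \<circ> sg 3 1 \<circ> sg 3 2"
  using braiding unfolding braiding_def Let_def sg_3 by blast

lemma sg_braid:
  assumes i: "i \<in> {1..<n}" "Suc i \<in> {1..<n}"
  shows "sg n i \<circ> sg n (Suc i) \<circ> sg n i = sg n (Suc i) \<circ> sg n i \<circ> sg n (Suc i)"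
proof (rule endos_eqI[where W = "TP n"])
  \<comment> \<open>Both generators live on three neighbouring entries; l and r count the entries on
    either side.\<close>
  define l r where "l = i - 1" and "r = n - l - 3"
  have n: "n = l + (3 + r)" "i = l + 1" using i by (auto simp: l_def r_def)
  fix x assume x: "x \<in> TP n"
  have e: "sg n i \<circ> sg n (Suc i) \<circ> sg n i \<in> endos (TP n)"
    "sg n (Suc i) \<circ> sg n i \<circ> sg n (Suc i) \<in> endos (TP n)"
    by (intro endos_comp subspace_tensor_power sg_endos i)+
  have local: "sg n (l + k) (a \<star> t \<star> c) = a \<star> sg 3 k t \<star> c"
    if "k \<in> {1..<3}" "a \<in> TP l" "t \<in> TP 3" "c \<in> TP r" for a t c k
  proof -
    have "k \<in> {1..<3 + r}" using that(1) by auto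
    from sg_right[OF this that(2) tmult_mem[OF that(3,4)]] sg_left[OF that(1,3,4)]
    show ?thesis by (simp add: n(1))
  qed
  have 12: "1 \<in> {1..<3::nat}" "2 \<in> {1..<3::nat}" by auto
  have si: "Suc i = l + 2" using n by simp
  show "(sg n i \<circ> sg n (Suc i) \<circ> sg n i) x = (sg n (Suc i) \<circ> sg n i \<circ> sg n (Suc i)) x"
  proof (rule lin_on_TP_eq3[OF lin_on_endos[OF e(1)] lin_on_endos[OF e(2)] n(1) _ x])
    fix a t c assume abc: "a \<in> TP l" "t \<in> TP 3" "c \<in> TP r"
    note m = endos_mem[OF sg_endos[OF 12(1)]] endos_mem[OF sg_endos[OF 12(2)]]
    show "(sg n i \<circ> sg n (Suc i) \<circ> sg n i) (a \<star> t \<star> c) =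
        (sg n (Suc i) \<circ> sg n i \<circ> sg n (Suc i)) (a \<star> t \<star> c)"
      unfolding si unfolding n(2) o_apply
      using fun_cong[OF sg_braid_3, of t] abc
      by (simp only: local[OF 12(1)] local[OF 12(2)] m o_apply)
  qed
qed (intro endos_comp subspace_tensor_power sg_endos i)+

section \<open>The operators T_w and reduced words\<close>

definition op_word :: "nat \<Rightarrow> nat list \<Rightarrow> 'v tensor \<Rightarrow> 'v tensor" where
  "op_word n is = foldr (\<lambda>i f. sg n i \<circ> f) is (id_on (TP n))"

abbreviation TT :: "nat \<Rightarrow> (nat \<Rightarrow> nat) \<Rightarrow> 'v tensor \<Rightarrow> 'v tensor" where
  "TT \<equiv> T_perm scale \<sigma>"

lemma op_word_Nil: "op_word n [] = id_on (TP n)"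
  by (simp add: op_word_def)

lemma op_word_Cons: "op_word n (k # is) = sg n k \<circ> op_word n is"
  by (simp add: op_word_def)

lemma op_word_endos: "set is \<subseteq> {1..<n} \<Longrightarrow> op_word n is \<in> endos (TP n)"
proof (induction "is")
  case (Cons k "is")
  then have "sg n k \<circ> op_word n is \<in> endos (TP n)"
    by (intro endos_comp subspace_tensor_power sg_endos) auto
  then show ?case by (simp only: op_word_Cons)
qed (simp only: op_word_Nil id_TP)

lemma op_word_append:
  assumes "set js \<subseteq> {1..<n}"
  shows "op_word n (is @ js) = op_word n is \<circ> op_word n js"
proof (induction "is")
  case Nil
  \<comment> \<open>The fold ends in \<open>id_on\<close>, which is absorbed because
    \<open>op_word n js\<close> already has values in \<open>TP n\<close>.\<close>
  then show ?case using id_on_comp[OF op_word_endos[OF assms] TP_0]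
    by (simp only: op_word_Nil append_Nil)
next
  case (Cons k "is")
  then show ?case by (simp only: op_word_Cons append_Cons comp_assoc)
qed

text \<open>Removes the choice in \<open>T_perm\<close>: the chosen word and the given one are both
  reduced, so \<open>matsumoto\<close> identifies the two folds.\<close>

lemma TT_reduced_word:
  assumes "w permutes {1..n}" "reduced_word n w is"
  shows "TT n w = op_word n is"
  unfolding T_perm_def op_word_def
proof (rule matsumoto[where g = "sg n" and n = n, OF _ _ assms(1) _ assms(2)])
  show "reduced_word n w (SOME is. reduced_word n w is)"
    by (rule someI_ex[OF exists_reduced_word[OF assms(1)]])
qed (rule sg_commute sg_braid; assumption)+

lemma TT_endos: "w permutes {1..n} \<Longrightarrow> TT n w \<in> endos (TP n)"
  using exists_reduced_word[of w n] TT_reduced_word op_word_endos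
  by (metis reduced_word_def)

lemma TT_id: "TT n id = id_on (TP n)"
proof -
  have "reduced_word n id []" by (simp add: reduced_word_def)
  from TT_reduced_word[OF permutes_id this] show ?thesis by (simp add: op_word_Nil)
qed

text \<open>When inversion numbers add, concatenating reduced words of x and y gives a reduced word
  of the composite.\<close>

lemma TT_comp:
  assumes x: "x permutes {1..n}" and y: "y permutes {1..n}"
    and len: "inversion_number n (x \<circ> y) = inversion_number n x + inversion_number n y"
  shows "TT n (x \<circ> y) = TT n x \<circ> TT n y"
proof -
  note xy = permutes_compose[OF y x]
  obtain "is" js where r: "reduced_word n x is" "reduced_word n y js"
    using exists_reduced_word x y by blast
  then have xyr: "reduced_word n (x \<circ> y) (is @ js)"
    using len
    by (simp add: reduced_word_iff[OF x] reduced_word_iff[OF y] reduced_word_iff[OF xy] word_perm_append)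
  then show ?thesis
    using TT_reduced_word[OF xy xyr] TT_reduced_word[OF x r(1)] TT_reduced_word[OF y r(2)]
      op_word_append[of js n "is"] r(2) by (simp only: reduced_word_def)
qed

lemma op_word_left:
  assumes "set is \<subseteq> {1..<i}" "x \<in> TP i" "y \<in> TP j"
  shows "op_word (i + j) is (x \<star> y) = op_word i is x \<star> y"
  using assms(1)
proof (induction "is")
  case Nil
  then show ?case using assms tmult_mem by (simp add: op_word_Nil id_on_def)
next
  case (Cons k "is")
  then have "op_word i is x \<in> TP i" using endos_mem[OF op_word_endos assms(2)] by simp
  with Cons show ?case using sg_left[OF _ _ assms(3), of k i] by (simp add: op_word_Cons)
qed

lemma op_word_right:
  assumes "set is \<subseteq> {1..<j}" "x \<in> TP i" "y \<in> TP j"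
  shows "op_word (i + j) (map ((+) i) is) (x \<star> y) = x \<star> op_word j is y"
  using assms(1)
proof (induction "is")
  case Nil
  then show ?case using assms tmult_mem by (simp add: op_word_Nil id_on_def)
next
  case (Cons k "is")
  then have "op_word j is y \<in> TP j" using endos_mem[OF op_word_endos assms(3)] by simp
  with Cons show ?case using sg_right[OF _ assms(2), of k j] by (simp add: op_word_Cons)
qed

text \<open>A reduced word of u followed by a shifted reduced word of v is reduced by
  \<open>inversion_number_block\<close>; the letters of the first act on x only, those of the second
  on y only.\<close>

lemma TT_block:
  assumes u: "u permutes {1..i}" and v: "v permutes {1..j}" and x: "x \<in> TP i" and y: "y \<in> TP j"
  shows "TT (i + j) (u \<circ> shift_perm i v) (x \<star> y) = TT i u x \<star> TT j v y"
proof -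
  obtain "is" js where r: "reduced_word i u is" "reduced_word j v js"
    using exists_reduced_word u v by blast
  have w: "u \<circ> shift_perm i v permutes {1..i + j}"
    using block_perms_bij[of i j] u v by (force simp: bij_betw_def block_perms_def)
  have s: "set is \<subseteq> {1..<i}" "set js \<subseteq> {1..<j}" using r by (auto simp: reduced_word_def)
  then have s': "set (map ((+) i) js) \<subseteq> {1..<i + j}" by auto
  have "word_perm (is @ map ((+) i) js) = u \<circ> shift_perm i v"
    using shift_perm_word_perm[OF s(2), of i] r by (simp add: word_perm_append reduced_word_def)
  then have "reduced_word (i + j) (u \<circ> shift_perm i v) (is @ map ((+) i) js)"
    using r s s' inversion_number_block[OF u v]
    by (auto simp: reduced_word_iff[OF u] reduced_word_iff[OF v] reduced_word_iff[OF w])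
  from TT_reduced_word[OF w this]
  have "TT (i + j) (u \<circ> shift_perm i v) (x \<star> y) =
      op_word (i + j) is (op_word (i + j) (map ((+) i) js) (x \<star> y))"
    by (simp add: op_word_append[OF s'])
  also have "\<dots> = op_word i is x \<star> op_word j js y"
    using op_word_right[OF s(2) x y] op_word_left[OF s(1) x endos_mem[OF op_word_endos[OF s(2)] y]]
    by simp
  finally show ?thesis using TT_reduced_word u v r by simp
qed

section \<open>Quantum symmetric powers\<close>

abbreviation qs :: "nat \<Rightarrow> 'v tensor \<Rightarrow> 'v tensor" where
  "qs \<equiv> quantum_symmetrizer scale \<sigma>"

abbreviation SP :: "nat \<Rightarrow> 'v tensor set" where
  "SP \<equiv> Ssym scale \<sigma>"

abbreviation sh :: "nat \<Rightarrow> nat \<Rightarrow> 'v tensor \<Rightarrow> 'v tensor" where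
  "sh \<equiv> quantum_shuffle scale \<sigma>"

lemma qs_endos: "qs n \<in> endos (TP n)"
  unfolding quantum_symmetrizer_def by (rule sum_endos[OF subspace_tensor_power]) (simp add: TT_endos)

lemma sh_endos: "sh i j \<in> endos (TP (i + j))"
  unfolding quantum_shuffle_def
  by (rule sum_endos[OF subspace_tensor_power]) (simp add: TT_endos shuffle_perms_def)

lemma subspace_SP: "tensor.subspace (SP n)"
  unfolding Ssym_def by (rule lin_on_image_subspace[OF lin_on_endos[OF qs_endos] subspace_tensor_power])

lemma SP_subset: "SP n \<subseteq> TP n"
  unfolding Ssym_def using endos_mem[OF qs_endos] by blast

lemma qs_mem_SP: "x \<in> TP n \<Longrightarrow> qs n x \<in> SP n"
  unfolding Ssym_def by blast

text \<open>By \<open>TT_block\<close> this is a double sum of products, which bilinearity factors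
  into two symmetrizers.\<close>

lemma sum_block_perms:
  assumes x: "x \<in> TP i" and y: "y \<in> TP j"
  shows "(\<Sum>b\<in>block_perms i j. TT (i + j) b (x \<star> y)) = qs i x \<star> qs j y"
proof -
  note m = endos_mem[OF TT_endos]
  have "(\<Sum>b\<in>block_perms i j. TT (i + j) b (x \<star> y)) =
      (\<Sum>(u, v)\<in>{u. u permutes {1..i}} \<times> {v. v permutes {1..j}}. TT i u x \<star> TT j v y)"
    using sum.reindex_bij_betw[OF block_perms_bij, of "\<lambda>b. TT (i + j) b (x \<star> y)" i j, symmetric]
    by (simp add: case_prod_beta) (rule sum.cong, auto simp: TT_block x y)
  also have "\<dots> = (\<Sum>u | u permutes {1..i}. \<Sum>v | v permutes {1..j}. TT i u x \<star> TT j v y)"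
    by (rule sum.cartesian_product[symmetric])
  also have "\<dots> = (\<Sum>u | u permutes {1..i}. TT i u x \<star> qs j y)"
    unfolding quantum_symmetrizer_def
    by (rule sum.cong[OF refl], rule lin_on_sum_apply[OF lin_on_right subspace_tensor_power, symmetric])
      (auto intro: m x y)
  also have "\<dots> = qs i x \<star> qs j y"
    unfolding quantum_symmetrizer_def[of _ _ i]
    by (rule lin_on_sum_apply[OF lin_on_left tensor.subspace_UNIV, symmetric]) simp
  finally show ?thesis .
qed

lemma shuffle_blockD:
  assumes "x \<in> shuffle_perms i j" "y \<in> block_perms i j"
  shows "x permutes {1..i + j}" "y permutes {1..i + j}"
  using assms by (auto simp: shuffle_perms_def block_perms_def)

lemma sh_qs:
  assumes x: "x \<in> TP i" and y: "y \<in> TP j"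
  shows "sh i j (qs i x \<star> qs j y) = qs (i + j) (x \<star> y)"
proof -
  note xy = tmult_mem[OF x y]
  have "qs (i + j) (x \<star> y) =
      (\<Sum>(s, b)\<in>shuffle_perms i j \<times> block_perms i j. TT (i + j) (s \<circ> b) (x \<star> y))"
    unfolding quantum_symmetrizer_def
    using sum.reindex_bij_betw[OF shuffle_block_bij, of "\<lambda>b. TT (i + j) b (x \<star> y)" i j, symmetric]
    by (simp add: case_prod_beta)
  also have "\<dots> = (\<Sum>s\<in>shuffle_perms i j. \<Sum>b\<in>block_perms i j. TT (i + j) (s \<circ> b) (x \<star> y))"
    by (rule sum.cartesian_product[symmetric])
  also have "\<dots> = (\<Sum>s\<in>shuffle_perms i j. \<Sum>b\<in>block_perms i j. TT (i + j) s (TT (i + j) b (x \<star> y)))"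
    by (intro sum.cong refl)
      (simp add: TT_comp[OF shuffle_blockD] inversion_number_shuffle_block)
  also have "\<dots> = (\<Sum>s\<in>shuffle_perms i j. TT (i + j) s (\<Sum>b\<in>block_perms i j. TT (i + j) b (x \<star> y)))"
    by (rule sum.cong[OF refl],
        rule lin_on_sum_apply[OF lin_on_endos[OF TT_endos] subspace_tensor_power, symmetric])
      (auto simp: shuffle_perms_def block_perms_def intro: endos_mem[OF TT_endos] xy)
  also have "\<dots> = sh i j (qs i x \<star> qs j y)"
    by (simp add: quantum_shuffle_def sum_block_perms[OF x y])
  finally show ?thesis ..
qed

lemma sum_block_perms_mem:
  assumes z: "z \<in> TP (i + j)"
  shows "(\<Sum>b\<in>block_perms i j. TT (i + j) b z) \<in> tensor_product scale (SP i) (SP j)"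
proof (rule lin_on_tensor_product_mem[OF _ subspace_tensor_product _ z[folded tensor_product_TP]])
  show "lin_on (tensor_product scale (TP i) (TP j)) (\<lambda>z. \<Sum>b\<in>block_perms i j. TT (i + j) b z)"
    unfolding tensor_product_TP
    by (intro lin_on_sum lin_on_endos TT_endos) (simp add: block_perms_def)
qed (auto simp: sum_block_perms intro: tensor_product_mem qs_mem_SP)

lemma SP_subset_product: "SP (i + j) \<subseteq> tensor_product scale (SP i) (SP j)"
proof
  fix t assume "t \<in> SP (i + j)"
  then obtain z where z: "z \<in> TP (i + j)" "t = qs (i + j) z" unfolding Ssym_def by blast
  let ?S = "shuffle_perms i j" and ?B = "block_perms i j" and ?I = "inv_into UNIV :: (nat \<Rightarrow> nat) \<Rightarrow> _"
  let ?n = "i + j"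
  have binv: "bij_betw ?I {w. w permutes {1..?n}} {w. w permutes {1..?n}}"
    by (rule bij_betw_byWitness[where f' = ?I]) (auto simp: permutes_inv permutes_inv_inv)
  have bB: "bij_betw ?I ?B ?B"
  proof (rule bij_betw_byWitness[where f' = ?I])
    have "?I (?I b) = b" if "b \<in> ?B" for b
      using that by (auto simp: block_perms_def intro: permutes_inv_inv)
    then show "\<forall>b\<in>?B. ?I (?I b) = b" "\<forall>b\<in>?B. ?I (?I b) = b" by blast+
  qed (use block_perms_inv in blast)+
  have bS: "bij_betw (\<lambda>p. ?I (case p of (x, y) \<Rightarrow> x \<circ> y)) (?S \<times> ?B) {w. w permutes {1..?n}}"
    using bij_betw_trans[OF shuffle_block_bij binv] by (simp add: comp_def)
  \<comment> \<open>Inverting reverses the factorisation and keeps inversion numbers. The block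
    factor now acts last, where \<open>sum_block_perms_mem\<close> controls the image.\<close>
  have split: "TT ?n (?I (s \<circ> b)) = TT ?n (?I b) \<circ> TT ?n (?I s)" if "s \<in> ?S" "b \<in> ?B" for s b
  proof -
    note p = shuffle_blockD[OF that]
    have eq: "?I (s \<circ> b) = ?I b \<circ> ?I s"
      by (rule o_inv_distrib[OF permutes_bij[OF p(1)] permutes_bij[OF p(2)]])
    have "inversion_number ?n (?I b \<circ> ?I s) = inversion_number ?n (?I b) + inversion_number ?n (?I s)"
      using inversion_number_shuffle_block[OF that] inversion_number_inv p permutes_compose[OF p(2,1)]
      by (simp add: eq[symmetric])
    then show ?thesis unfolding eq by (intro TT_comp permutes_inv p)
  qed
  define z' where "z' = (\<Sum>s\<in>?S. TT ?n (?I s) z)"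
  have m: "TT ?n (?I s) z \<in> TP ?n" if "s \<in> ?S" for s
    using that z(1) by (intro endos_mem[OF TT_endos] permutes_inv) (auto simp: shuffle_perms_def)
  have z': "z' \<in> TP ?n" unfolding z'_def by (rule tensor.subspace_sum[OF subspace_tensor_power m])
  have "t = (\<Sum>(s, b)\<in>?S \<times> ?B. TT ?n (?I (s \<circ> b)) z)"
    unfolding z(2) quantum_symmetrizer_def
    using sum.reindex_bij_betw[OF bS, of "\<lambda>w. TT ?n w z", symmetric]
    by (simp add: case_prod_beta)
  also have "\<dots> = (\<Sum>s\<in>?S. \<Sum>b\<in>?B. TT ?n (?I (s \<circ> b)) z)"
    by (rule sum.cartesian_product[symmetric])
  also have "\<dots> = (\<Sum>s\<in>?S. \<Sum>b\<in>?B. TT ?n (?I b) (TT ?n (?I s) z))"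
    by (intro sum.cong refl) (simp add: split)
  also have "\<dots> = (\<Sum>b\<in>?B. \<Sum>s\<in>?S. TT ?n (?I b) (TT ?n (?I s) z))"
    by (rule sum.swap)
  also have "\<dots> = (\<Sum>b\<in>?B. TT ?n (?I b) z')"
    unfolding z'_def
    by (rule sum.cong[OF refl],
        rule lin_on_sum_apply[OF lin_on_endos[OF TT_endos] subspace_tensor_power m, symmetric])
      (auto simp: block_perms_def intro: permutes_inv)
  \<comment> \<open>Block permutations form a group, so inversion only permutes the
    summands.\<close>
  also have "\<dots> = (\<Sum>b\<in>?B. TT ?n b z')"
    by (rule sum.reindex_bij_betw[OF bB])
  finally show "t \<in> tensor_product scale (SP i) (SP j)" using sum_block_perms_mem[OF z'] by simp
qed

lemma sh_mem:
  assumes "z \<in> tensor_product scale (SP i) (SP j)"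
  shows "sh i j z \<in> SP (i + j)"
proof (rule lin_on_tensor_product_mem[OF _ subspace_SP _ assms])
  show "lin_on (tensor_product scale (SP i) (SP j)) (sh i j)"
    by (rule lin_on_subset[OF lin_on_endos[OF sh_endos] tensor_product_subset_TP[OF SP_subset SP_subset]])
  fix x y assume "x \<in> SP i" "y \<in> SP j"
  then obtain a b where "a \<in> TP i" "b \<in> TP j" "x = qs i a" "y = qs j b" unfolding Ssym_def by blast
  then show "sh i j (x \<star> y) \<in> SP (i + j)" using sh_qs qs_mem_SP[OF tmult_mem] by simp
qed

lemma sh_assoc:
  assumes "x \<in> SP i" "y \<in> SP j" "z \<in> SP k"
  shows "sh (i + j) k (sh i j (x \<star> y) \<star> z) = sh i (j + k) (x \<star> sh j k (y \<star> z))"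
proof -
  obtain a b c where abc: "a \<in> TP i" "b \<in> TP j" "c \<in> TP k" "x = qs i a" "y = qs j b" "z = qs k c"
    using assms unfolding Ssym_def by blast
  then show ?thesis
    using sh_qs[OF tmult_mem[OF abc(1,2)] abc(3)] sh_qs[OF abc(1) tmult_mem[OF abc(2,3)]]
    by (simp add: sh_qs tmult_assoc[OF abc(3)] add.assoc)
qed

lemma sh_0_left: "sh 0 j = id_on (TP j)"
  by (simp add: quantum_shuffle_def shuffle_perms_0_left TT_id)

lemma sh_0_right: "sh i 0 = id_on (TP i)"
  by (simp add: quantum_shuffle_def shuffle_perms_0_right TT_id)

text \<open>Puts the empty tensor into \<open>SP 0\<close>, on which the unit laws of convolution
  rest.\<close>

lemma SP_0: "SP 0 = TP 0"
proof -
  have "{w. w permutes {1..0::nat}} = {id}" by auto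
  then have "qs 0 = id_on (TP 0)" by (simp add: quantum_symmetrizer_def TT_id)
  then show ?thesis by (auto simp: Ssym_def id_on_def)
qed

end

section \<open>The convolution product\<close>

context braided_space
begin

abbreviation conv :: "nat \<Rightarrow> ('v tensor \<Rightarrow> 'v tensor) \<Rightarrow> nat \<Rightarrow> ('v tensor \<Rightarrow> 'v tensor) \<Rightarrow>
    'v tensor \<Rightarrow> 'v tensor" where
  "conv \<equiv> conv_hom scale \<sigma>"

abbreviation tp :: "'v tensor set \<Rightarrow> 'v tensor set \<Rightarrow> 'v tensor set" (infixr "\<otimes>\<otimes>" 75) where
  "W1 \<otimes>\<otimes> W2 \<equiv> tensor_product scale W1 W2"

abbreviation tm :: "nat \<Rightarrow> ('v tensor \<Rightarrow> 'v tensor) \<Rightarrow> nat \<Rightarrow> ('v tensor \<Rightarrow> 'v tensor) \<Rightarrow>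
    'v tensor \<Rightarrow> 'v tensor" where
  "tm i f j g \<equiv> tensor_map scale (SP i) f (SP j) g"

lemmas tm_endos = tensor_map_endos[OF subspace_SP SP_subset subspace_SP SP_subset]
lemmas tm_apply = tensor_map_apply[OF subspace_SP SP_subset subspace_SP SP_subset]
lemmas tm_eqI = tensor_map_eqI[OF subspace_SP SP_subset subspace_SP SP_subset]
lemmas SP_product_subset_TP = tensor_product_subset_TP[OF SP_subset SP_subset]

lemma lin_on_sh: "lin_on (SP i \<otimes>\<otimes> SP j) (sh i j)"
  by (rule lin_on_subset[OF lin_on_endos[OF sh_endos] SP_product_subset_TP])

lemma conv_in: "x \<in> SP (i + j) \<Longrightarrow> conv i f j g x = sh i j (tm i f j g x)"
  by (simp add: conv_hom_def)

lemma conv_out: "x \<notin> SP (i + j) \<Longrightarrow> conv i f j g x = 0"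
  by (simp add: conv_hom_def)

lemma conv_endos:
  assumes "f \<in> endos (SP i)" "g \<in> endos (SP j)"
  shows "conv i f j g \<in> endos (SP (i + j))"
proof -
  note t = tm_endos[OF assms]
  have "lin_on (SP (i + j)) (\<lambda>x. sh i j (tm i f j g x))"
    by (rule lin_on_subset[OF lin_on_comp[OF lin_on_endos[OF t] _ lin_on_sh] SP_subset_product])
      (rule endos_mem[OF t])
  then have "lin_on (SP (i + j)) (conv i f j g)"
    using lin_on_cong[OF subspace_SP, of "i + j" "conv i f j g" "\<lambda>x. sh i j (tm i f j g x)"] conv_in
    by blast
  moreover have "conv i f j g x \<in> SP (i + j)" if "x \<in> SP (i + j)" for x
    unfolding conv_in[OF that]
    by (rule sh_mem[OF endos_mem[OF t]]) (use that SP_subset_product in blast)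
  ultimately show ?thesis by (simp add: endos_iff conv_out)
qed

text \<open>A tensor map is determined by its values on products, so any h that is linear there and
  has these values may replace it. Bilinearity and associativity of convolution both go through this
  exchange.\<close>

lemma conv_eq_sh:
  assumes "f \<in> endos (SP i)" "g \<in> endos (SP j)" "x \<in> SP (i + j)"
    and "lin_on (SP i \<otimes>\<otimes> SP j) h"
    and "\<And>a b. a \<in> SP i \<Longrightarrow> b \<in> SP j \<Longrightarrow> h (a \<star> b) = f a \<star> g b"
  shows "conv i f j g x = sh i j (h x)"
proof -
  have "x \<in> SP i \<otimes>\<otimes> SP j" using SP_subset_product assms(3) by blast
  then show ?thesis using tm_eqI[OF assms(1,2,4,5)] by (simp add: conv_in assms(3))
qed

lemma sh_add: "x \<in> SP i \<otimes>\<otimes> SP j \<Longrightarrow> y \<in> SP i \<otimes>\<otimes> SP j \<Longrightarrow> sh i j (x + y) = sh i j x + sh i j y"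
  using lin_on_sh unfolding lin_on_def by blast

lemma sh_scale: "x \<in> SP i \<otimes>\<otimes> SP j \<Longrightarrow> sh i j (tscale c x) = tscale c (sh i j x)"
  using lin_on_sh unfolding lin_on_def by blast

lemma conv_add_left:
  assumes "f \<in> endos (SP i)" "f' \<in> endos (SP i)" "g \<in> endos (SP j)"
  shows "conv i (\<lambda>x. f x + f' x) j g = (\<lambda>x. conv i f j g x + conv i f' j g x)"
proof
  note t = tm_endos[OF assms(1,3)] tm_endos[OF assms(2,3)]
  fix x
  show "conv i (\<lambda>x. f x + f' x) j g x = conv i f j g x + conv i f' j g x"
  proof (cases "x \<in> SP (i + j)")
    case True
    then have x: "x \<in> SP i \<otimes>\<otimes> SP j" using SP_subset_product by blast
    have "conv i (\<lambda>x. f x + f' x) j g x = sh i j (tm i f j g x + tm i f' j g x)"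
      by (rule conv_eq_sh[OF add_endos[OF subspace_SP assms(1,2)] assms(3) True
            lin_on_add[OF t[THEN lin_on_endos]]])
        (simp only: tm_apply[OF assms(1,3)] tm_apply[OF assms(2,3)] tensor_mult_add_left)
    then show ?thesis
      using True sh_add[OF endos_mem[OF t(1) x] endos_mem[OF t(2) x]] by (simp only: conv_in)
  qed (simp add: conv_out)
qed

lemma conv_add_right:
  assumes "f \<in> endos (SP i)" "g \<in> endos (SP j)" "g' \<in> endos (SP j)"
  shows "conv i f j (\<lambda>x. g x + g' x) = (\<lambda>x. conv i f j g x + conv i f j g' x)"
proof
  note t = tm_endos[OF assms(1,2)] tm_endos[OF assms(1,3)]
  fix x
  show "conv i f j (\<lambda>x. g x + g' x) x = conv i f j g x + conv i f j g' x"
  proof (cases "x \<in> SP (i + j)")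
    case True
    then have x: "x \<in> SP i \<otimes>\<otimes> SP j" using SP_subset_product by blast
    have "conv i f j (\<lambda>x. g x + g' x) x = sh i j (tm i f j g x + tm i f j g' x)"
    proof (rule conv_eq_sh[OF assms(1) add_endos[OF subspace_SP assms(2,3)] True
            lin_on_add[OF t[THEN lin_on_endos]]])
      fix a b assume ab: "a \<in> SP i" "b \<in> SP j"
      \<comment> \<open>In its right argument \<open>tensor_mult\<close> is additive only on tensor
        powers, so these memberships have to be supplied.\<close>
      have "f a \<in> TP i" "g b \<in> TP j" "g' b \<in> TP j"
        using assms endos_mem ab SP_subset by blast+
      then show "tm i f j g (a \<star> b) + tm i f j g' (a \<star> b) = f a \<star> (g b + g' b)"
        using tensor_mult_add_right[OF V, of "f a" i "g b" j "g' b"]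
        by (simp only: tm_apply[OF assms(1,2) ab] tm_apply[OF assms(1,3) ab])
    qed
    then show ?thesis
      using True sh_add[OF endos_mem[OF t(1) x] endos_mem[OF t(2) x]] by (simp only: conv_in)
  qed (simp add: conv_out)
qed

lemma conv_scale_left:
  assumes "f \<in> endos (SP i)" "g \<in> endos (SP j)"
  shows "conv i (\<lambda>x. tscale c (f x)) j g = (\<lambda>x. tscale c (conv i f j g x))"
proof
  note t = tm_endos[OF assms]
  fix x
  show "conv i (\<lambda>x. tscale c (f x)) j g x = tscale c (conv i f j g x)"
  proof (cases "x \<in> SP (i + j)")
    case True
    then have x: "x \<in> SP i \<otimes>\<otimes> SP j" using SP_subset_product by blast
    have "conv i (\<lambda>x. tscale c (f x)) j g x = sh i j (tscale c (tm i f j g x))"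
      by (rule conv_eq_sh[OF scale_endos[OF subspace_SP assms(1)] assms(2) True
            lin_on_scale[OF lin_on_endos[OF t]]])
        (simp only: tm_apply[OF assms] tensor_mult_scale_left)
    then show ?thesis using True sh_scale[OF endos_mem[OF t x]] by (simp only: conv_in)
  qed (simp add: conv_out)
qed

lemma conv_scale_right:
  assumes "f \<in> endos (SP i)" "g \<in> endos (SP j)"
  shows "conv i f j (\<lambda>x. tscale c (g x)) = (\<lambda>x. tscale c (conv i f j g x))"
proof
  note t = tm_endos[OF assms]
  fix x
  show "conv i f j (\<lambda>x. tscale c (g x)) x = tscale c (conv i f j g x)"
  proof (cases "x \<in> SP (i + j)")
    case True
    then have x: "x \<in> SP i \<otimes>\<otimes> SP j" using SP_subset_product by blast
    have "conv i f j (\<lambda>x. tscale c (g x)) x = sh i j (tscale c (tm i f j g x))"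
    proof (rule conv_eq_sh[OF assms(1) scale_endos[OF subspace_SP assms(2)] True
            lin_on_scale[OF lin_on_endos[OF t]]])
      fix a b assume ab: "a \<in> SP i" "b \<in> SP j"
      have "f a \<in> TP i" "g b \<in> TP j"
        using assms endos_mem ab SP_subset by blast+
      then show "tscale c (tm i f j g (a \<star> b)) = f a \<star> tscale c (g b)"
        using tensor_mult_scale_right[OF V, of "f a" i "g b" j]
        by (simp only: tm_apply[OF assms ab])
    qed
    then show ?thesis using True sh_scale[OF endos_mem[OF t x]] by (simp only: conv_in)
  qed (simp add: conv_out)
qed

text \<open>The zero map is 0 times itself, so homogeneity suffices.\<close>

lemma conv_zero_left: "g \<in> endos (SP j) \<Longrightarrow> conv i (\<lambda>x. 0) j g = (\<lambda>x. 0)"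
  using conv_scale_left[OF zero_endos[OF subspace_SP], of g j i 0] by simp

lemma conv_zero_right: "f \<in> endos (SP i) \<Longrightarrow> conv i f j (\<lambda>x. 0) = (\<lambda>x. 0)"
  using conv_scale_right[OF _ zero_endos[OF subspace_SP], of f i j 0] by simp

lemma conv_sum_left:
  assumes "\<And>a. a \<in> S \<Longrightarrow> f a \<in> endos (SP i)" "g \<in> endos (SP j)"
  shows "conv i (\<lambda>x. \<Sum>a\<in>S. f a x) j g = (\<lambda>x. \<Sum>a\<in>S. conv i (f a) j g x)"
  using assms(1)
proof (induction S rule: infinite_finite_induct)
  case (insert a S)
  then have "f a \<in> endos (SP i)" "(\<lambda>x. \<Sum>a\<in>S. f a x) \<in> endos (SP i)"
    by (auto intro: sum_endos subspace_SP)
  from conv_add_left[OF this assms(2)]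
  have "conv i (\<lambda>x. f a x + (\<Sum>a\<in>S. f a x)) j g =
      (\<lambda>x. conv i (f a) j g x + conv i (\<lambda>x. \<Sum>a\<in>S. f a x) j g x)" .
  moreover have "conv i (\<lambda>x. \<Sum>a\<in>S. f a x) j g = (\<lambda>x. \<Sum>a\<in>S. conv i (f a) j g x)"
    using insert by blast
  ultimately show ?case by (simp only: sum.insert[OF insert(1,2)])
qed (simp_all add: conv_zero_left assms(2))

lemma conv_sum_right:
  assumes "\<And>a. a \<in> S \<Longrightarrow> g a \<in> endos (SP j)" "f \<in> endos (SP i)"
  shows "conv i f j (\<lambda>x. \<Sum>a\<in>S. g a x) = (\<lambda>x. \<Sum>a\<in>S. conv i f j (g a) x)"
  using assms(1)
proof (induction S rule: infinite_finite_induct)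
  case (insert a S)
  then have "g a \<in> endos (SP j)" "(\<lambda>x. \<Sum>a\<in>S. g a x) \<in> endos (SP j)"
    by (auto intro: sum_endos subspace_SP)
  from conv_add_right[OF assms(2) this]
  have "conv i f j (\<lambda>x. g a x + (\<Sum>a\<in>S. g a x)) =
      (\<lambda>x. conv i f j (g a) x + conv i f j (\<lambda>x. \<Sum>a\<in>S. g a x) x)" .
  moreover have "conv i f j (\<lambda>x. \<Sum>a\<in>S. g a x) = (\<lambda>x. \<Sum>a\<in>S. conv i f j (g a) x)"
    using insert by blast
  ultimately show ?case by (simp only: sum.insert[OF insert(1,2)])
qed (simp_all add: conv_zero_right assms(2))

text \<open>Checked on generators; it gives the two nested tensor maps in \<open>conv_assoc\<close>
  a common domain.\<close>

lemma tensor_product_assoc: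
  assumes "W2 \<subseteq> TP j" "W1 \<subseteq> TP i" "W3 \<subseteq> TP k"
  shows "(W1 \<otimes>\<otimes> W2) \<otimes>\<otimes> W3 = W1 \<otimes>\<otimes> W2 \<otimes>\<otimes> W3"
proof
  have as: "(x \<star> y) \<star> z = x \<star> y \<star> z" if "z \<in> W3" for x y z
    using that assms(3) tmult_assoc by blast
  have "x \<star> z \<in> W1 \<otimes>\<otimes> W2 \<otimes>\<otimes> W3" if "x \<in> W1 \<otimes>\<otimes> W2" "z \<in> W3" for x z
    by (rule lin_on_tensor_product_mem[OF lin_on_left subspace_tensor_product _ that(1)])
      (simp add: as that(2) tensor_product_mem)
  then show "(W1 \<otimes>\<otimes> W2) \<otimes>\<otimes> W3 \<subseteq> W1 \<otimes>\<otimes> W2 \<otimes>\<otimes> W3"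
    using lin_on_tensor_product_mem[OF lin_on_id subspace_tensor_product] by blast
  have "x \<star> z \<in> (W1 \<otimes>\<otimes> W2) \<otimes>\<otimes> W3" if "x \<in> W1" "z \<in> W2 \<otimes>\<otimes> W3" for x z
  proof (rule lin_on_tensor_product_mem[OF _ subspace_tensor_product _ that(2)])
    show "lin_on (W2 \<otimes>\<otimes> W3) ((\<star>) x)"
      by (rule lin_on_subset[OF lin_on_right tensor_product_subset_TP[OF assms(1,3)]])
        (use that(1) assms(2) in blast)
  qed (simp add: as[symmetric] that(1) tensor_product_mem)
  then show "W1 \<otimes>\<otimes> W2 \<otimes>\<otimes> W3 \<subseteq> (W1 \<otimes>\<otimes> W2) \<otimes>\<otimes> W3"
    using lin_on_tensor_product_mem[OF lin_on_id subspace_tensor_product] by blast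
qed

text \<open>Both sides extend from \<open>S\<^bsup>i+j+k\<^esup>\<close> to \<open>S\<^sup>i \<otimes> S\<^sup>j \<otimes> S\<^sup>k\<close>, where they can be compared on
  products.\<close>

lemma conv_assoc:
  assumes f: "f \<in> endos (SP i)" and g: "g \<in> endos (SP j)" and h: "h \<in> endos (SP k)"
  shows "conv (i + j) (conv i f j g) k h = conv i f (j + k) (conv j g k h)"
proof
  fix x
  show "conv (i + j) (conv i f j g) k h x = conv i f (j + k) (conv j g k h) x"
  proof (cases "x \<in> SP (i + j + k)")
    case False
    then show ?thesis by (simp add: conv_out add.assoc)
  next
    case True
    let ?U = "(SP i \<otimes>\<otimes> SP j) \<otimes>\<otimes> SP k"
    have U: "?U = SP i \<otimes>\<otimes> SP j \<otimes>\<otimes> SP k" by (rule tensor_product_assoc[OF SP_subset SP_subset SP_subset])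
    have x: "x \<in> ?U"
      using True SP_subset_product[of "i + j" k] tensor_product_mono[OF SP_subset_product[of i j] subset_refl]
      by blast
    \<comment> \<open>This is \<open>conv\<close> without the cut-off to \<open>SP (i + j)\<close>,
      so that it can be evaluated on a single product of elements of \<open>SP i\<close> and
      \<open>SP j\<close>.\<close>
    define ext where "ext i f j g = (\<lambda>z. if z \<in> SP i \<otimes>\<otimes> SP j then sh i j (tm i f j g z) else 0)"
      for i j f g
    have ext: "ext i f j g \<in> endos (SP i \<otimes>\<otimes> SP j)" "\<And>z. z \<in> SP (i + j) \<Longrightarrow> conv i f j g z = ext i f j g z"
      "\<And>a b. a \<in> SP i \<Longrightarrow> b \<in> SP j \<Longrightarrow> ext i f j g (a \<star> b) = sh i j (f a \<star> g b)"
      if "f \<in> endos (SP i)" "g \<in> endos (SP j)" for i j f g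
    proof -
      note t = tm_endos[OF that]
      have "lin_on (SP i \<otimes>\<otimes> SP j) (\<lambda>z. sh i j (tm i f j g z))"
        by (rule lin_on_comp[OF lin_on_endos[OF t] _ lin_on_sh]) (rule endos_mem[OF t])
      then have "lin_on (SP i \<otimes>\<otimes> SP j) (ext i f j g)"
        using lin_on_cong[OF subspace_tensor_product, of "SP i" "SP j" "ext i f j g"]
        unfolding ext_def by simp
      \<comment> \<open>The shuffle lands in \<open>SP (i + j)\<close>, which lies inside the tensor
        product again. So \<open>ext\<close> is an endomorphism, as a factor of
        \<open>tensor_map\<close> has to be.\<close>
      moreover have "sh i j (tm i f j g z) \<in> SP i \<otimes>\<otimes> SP j" if "z \<in> SP i \<otimes>\<otimes> SP j" for z
        using sh_mem[OF endos_mem[OF t that]] SP_subset_product by blast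
      ultimately show "ext i f j g \<in> endos (SP i \<otimes>\<otimes> SP j)" by (simp add: endos_iff ext_def)
      show "conv i f j g z = ext i f j g z" if "z \<in> SP (i + j)" for z
        using that SP_subset_product by (auto simp: conv_in ext_def)
      show "ext i f j g (a \<star> b) = sh i j (f a \<star> g b)" if "a \<in> SP i" "b \<in> SP j" for a b
        using that tm_apply[OF \<open>f \<in> _\<close> \<open>g \<in> _\<close> that] by (simp add: ext_def tensor_product_mem)
    qed
    define L where "L = tensor_map scale (SP i \<otimes>\<otimes> SP j) (ext i f j g) (SP k) h"
    define R where "R = tensor_map scale (SP i) f (SP j \<otimes>\<otimes> SP k) (ext j g k h)"
    note ml = subspace_tensor_product SP_product_subset_TP subspace_SP SP_subset ext(1)[OF f g] h
    note mr = subspace_SP SP_subset subspace_tensor_product SP_product_subset_TP f ext(1)[OF g h]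
    have L: "L \<in> endos ?U" unfolding L_def by (rule tensor_map_endos[OF ml])
    have R: "R \<in> endos ?U" unfolding R_def U by (rule tensor_map_endos[OF mr])
    have UT: "?U \<subseteq> TP (i + j + k)"
      by (intro tensor_product_subset_TP SP_subset)
    have 1: "conv (i + j) (conv i f j g) k h x = sh (i + j) k (L x)"
    proof (rule conv_eq_sh[OF conv_endos[OF f g] h True])
      show "lin_on (SP (i + j) \<otimes>\<otimes> SP k) L"
        by (rule lin_on_subset[OF lin_on_endos[OF L] tensor_product_mono[OF SP_subset_product subset_refl]])
      fix a b assume ab: "a \<in> SP (i + j)" "b \<in> SP k"
      then have "a \<in> SP i \<otimes>\<otimes> SP j" using SP_subset_product by blast
      then show "L (a \<star> b) = conv i f j g a \<star> h b"
        unfolding L_def using tensor_map_apply[OF ml] ab ext(2)[OF f g] by simp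
    qed
    have 2: "conv i f (j + k) (conv j g k h) x = sh i (j + k) (R x)"
    proof (rule conv_eq_sh[OF f conv_endos[OF g h]])
      show "x \<in> SP (i + (j + k))" using True by (simp add: add.assoc)
      show "lin_on (SP i \<otimes>\<otimes> SP (j + k)) R"
        by (rule lin_on_subset[OF lin_on_endos[OF R[unfolded U]] tensor_product_mono[OF subset_refl SP_subset_product]])
      fix a b assume ab: "a \<in> SP i" "b \<in> SP (j + k)"
      then have "b \<in> SP j \<otimes>\<otimes> SP k" using SP_subset_product by blast
      then show "R (a \<star> b) = f a \<star> conv j g k h b"
        unfolding R_def using tensor_map_apply[OF mr] ab ext(2)[OF g h] by simp
    qed
    have l: "lin_on ?U (\<lambda>x. sh (i + j) k (L x))"
      by (rule lin_on_comp[OF lin_on_endos[OF L] _ lin_on_endos[OF sh_endos]])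
        (use endos_mem[OF L] UT in blast)
    have r: "lin_on ?U (\<lambda>x. sh i (j + k) (R x))"
      by (rule lin_on_comp[OF lin_on_endos[OF R] _ lin_on_endos[OF sh_endos]])
        (use endos_mem[OF R] UT in \<open>auto simp: add.assoc\<close>)
    \<comment> \<open>Two reductions by linearity, first to a product t, c and then to products
      inside t, lead to triple products, where \<open>sh_assoc\<close> decides.\<close>
    have "sh (i + j) k (L x) = sh i (j + k) (R x)"
    proof (rule lin_on_tensor_product_eqI[OF l r _ x])
      fix t c assume tc: "t \<in> SP i \<otimes>\<otimes> SP j" "c \<in> SP k"
      show "sh (i + j) k (L (t \<star> c)) = sh i (j + k) (R (t \<star> c))"
      proof (rule lin_on_tensor_product_eqI[OF _ _ _ tc(1)])
        show "lin_on (SP i \<otimes>\<otimes> SP j) (\<lambda>t. sh (i + j) k (L (t \<star> c)))"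
          by (rule lin_on_comp[OF lin_on_left _ l]) (rule tensor_product_mem[OF _ tc(2)])
        show "lin_on (SP i \<otimes>\<otimes> SP j) (\<lambda>t. sh i (j + k) (R (t \<star> c)))"
          by (rule lin_on_comp[OF lin_on_left _ r]) (rule tensor_product_mem[OF _ tc(2)])
        fix a b assume ab: "a \<in> SP i" "b \<in> SP j"
        have c: "c \<in> TP k" using tc(2) SP_subset by blast
        have "L ((a \<star> b) \<star> c) = sh i j (f a \<star> g b) \<star> h c"
          unfolding L_def tensor_map_apply[OF ml tensor_product_mem[OF ab] tc(2)] ext(3)[OF f g ab] ..
        moreover have "R ((a \<star> b) \<star> c) = f a \<star> sh j k (g b \<star> h c)"
          unfolding tmult_assoc[OF c] R_def tensor_map_apply[OF mr ab(1) tensor_product_mem[OF ab(2) tc(2)]]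
            ext(3)[OF g h ab(2) tc(2)] ..
        ultimately show "sh (i + j) k (L ((a \<star> b) \<star> c)) = sh i (j + k) (R ((a \<star> b) \<star> c))"
          using sh_assoc[OF endos_mem[OF f ab(1)] endos_mem[OF g ab(2)] endos_mem[OF h tc(2)]] by simp
      qed
    qed
    then show ?thesis using 1 2 by simp
  qed
qed

lemma id_SP: "id_on (SP n) \<in> endos (SP n)"
  by (rule id_on_endos[OF subspace_SP])

lemma conv_unit_left:
  assumes g: "g \<in> endos (SP j)" shows "conv 0 (id_on (SP 0)) j g = g"
proof
  fix x
  show "conv 0 (id_on (SP 0)) j g x = g x"
  proof (cases "x \<in> SP j")
    case True
    have gx: "g x \<in> TP j" "x \<in> TP j" using endos_mem[OF g True] True SP_subset by blast+
    \<comment> \<open>Multiplying by the empty tensor exhibits x itself as a product, on which the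
      tensor map is known.\<close>
    have e: "pure_tensor scale [] \<in> SP 0" by (simp add: SP_0 unit_mem)
    have "tm 0 (id_on (SP 0)) j g x = g x"
      using tm_apply[OF id_SP g e True] e gx by (simp add: tmult_unit_left id_on_def)
    then show ?thesis using True gx conv_in[of x 0 j] by (simp add: sh_0_left id_on_def)
  qed (use endos_outside[OF g] conv_out[of x 0 j] in simp)
qed

lemma conv_unit_right:
  assumes f: "f \<in> endos (SP i)" shows "conv i f 0 (id_on (SP 0)) = f"
proof
  fix x
  show "conv i f 0 (id_on (SP 0)) x = f x"
  proof (cases "x \<in> SP i")
    case True
    have fx: "f x \<in> TP i" "x \<in> TP i" using endos_mem[OF f True] True SP_subset by blast+
    have e: "pure_tensor scale [] \<in> SP 0" by (simp add: SP_0 unit_mem)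
    have "tm i f 0 (id_on (SP 0)) x = f x"
      using tm_apply[OF f id_SP True e] e fx by (simp add: tmult_unit_right id_on_def)
    then show ?thesis using True fx conv_in[of x i 0] by (simp add: sh_0_right id_on_def)
  qed (use endos_outside[OF f] conv_out[of x i 0] in simp)
qed

text \<open>For \<open>U 0\<close> the identity, degree p > 0 of the equation saying that X
  convolved with U is the unit reads X_p + (terms with X_l, l < p) = 0; the recursion solves this
  for X_p.\<close>

fun conv_left_inv :: "'v endo_seq \<Rightarrow> 'v endo_seq" where
  "conv_left_inv U p = (if p = 0 then id_on (SP 0) else
     (\<lambda>x. tscale (-1) (\<Sum>l<p. conv l (conv_left_inv U l) (p - l) (U (p - l)) x)))"

declare conv_left_inv.simps [simp del]

end

section \<open>The convolution algebra of truncated sequences\<close>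

locale braided_space_trunc = braided_space scale \<sigma>
  for scale :: "complex \<Rightarrow> 'v::ab_group_add \<Rightarrow> 'v" and \<sigma> :: "'v tensor \<Rightarrow> 'v tensor" +
  fixes M :: nat
begin

abbreviation ES :: "'v endo_seq set" where
  "ES \<equiv> endo_seqs scale \<sigma> M"

abbreviation cprod :: "'v endo_seq \<Rightarrow> 'v endo_seq \<Rightarrow> 'v endo_seq" (infixl "\<circledast>" 70) where
  "A \<circledast> B \<equiv> conv_prod scale \<sigma> M A B"

abbreviation unit_seq :: "'v endo_seq" where
  "unit_seq \<equiv> conv_unit scale \<sigma>"

lemma ES_endos: "A \<in> ES \<Longrightarrow> p \<le> M \<Longrightarrow> A p \<in> endos (SP p)"
  by (simp add: endo_seqs_def)

lemma ES_high: "A \<in> ES \<Longrightarrow> p > M \<Longrightarrow> A p = (\<lambda>x. 0)"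
  by (simp add: endo_seqs_def)

lemma ES_I: "(\<And>p. p \<le> M \<Longrightarrow> A p \<in> endos (SP p)) \<Longrightarrow> (\<And>p. p > M \<Longrightarrow> A p = (\<lambda>x. 0)) \<Longrightarrow> A \<in> ES"
  by (simp add: endo_seqs_def)

lemma ES_eqI:
  assumes "A \<in> ES" "B \<in> ES" "\<And>p. p \<le> M \<Longrightarrow> A p = B p" shows "A = B"
proof
  fix p show "A p = B p" using assms ES_high[of A p] ES_high[of B p] by (cases "p \<le> M") auto
qed

lemma cprod_le: "p \<le> M \<Longrightarrow> (A \<circledast> B) p = (\<lambda>x. \<Sum>l\<le>p. conv l (A l) (p - l) (B (p - l)) x)"
  by (simp add: conv_prod_def)

lemma cprod_term_endos:
  assumes "A \<in> ES" "B \<in> ES" "l \<le> p" "p \<le> M"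
  shows "conv l (A l) (p - l) (B (p - l)) \<in> endos (SP p)"
  using conv_endos[OF ES_endos[OF assms(1), of l] ES_endos[OF assms(2), of "p - l"]] assms(3,4) by simp

lemma cprod_closed: "A \<in> ES \<Longrightarrow> B \<in> ES \<Longrightarrow> A \<circledast> B \<in> ES"
proof (rule ES_I)
  fix p assume "A \<in> ES" "B \<in> ES" "p \<le> M"
  then show "(A \<circledast> B) p \<in> endos (SP p)"
    unfolding cprod_le[OF \<open>p \<le> M\<close>] by (intro sum_endos subspace_SP cprod_term_endos) auto
qed (simp add: conv_prod_def)

lemma unit_closed: "unit_seq \<in> ES"
  by (rule ES_I) (auto simp: conv_unit_def id_SP zero_endos subspace_SP)

lemma zero_closed: "(\<lambda>p x. 0) \<in> ES"
  by (rule ES_I) (auto simp: zero_endos subspace_SP)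

lemma add_closed: "A \<in> ES \<Longrightarrow> B \<in> ES \<Longrightarrow> (\<lambda>p x. A p x + B p x) \<in> ES"
  by (rule ES_I) (simp_all add: ES_endos add_endos subspace_SP ES_high fun_eq_iff)

lemma scale_closed: "A \<in> ES \<Longrightarrow> (\<lambda>p x. tscale c (A p x)) \<in> ES"
proof (rule ES_I)
  show "(\<lambda>x. tscale c (A p x)) = (\<lambda>x. 0)" if "A \<in> ES" "p > M" for p
    using that by (simp add: ES_high fun_eq_iff tscale_def)
qed (simp_all add: ES_endos scale_endos subspace_SP)

lemma comp_closed: "A \<in> ES \<Longrightarrow> B \<in> ES \<Longrightarrow> comp_prod A B \<in> ES"
  unfolding comp_prod_def
  by (rule ES_I) (simp_all add: ES_endos endos_comp subspace_SP ES_high fun_eq_iff)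

lemma cprod_add_left:
  assumes "A \<in> ES" "B \<in> ES" "C \<in> ES"
  shows "(\<lambda>p x. A p x + B p x) \<circledast> C = (\<lambda>p x. (A \<circledast> C) p x + (B \<circledast> C) p x)"
proof (rule ext, rule ext)
  fix p x
  show "((\<lambda>p x. A p x + B p x) \<circledast> C) p x = (A \<circledast> C) p x + (B \<circledast> C) p x"
  proof (cases "p \<le> M")
    case True
    then have "conv l (\<lambda>x. A l x + B l x) (p - l) (C (p - l)) x =
        conv l (A l) (p - l) (C (p - l)) x + conv l (B l) (p - l) (C (p - l)) x" if "l \<le> p" for l
      using that by (simp add: conv_add_left ES_endos assms)
    then show ?thesis using True by (simp add: cprod_le sum.distrib[symmetric])
  qed (simp add: conv_prod_def)
qed

lemma cprod_scale_left:
  assumes "A \<in> ES" "C \<in> ES"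
  shows "(\<lambda>p x. tscale c (A p x)) \<circledast> C = (\<lambda>p x. tscale c ((A \<circledast> C) p x))"
proof (rule ext, rule ext)
  fix p x
  show "((\<lambda>p x. tscale c (A p x)) \<circledast> C) p x = tscale c ((A \<circledast> C) p x)"
  proof (cases "p \<le> M")
    case True
    then have "conv l (\<lambda>x. tscale c (A l x)) (p - l) (C (p - l)) x =
        tscale c (conv l (A l) (p - l) (C (p - l)) x)" if "l \<le> p" for l
      using that by (simp add: conv_scale_left ES_endos assms)
    then show ?thesis using True by (simp add: cprod_le tensor.scale_sum_right)
  qed (simp add: conv_prod_def)
qed

text \<open>Both sides run over all triples of degrees with sum p, grouped by the last degree on the
  left and by the first on the right.\<close>

lemma sum_triangle_assoc:
  fixes \<phi> :: "nat \<Rightarrow> nat \<Rightarrow> nat \<Rightarrow> 'b::comm_monoid_add"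
  shows "(\<Sum>l\<le>p. \<Sum>m\<le>l. \<phi> m (l - m) (p - l)) = (\<Sum>m\<le>p. \<Sum>n\<le>p - m. \<phi> m n (p - m - n))"
proof -
  have "(\<Sum>(l, m)\<in>(SIGMA l:{..p}. {..l}). \<phi> m (l - m) (p - l)) =
      (\<Sum>(m, n)\<in>(SIGMA m:{..p}. {..p - m}). \<phi> m n (p - m - n))"
    by (rule sum.reindex_bij_witness[of _ "\<lambda>(m, n). (m + n, m)" "\<lambda>(l, m). (m, l - m)"]) auto
  then show ?thesis by (simp add: sum.Sigma)
qed

lemma cprod_assoc:
  assumes A: "A \<in> ES" and B: "B \<in> ES" and C: "C \<in> ES"
  shows "(A \<circledast> B) \<circledast> C = A \<circledast> (B \<circledast> C)"
proof (rule ES_eqI)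
  fix p assume p: "p \<le> M"
  note e = ES_endos[OF A] ES_endos[OF B] ES_endos[OF C]
  show "((A \<circledast> B) \<circledast> C) p = (A \<circledast> (B \<circledast> C)) p"
  proof
    fix x
    have "((A \<circledast> B) \<circledast> C) p x =
        (\<Sum>l\<le>p. \<Sum>m\<le>l. conv l (conv m (A m) (l - m) (B (l - m))) (p - l) (C (p - l)) x)"
      unfolding cprod_le[OF p]
    proof (rule sum.cong[OF refl])
      fix l assume l: "l \<in> {..p}"
      then have "l \<le> M" using p by simp
      show "conv l ((A \<circledast> B) l) (p - l) (C (p - l)) x =
          (\<Sum>m\<le>l. conv l (conv m (A m) (l - m) (B (l - m))) (p - l) (C (p - l)) x)"
        unfolding cprod_le[OF \<open>l \<le> M\<close>]
        by (rule fun_cong[OF conv_sum_left]; (rule cprod_term_endos[OF A B] | rule e))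
          (use l p in simp_all)
    qed
    \<comment> \<open>Writing l as m + (l - m) shows the summand as a function of the three degrees,
      the form \<open>sum_triangle_assoc\<close> expects.\<close>
    also have "\<dots> = (\<Sum>l\<le>p. \<Sum>m\<le>l.
        conv (m + (l - m)) (conv m (A m) (l - m) (B (l - m))) (p - l) (C (p - l)) x)"
      by (intro sum.cong refl) simp
    also have "\<dots> = (\<Sum>m\<le>p. \<Sum>n\<le>p - m. conv (m + n) (conv m (A m) n (B n)) (p - m - n) (C (p - m - n)) x)"
      by (rule sum_triangle_assoc)
    also have "\<dots> = (\<Sum>m\<le>p. \<Sum>n\<le>p - m. conv m (A m) (n + (p - m - n)) (conv n (B n) (p - m - n) (C (p - m - n))) x)"
      by (intro sum.cong refl fun_cong[OF conv_assoc] e) (use p in auto)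
    also have "\<dots> = (\<Sum>m\<le>p. \<Sum>n\<le>p - m. conv m (A m) (p - m) (conv n (B n) (p - m - n) (C (p - m - n))) x)"
      by (intro sum.cong refl) simp
    also have "\<dots> = (A \<circledast> (B \<circledast> C)) p x"
      unfolding cprod_le[OF p]
    proof (rule sum.cong[OF refl])
      fix m assume m: "m \<in> {..p}"
      then have "p - m \<le> M" using p by simp
      show "(\<Sum>n\<le>p - m. conv m (A m) (p - m) (conv n (B n) (p - m - n) (C (p - m - n))) x) =
          conv m (A m) (p - m) ((B \<circledast> C) (p - m)) x"
        unfolding cprod_le[OF \<open>p - m \<le> M\<close>]
        by (rule fun_cong[OF conv_sum_right[symmetric]]; (rule cprod_term_endos[OF B C] | rule e))
          (use m p in simp_all)
    qed
    finally show "((A \<circledast> B) \<circledast> C) p x = (A \<circledast> (B \<circledast> C)) p x" .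
  qed
qed (intro cprod_closed A B C)+

lemma cprod_unit_left:
  assumes A: "A \<in> ES" shows "unit_seq \<circledast> A = A"
proof (rule ES_eqI[OF cprod_closed[OF unit_closed A] A])
  fix p assume p: "p \<le> M"
  have "conv l (unit_seq l) (p - l) (A (p - l)) x = (if l = 0 then A p x else 0)" for l x
    using conv_unit_left[OF ES_endos[OF A p]] conv_zero_left[OF ES_endos[OF A, of "p - l"], of l] p
    by (simp add: conv_unit_def)
  then show "(unit_seq \<circledast> A) p = A p" by (simp add: cprod_le[OF p])
qed

lemma cprod_unit_right:
  assumes A: "A \<in> ES" shows "A \<circledast> unit_seq = A"
proof (rule ES_eqI[OF cprod_closed[OF A unit_closed] A])
  fix p assume p: "p \<le> M"
  have "conv l (A l) (p - l) (unit_seq (p - l)) x = (if l = p then A p x else 0)" if "l \<le> p" for l x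
    using conv_unit_right[OF ES_endos[OF A p]] conv_zero_right[OF ES_endos[OF A, of l], of "p - l"] p that
    by (auto simp: conv_unit_def)
  then have "(A \<circledast> unit_seq) p x = (\<Sum>l\<le>p. if l = p then A p x else 0)" for x
    unfolding cprod_le[OF p] by (intro sum.cong) auto
  then show "(A \<circledast> unit_seq) p = A p" by (simp add: fun_eq_iff)
qed

lemma exists_left_inverse:
  assumes U: "U \<in> ES" "U 0 = id_on (SP 0)"
  shows "\<exists>X\<in>ES. X 0 = id_on (SP 0) \<and> X \<circledast> U = unit_seq"
proof -
  define X where "X p = (if p \<le> M then conv_left_inv U p else (\<lambda>x. 0))" for p
  have endo: "conv_left_inv U p \<in> endos (SP p)" if "p \<le> M" for p
    using that
  proof (induction p rule: less_induct)
    case (less p)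
    have "conv l (conv_left_inv U l) (p - l) (U (p - l)) \<in> endos (SP p)" if "l < p" for l
      using conv_endos[OF less.IH[OF that] ES_endos[OF U(1), of "p - l"]] that less.prems by simp
    then have "(\<lambda>x. tscale (-1) (\<Sum>l<p. conv l (conv_left_inv U l) (p - l) (U (p - l)) x)) \<in> endos (SP p)"
      by (intro scale_endos sum_endos subspace_SP) simp
    then show ?case
      using conv_left_inv.simps[of U p] id_SP[of 0] by (cases "p = 0") (simp_all only: if_False simp_thms if_True)
  qed
  have X: "X \<in> ES" by (rule ES_I) (simp_all add: X_def endo)
  have X0: "X 0 = id_on (SP 0)" by (simp add: X_def conv_left_inv.simps)
  have "X \<circledast> U = unit_seq"
  proof (rule ES_eqI[OF cprod_closed[OF X U(1)] unit_closed])
    fix p assume p: "p \<le> M"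
    show "(X \<circledast> U) p = unit_seq p"
    proof (cases "p = 0")
      case True
      then show ?thesis using conv_unit_left[OF ES_endos[OF U(1) le0]] X0 U(2)
        by (simp add: cprod_le conv_unit_def)
    next
      case False
      let ?s = "\<lambda>x. \<Sum>l<p. conv l (X l) (p - l) (U (p - l)) x"
      have "X p = (\<lambda>x. tscale (-1) (?s x))"
        using p False conv_left_inv.simps[of U p] by (simp add: X_def)
      then have "X p x + ?s x = 0" for x
        using tensor.scale_minus_left[of 1 "?s x"] by simp
      \<comment> \<open>The summand l = p is X p convolved with the identity in degree 0, that is, X
        p itself.\<close>
      moreover have "(X \<circledast> U) p x = ?s x + X p x" for x
        using conv_unit_right[OF ES_endos[OF X p]] U(2)
        by (simp add: cprod_le[OF p] lessThan_Suc_atMost[symmetric])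
      ultimately show ?thesis using False by (simp add: conv_unit_def fun_eq_iff add.commute)
    qed
  qed
  then show ?thesis using X X0 by blast
qed

abbreviation E :: "'v endo_seq" where
  "E \<equiv> conv_exp scale \<sigma> M"

abbreviation E' :: "'v endo_seq" where
  "E' \<equiv> conv_exp_inv scale \<sigma> M"

lemma E_closed: "E \<in> ES"
  by (rule ES_I) (simp_all add: conv_exp_def id_SP)

text \<open>The left inverse X of \<open>E\<close> has a left inverse Y of its own, and
  associativity forces Y = \<open>E\<close>; hence X is two-sided. Uniqueness is included because
  \<open>conv_exp_inv\<close> is a definite description.\<close>

lemma E'_props: "E' \<in> ES" "E \<circledast> E' = unit_seq" "E' \<circledast> E = unit_seq"
proof -
  obtain X where X: "X \<in> ES" "X 0 = id_on (SP 0)" "X \<circledast> E = unit_seq"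
    using exists_left_inverse[OF E_closed] by (auto simp: conv_exp_def)
  obtain Y where Y: "Y \<in> ES" "Y \<circledast> X = unit_seq"
    using exists_left_inverse[OF X(1,2)] by blast
  have "Y = (Y \<circledast> X) \<circledast> E"
    using cprod_assoc[OF Y(1) X(1) E_closed] X(3) cprod_unit_right[OF Y(1)] by simp
  then have "Y = E" using Y(2) cprod_unit_left[OF E_closed] by simp
  then have EX: "E \<circledast> X = unit_seq" using Y(2) by simp
  have "Z = X" if "Z \<in> ES" "Z \<circledast> E = unit_seq" for Z
    using cprod_assoc[OF that(1) E_closed X(1)] that EX cprod_unit_left[OF X(1)]
      cprod_unit_right[OF that(1)] by simp
  then have "\<exists>!Z. Z \<in> ES \<and> E \<circledast> Z = unit_seq \<and> Z \<circledast> E = unit_seq" using X EX by blast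
  from theI'[OF this] show "E' \<in> ES" "E \<circledast> E' = unit_seq" "E' \<circledast> E = unit_seq"
    unfolding conv_exp_inv_def by blast+
qed

section \<open>The third product\<close>

abbreviation al :: "'v endo_seq \<Rightarrow> 'v endo_seq" where "al \<equiv> alpha scale \<sigma> M"
abbreviation be :: "'v endo_seq \<Rightarrow> 'v endo_seq" where "be \<equiv> alpha_inv scale \<sigma> M"
abbreviation third :: "'v endo_seq \<Rightarrow> 'v endo_seq \<Rightarrow> 'v endo_seq" (infixl "\<boxtimes>" 70) where
  "A \<boxtimes> B \<equiv> third_prod scale \<sigma> M A B"

lemma al_closed: "A \<in> ES \<Longrightarrow> al A \<in> ES"
  by (simp add: alpha_def cprod_closed E_closed)

lemma be_closed: "A \<in> ES \<Longrightarrow> be A \<in> ES"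
  by (simp add: alpha_inv_def cprod_closed E'_props)

lemma al_be: "A \<in> ES \<Longrightarrow> al (be A) = A"
  by (simp add: alpha_def alpha_inv_def cprod_assoc E_closed E'_props cprod_unit_right)

lemma be_al: "A \<in> ES \<Longrightarrow> be (al A) = A"
  by (simp add: alpha_def alpha_inv_def cprod_assoc E_closed E'_props cprod_unit_right)

lemma al_unit: "al unit_seq = E"
  by (simp add: alpha_def cprod_unit_left E_closed)

lemma al_add: "A \<in> ES \<Longrightarrow> B \<in> ES \<Longrightarrow> al (\<lambda>p x. A p x + B p x) = (\<lambda>p x. al A p x + al B p x)"
  by (simp add: alpha_def cprod_add_left E_closed)

lemma be_add: "A \<in> ES \<Longrightarrow> B \<in> ES \<Longrightarrow> be (\<lambda>p x. A p x + B p x) = (\<lambda>p x. be A p x + be B p x)"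
  by (simp add: alpha_inv_def cprod_add_left E'_props)

lemma al_scale: "A \<in> ES \<Longrightarrow> al (\<lambda>p x. tscale c (A p x)) = (\<lambda>p x. tscale c (al A p x))"
  by (simp add: alpha_def cprod_scale_left E_closed)

lemma be_scale: "A \<in> ES \<Longrightarrow> be (\<lambda>p x. tscale c (A p x)) = (\<lambda>p x. tscale c (be A p x))"
  by (simp add: alpha_inv_def cprod_scale_left E'_props)

lemma comp_E:
  assumes "A \<in> ES" shows "comp_prod E A = A" "comp_prod A E = A"
proof -
  \<comment> \<open>For x outside \<open>SP p\<close> the map \<open>id_on\<close> returns 0, so the
    first equation relies on A p vanishing both at 0 and at x.\<close>
  have "A p (id_on (SP p) x) = A p x" "id_on (SP p) (A p x) = A p x" if "p \<le> M" for p x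
    using ES_endos[OF assms that] lin_on_0[OF lin_on_endos[OF ES_endos[OF assms that]] tensor.subspace_0[OF subspace_SP]]
      tensor.subspace_0[OF subspace_SP, of p]
    by (auto simp: id_on_def endos_iff)
  then have eq: "comp_prod E A p = A p" "comp_prod A E p = A p" if "p \<le> M" for p
    using that by (simp_all add: comp_prod_def conv_exp_def comp_def)
  show "comp_prod E A = A" by (rule ES_eqI[OF comp_closed[OF E_closed assms] assms eq(1)])
  show "comp_prod A E = A" by (rule ES_eqI[OF comp_closed[OF assms E_closed] assms eq(2)])
qed

text \<open>For p \<le> M the inner values lie in \<open>SP p\<close> for every x, since they are 0
  when x is outside, and A p is linear there; for p > M the map A p is 0.\<close>

lemma ES_lin:
  assumes "A \<in> ES" "B \<in> ES" "C \<in> ES"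
  shows "A p (B p x + C p x) = A p (B p x) + A p (C p x)"
    and "A p (tscale c (B p x)) = tscale c (A p (B p x))"
proof -
  have "B p x \<in> SP p \<and> C p x \<in> SP p \<and> lin_on (SP p) (A p)" if "p \<le> M"
    using ES_endos[OF assms(1) that] ES_endos[OF assms(2) that] ES_endos[OF assms(3) that]
      tensor.subspace_0[OF subspace_SP, of p] unfolding endos_iff by metis
  then show "A p (B p x + C p x) = A p (B p x) + A p (C p x)"
    "A p (tscale c (B p x)) = tscale c (A p (B p x))"
    using ES_high[OF assms(1), of p] unfolding lin_on_def by (cases "p \<le> M"; simp)+
qed

lemma third_closed: "A \<in> ES \<Longrightarrow> B \<in> ES \<Longrightarrow> A \<boxtimes> B \<in> ES"
  by (simp add: third_prod_def be_closed comp_closed al_closed)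

text \<open>\<open>al\<close> cancels the inner \<open>be\<close>, so both sides become
  \<open>be\<close> of the same threefold composition.\<close>

lemma third_assoc: "A \<in> ES \<Longrightarrow> B \<in> ES \<Longrightarrow> C \<in> ES \<Longrightarrow> (A \<boxtimes> B) \<boxtimes> C = A \<boxtimes> (B \<boxtimes> C)"
  by (simp add: third_prod_def al_be comp_closed al_closed) (simp add: comp_prod_def comp_assoc)

lemma third_unit: "A \<in> ES \<Longrightarrow> unit_seq \<boxtimes> A = A" "A \<in> ES \<Longrightarrow> A \<boxtimes> unit_seq = A"
  by (simp_all add: third_prod_def al_unit comp_E al_closed be_al)

lemma third_add_left:
  assumes "A \<in> ES" "B \<in> ES" "C \<in> ES"
  shows "(\<lambda>p x. A p x + B p x) \<boxtimes> C = (\<lambda>p x. (A \<boxtimes> C) p x + (B \<boxtimes> C) p x)"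
proof -
  have "comp_prod (\<lambda>p x. al A p x + al B p x) (al C) =
      (\<lambda>p x. comp_prod (al A) (al C) p x + comp_prod (al B) (al C) p x)"
    by (simp add: comp_prod_def comp_def)
  then show ?thesis
    by (simp add: third_prod_def al_add be_add comp_closed al_closed assms)
qed

lemma third_add_right:
  assumes "A \<in> ES" "B \<in> ES" "C \<in> ES"
  shows "C \<boxtimes> (\<lambda>p x. A p x + B p x) = (\<lambda>p x. (C \<boxtimes> A) p x + (C \<boxtimes> B) p x)"
proof -
  \<comment> \<open>Composition is additive in its left argument pointwise, but in its right
    argument only through linearity of the left factor, hence \<open>ES_lin\<close>.\<close>
  have "comp_prod (al C) (\<lambda>p x. al A p x + al B p x) =
      (\<lambda>p x. comp_prod (al C) (al A) p x + comp_prod (al C) (al B) p x)"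
    using ES_lin(1)[OF al_closed al_closed al_closed, OF assms(3,1,2)] by (simp add: comp_prod_def comp_def)
  then show ?thesis
    by (simp add: third_prod_def al_add be_add comp_closed al_closed assms)
qed

lemma third_scale_left:
  assumes "A \<in> ES" "C \<in> ES"
  shows "(\<lambda>p x. tscale c (A p x)) \<boxtimes> C = (\<lambda>p x. tscale c ((A \<boxtimes> C) p x))"
proof -
  have "comp_prod (\<lambda>p x. tscale c (al A p x)) (al C) = (\<lambda>p x. tscale c (comp_prod (al A) (al C) p x))"
    by (simp add: comp_prod_def comp_def)
  then show ?thesis
    by (simp add: third_prod_def al_scale be_scale comp_closed al_closed assms)
qed

lemma third_scale_right:
  assumes "A \<in> ES" "C \<in> ES"
  shows "C \<boxtimes> (\<lambda>p x. tscale c (A p x)) = (\<lambda>p x. tscale c ((C \<boxtimes> A) p x))"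
proof -
  have "comp_prod (al C) (\<lambda>p x. tscale c (al A p x)) = (\<lambda>p x. tscale c (comp_prod (al C) (al A) p x))"
    using ES_lin(2)[OF al_closed al_closed al_closed, OF assms(2,1,1)] by (simp add: comp_prod_def comp_def)
  then show ?thesis
    by (simp add: third_prod_def al_scale be_scale comp_closed al_closed assms)
qed

lemma third_algebra_assoc_algebra: "assoc_algebra complex_ring (third_algebra scale \<sigma> M)"
proof -
  let ?T = "third_algebra scale \<sigma> M"
  have C: "cring complex_ring"
  proof (rule cringI)
    show "abelian_group complex_ring"
    proof (rule abelian_groupI)
      fix x :: complex
      show "\<exists>y\<in>carrier complex_ring. y \<oplus>\<^bsub>complex_ring\<^esub> x = \<zero>\<^bsub>complex_ring\<^esub>"
        by (auto simp: complex_ring_def intro!: exI[of _ "- x"])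
    qed (auto simp: complex_ring_def)
    show "comm_monoid complex_ring"
      by (rule comm_monoidI) (auto simp: complex_ring_def)
  qed (auto simp: complex_ring_def distrib_right)
  have G: "abelian_group ?T"
  proof (rule abelian_groupI)
    fix A assume "A \<in> carrier ?T"
    then have A: "A \<in> ES" by (simp add: third_algebra_def)
    \<comment> \<open>Additive inverses are taken as multiples by -1, so that
      \<open>scale_closed\<close> gives membership.\<close>
    have "tscale (-1) y + y = 0" for y :: "'v tensor"
      using tensor.scale_minus_left[of 1 y] by simp
    then show "\<exists>B\<in>carrier ?T. B \<oplus>\<^bsub>?T\<^esub> A = \<zero>\<^bsub>?T\<^esub>"
      using scale_closed[OF A, of "-1"] by (auto simp: third_algebra_def intro!: bexI)
  qed (simp_all add: third_algebra_def add_closed zero_closed add_ac)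
  have Mo: "module complex_ring ?T"
    by (rule moduleI[OF C G])
      (simp_all add: third_algebra_def complex_ring_def scale_closed tensor.scale_left_distrib
        tensor.scale_right_distrib)
  have Ri: "ring ?T"
  proof (rule ringI[OF G])
    show "monoid ?T"
      by (rule monoidI)
        (simp_all add: third_algebra_def third_closed unit_closed third_assoc third_unit)
  qed (simp_all add: third_algebra_def third_add_left third_add_right)
  show ?thesis
    by (intro assoc_algebra.intro Mo Ri assoc_algebra_axioms.intro)
      (simp_all add: third_algebra_def third_scale_left third_scale_right)
qed

end

theorem proposition2p5:
  fixes scale :: "complex \<Rightarrow> 'v::ab_group_add \<Rightarrow> 'v"
    and \<sigma> :: "'v tensor \<Rightarrow> 'v tensor"
    and \<nu> :: complex
    and M :: nat
  assumes "vector_space scale"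
    and "braiding scale \<sigma>"
    and "hecke_type scale \<sigma> \<nu>"
    and "\<forall>n>0. \<nu> ^ n \<noteq> 1"
    and "has_dim (Ssym scale \<sigma> M) 1"
    and "\<forall>p>M. has_dim (Ssym scale \<sigma> p) 0"
  shows "assoc_algebra complex_ring (third_algebra scale \<sigma> M)"
proof -
  interpret braided_space_trunc scale \<sigma> M
    by (intro braided_space_trunc.intro braided_space.intro tensor_algebra.intro
        braided_space_axioms.intro assms)
  show ?thesis by (rule third_algebra_assoc_algebra)
qed

end
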